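(* Assume that the set-valued mapping $F:\mathbb{R}^n\rightrightarrows\mathbb{R}^m$ has locally closed graph at $(\bar x,\bar y)\in\mathrm{gph}\,F$. Then the following statements are equivalent: (i) $F$ is strictly proto-differentiable at $\bar x$ for $\bar y$. (ii) $F$ is graphically strictly differentiable at $(\bar x,\bar y)$. (iii) $F$ is graphically Lipschitzian of dimension $d$ around $(\bar x,\bar y)$ and $\widehat T_{\mathrm{gph}\,F}(\bar x,\bar y)$ is a $d$-dimensional subspace (for some $d$). (iv) $F$ is graphically Lipschitzian around $(\bar x,\bar y)$ and $\mathrm{gph}\,D_*F(\bar x,\bar y)$ is a subspace. (v) $F$ is graphically Lipschitzian around $(\bar x,\bar y)$ and $\mathrm{gph}\,D^*F(\bar x,\bar y)$ is a subspace. (vi) $F$ is both graphically Lipschitzian around $(\bar x,\bar y)$ and graphically regular at $(\bar x,\bar y)$. (vii) $F$ is graphically Lipschitzian around $(\bar x,\bar y)$ and $\tilde{\mathcal S}F(\bar x,\bar y)$ is a singleton. (viii) $F$ is graphically Lipschitzian around $(\bar x,\bar y)$ and $\tilde{\mathcal S}^*F(\bar x,\bar y)$ is a singleton. In every case there holds $\dim\mathrm{gph}\,D_*F(\bar x,\bar y)=\dim\mathrm{gph}\,DF(\bar x,\bar y)=\dim\widehat T_{\mathrm{gph}\,F}(\bar x,\bar y)=d$ and $\dim\mathrm{gph}\,D^*F(\bar x,\bar y)=n+m-d$, where $d$ is the dimension of the graphical Lipschitz property of $F$, and $\tilde{\mathcal S}F(\bar x,\bar y)=\{\mathrm{gph}\,DF(\bar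 x,\bar y)\}$, $\tilde{\mathcal S}^*F(\bar x,\bar y)=\{\mathrm{gph}\,D^*F(\bar x,\bar y)\}$.
   Context: $\mathrm{gph}\,F=\{(x,y)\mid y\in F(x)\}$. Set limits are in the Painlevé–Kuratowski sense: for a family $C_t$ of sets, $\limsup_{t\to\bar t}C_t=\{x\mid\liminf_{t\to\bar t}\mathrm{dist}(x,C_t)=0\}$ and $\liminf_{t\to\bar t}C_t=\{x\mid\limsup_{t\to\bar t}\mathrm{dist}(x,C_t)=0\}$; the limit exists if both coincide. The polar cone of $A$ is $A^\circ=\{v\mid\langle v,a\rangle\le0\ \forall a\in A\}$. For a set $\Omega\subset\mathbb{R}^N$ and $\bar z\in\Omega$: tangent cone $T_\Omega(\bar z)=\limsup_{t\downarrow0}\frac{\Omega-\bar z}{t}$; regular (Clarke) tangent cone $\widehat T_\Omega(\bar z)=\liminf_{z\to\bar z,\,z\in\Omega,\,t\downarrow0}\frac{\Omega-z}{t}$; paratingent cone $T^P_\Omega(\bar z)=\limsup_{z\to\bar z,\,z\in\Omega,\,t\downarrow0}\frac{\Omega-z}{t}$; regular normal cone $\widehat N_\Omega(\bar z)=(T_\Omega(\bar z))^\circ$; limiting normal cone $N_\Omega(\bar z)=\limsup_{z\to\bar z,\,z\in\Omega}\widehat N_\Omega(z)$. For $F:\mathbb{R}^n\rightrightarrows\mathbb{R}^m$ and $(\bar x,\bar y)\in\mathrm{gph}\,F$: the strict derivative, graphical derivative and limiting coderivative are the set-valued mappings given by $\mathrm{gph}\,D_*F(\bar x,\bar y)=T^P_{\mathrm{gph}\,F}(\bar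 x,\bar y)$, $\mathrm{gph}\,DF(\bar x,\bar y)=T_{\mathrm{gph}\,F}(\bar x,\bar y)$, $\mathrm{gph}\,D^*F(\bar x,\bar y)=\{(y^*,x^* )\in\mathbb{R}^m\times\mathbb{R}^n\mid(x^*,-y^* )\in N_{\mathrm{gph}\,F}(\bar x,\bar y)\}$. $F$ is strictly proto-differentiable at $\bar x$ for $\bar y$ if $\mathrm{gph}\,F$ is strictly smooth at $(\bar x,\bar y)$, i.e. the limit of $\frac{\mathrm{gph}\,F-(x,y)}{t}$ exists as $(x,y)\to(\bar x,\bar y)$ in $\mathrm{gph}\,F$ and $t\downarrow0$ (equivalently $\widehat T_{\mathrm{gph}\,F}(\bar x,\bar y)=T^P_{\mathrm{gph}\,F}(\bar x,\bar y)$). $F$ is graphically regular at $(\bar x,\bar y)$ if $\widehat N_{\mathrm{gph}\,F}(\bar x,\bar y)=N_{\mathrm{gph}\,F}(\bar x,\bar y)$. A set $\Omega\subset\mathbb{R}^N$ is a Lipschitz manifold of dimension $d$ around $\bar z\in\Omega$ ($0\le d\le N$, $\mathbb{R}^0=\{0\}$) if there is an open neighborhood $W$ of $\bar z$ and a one-to-one mapping $\Phi$ from $W$ onto an open subset of $\mathbb{R}^N$, with $\Phi,\Phi^{-1}$ continuously differentiable, such that $\Phi(\Omega\cap W)$ is the graph of a Lipschitz continuous mapping $f:U\to\mathbb{R}^{N-d}$, $U$ open in $\mathbb{R}^d$. $F$ is graphically Lipschitzian of dimension $d$ around $(\bar x,\bar y)$ if $\mathrm{gph}\,F$ is a Lipschitz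 manifold of dimension $d$ around $(\bar x,\bar y)$ (without mention of $d$: for some $d$). $F$ is graphically strictly differentiable at $(\bar x,\bar y)$ (of dimension $d$) if there is an open neighborhood $W$ of $(\bar x,\bar y)$ and a one-to-one mapping $\Phi$ from $W$ onto an open subset of $\mathbb{R}^{n+m}$, with $\Phi,\Phi^{-1}$ continuously differentiable, such that $\Phi(\mathrm{gph}\,F\cap W)$ is the graph of a Lipschitz continuous mapping $f:U\to\mathbb{R}^{n+m-d}$, $U$ open in $\mathbb{R}^d$ (so that $\mathrm{gph}\,F$ is a Lipschitz manifold of dimension $d$ around $(\bar x,\bar y)$), and such that $f$ is strictly differentiable at $\bar u$, where $(\bar u,f(\bar u))=\Phi(\bar x,\bar y)$. Strict differentiability of $f$ at $\bar u$ means that there is a matrix $A$ with $\lim_{u,u'\to\bar u,\,u\neq u'}\frac{f(u')-f(u)-A(u'-u)}{\|u'-u\|}=0$. Let $\tilde{\mathcal Z}_{nm}$ be the set of all subspaces of $\mathbb{R}^n\times\mathbb{R}^m$ with the metric $d_{\mathcal Z}(L_1,L_2)=\|P_{L_1}-P_{L_2}\|$, $P_L$ being the orthogonal projection onto $L$. For $L\in\tilde{\mathcal Z}_{nm}$ its adjoint is $L^*=\{(y^*,x^* )\in\mathbb{R}^m\times\mathbb{R}^n\mid(x^*,-y^* )\in L^\perp\}$. Let $\tilde{\mathcal O}_F$ be the set of all $(x,y)\in\mathrm{gph}\,F$ such that $T_{\mathrm{gph}\,F}(x,y)$ is a subspace (of any dimension). The generalized SC derivative is $\tilde{\mathcal S}F(x,y)=\{L\in\tilde{\mathcal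 Z}_{nm}\mid\exists(x_k,y_k)\to(x,y),\ (x_k,y_k)\in\tilde{\mathcal O}_F:\ \lim_{k\to\infty}d_{\mathcal Z}(T_{\mathrm{gph}\,F}(x_k,y_k),L)=0\}$, and $\tilde{\mathcal S}^*F(x,y)=\{L^*\mid L\in\tilde{\mathcal S}F(x,y)\}$. *)

theory Defs
  imports "HOL-Analysis.Analysis"
begin

section \<open>Painleve-Kuratowski set limits\<close>

text \<open>Unlike \<open>infdist\<close>, the distance to the empty set is \<open>\<infinity>\<close>.\<close>

definition edist_set :: "'a::metric_space \<Rightarrow> 'a set \<Rightarrow> ereal" where
  "edist_set x C = (INF c\<in>C. ereal (dist x c))"

definition outer_limit :: "'i filter \<Rightarrow> ('i \<Rightarrow> 'a::metric_space set) \<Rightarrow> 'a set" where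
  "outer_limit G C = {x. Liminf G (\<lambda>t. edist_set x (C t)) = 0}"

definition inner_limit :: "'i filter \<Rightarrow> ('i \<Rightarrow> 'a::metric_space set) \<Rightarrow> 'a set" where
  "inner_limit G C = {x. Limsup G (\<lambda>t. edist_set x (C t)) = 0}"

definition set_limit_exists :: "'i filter \<Rightarrow> ('i \<Rightarrow> 'a::metric_space set) \<Rightarrow> bool" where
  "set_limit_exists G C \<longleftrightarrow> outer_limit G C = inner_limit G C"

section \<open>Tangent and normal cones\<close>

text \<open>The filter of \<open>z' \<rightarrow> z\<close> with \<open>z' \<in> \<Omega>\<close>. In contrast to \<open>at z within \<Omega>\<close>, the value
  \<open>z' = z\<close> is admitted.\<close>

definition nhds_in :: "'a::topological_space set \<Rightarrow> 'a \<Rightarrow> 'a filter" where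
  "nhds_in \<Omega> z = inf (nhds z) (principal \<Omega>)"

definition diff_quot :: "'a::real_normed_vector set \<Rightarrow> 'a \<Rightarrow> real \<Rightarrow> 'a set" where
  "diff_quot \<Omega> z t = (\<lambda>w. (w - z) /\<^sub>R t) ` \<Omega>"

definition tangent_cone :: "'a::real_normed_vector set \<Rightarrow> 'a \<Rightarrow> 'a set" where
  "tangent_cone \<Omega> z = outer_limit (at_right 0) (diff_quot \<Omega> z)"

definition regular_tangent_cone :: "'a::real_normed_vector set \<Rightarrow> 'a \<Rightarrow> 'a set" where
  "regular_tangent_cone \<Omega> z =
     inner_limit (nhds_in \<Omega> z \<times>\<^sub>F at_right 0) (\<lambda>(z', t). diff_quot \<Omega> z' t)"

definition paratingent_cone :: "'a::real_normed_vector set \<Rightarrow> 'a \<Rightarrow> 'a set" where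
  "paratingent_cone \<Omega> z =
     outer_limit (nhds_in \<Omega> z \<times>\<^sub>F at_right 0) (\<lambda>(z', t). diff_quot \<Omega> z' t)"

definition strictly_smooth :: "'a::real_normed_vector set \<Rightarrow> 'a \<Rightarrow> bool" where
  "strictly_smooth \<Omega> z \<longleftrightarrow>
     set_limit_exists (nhds_in \<Omega> z \<times>\<^sub>F at_right 0) (\<lambda>(z', t). diff_quot \<Omega> z' t)"

definition polar_cone :: "'a::real_inner set \<Rightarrow> 'a set" where
  "polar_cone A = {v. \<forall>a\<in>A. inner v a \<le> 0}"

definition regular_normal_cone :: "'a::real_inner set \<Rightarrow> 'a \<Rightarrow> 'a set" where
  "regular_normal_cone \<Omega> z = polar_cone (tangent_cone \<Omega> z)"

definition limiting_normal_cone :: "'a::real_inner set \<Rightarrow> 'a \<Rightarrow> 'a set" where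
  "limiting_normal_cone \<Omega> z = outer_limit (nhds_in \<Omega> z) (regular_normal_cone \<Omega>)"

definition locally_closed_at :: "'a::topological_space set \<Rightarrow> 'a \<Rightarrow> bool" where
  "locally_closed_at \<Omega> z \<longleftrightarrow> (\<exists>V. closed V \<and> z \<in> interior V \<and> closed (\<Omega> \<inter> V))"

section \<open>Lipschitz manifolds\<close>

definition continuously_differentiable_on ::
    "('a::real_normed_vector \<Rightarrow> 'b::real_normed_vector) \<Rightarrow> 'a set \<Rightarrow> bool" where
  "continuously_differentiable_on f W \<longleftrightarrow>
     (\<exists>f' :: 'a \<Rightarrow> 'a \<Rightarrow>\<^sub>L 'b.
        (\<forall>x\<in>W. (f has_derivative blinfun_apply (f' x)) (at x)) \<and> continuous_on W f')"

definition C1_diffeo_on :: "('a::euclidean_space \<Rightarrow> 'a) \<Rightarrow> 'a set \<Rightarrow> bool" where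
  "C1_diffeo_on \<Phi> W \<longleftrightarrow>
     open W \<and> inj_on \<Phi> W \<and> open (\<Phi> ` W) \<and>
     continuously_differentiable_on \<Phi> W \<and>
     continuously_differentiable_on (inv_into W \<Phi>) (\<Phi> ` W)"

text \<open>Since the dimension \<open>d\<close> is a variable number in \<open>{0..DIM('a)}\<close>, the splitting of the target space
  \<open>\<real>\<^sup>N\<close> of \<open>\<Phi>\<close> into \<open>\<real>\<^sup>d \<times> \<real>\<^sup>N\<^sup>-\<^sup>d\<close> is a splitting of coordinates: for \<open>S \<subseteq> Basis\<close> with \<open>card S = d\<close>,
  \<open>span S\<close> plays the role of \<open>\<real>\<^sup>d\<close> and \<open>span (Basis - S)\<close> that of \<open>\<real>\<^sup>N\<^sup>-\<^sup>d\<close>, and the pair \<open>(u, f u)\<close>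
  is the vector \<open>u + f u\<close>. Only the values of \<open>f\<close> on \<open>U\<close> matter.\<close>

definition lipschitz_chart ::
    "nat \<Rightarrow> 'a::euclidean_space set \<Rightarrow> 'a \<Rightarrow> 'a set \<Rightarrow> ('a \<Rightarrow> 'a) \<Rightarrow> 'a set \<Rightarrow> 'a set \<Rightarrow> ('a \<Rightarrow> 'a) \<Rightarrow> bool"
where
  "lipschitz_chart d \<Omega> z W \<Phi> S U f \<longleftrightarrow>
     z \<in> W \<and> C1_diffeo_on \<Phi> W \<and>
     S \<subseteq> Basis \<and> card S = d \<and>
     openin (top_of_set (span S)) U \<and>
     f ` U \<subseteq> span (Basis - S) \<and> (\<exists>L. L-lipschitz_on U f) \<and>
     \<Phi> ` (\<Omega> \<inter> W) = (\<lambda>u. u + f u) ` U"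

definition lipschitz_manifold :: "nat \<Rightarrow> 'a::euclidean_space set \<Rightarrow> 'a \<Rightarrow> bool" where
  "lipschitz_manifold d \<Omega> z \<longleftrightarrow> (\<exists>W \<Phi> S U f. lipschitz_chart d \<Omega> z W \<Phi> S U f)"

text \<open>A linear map \<open>\<real>\<^sup>d \<rightarrow> \<real>\<^sup>N\<^sup>-\<^sup>d\<close> is represented by a linear map on the whole space of which only the
  restriction to the linear hull of \<open>U - U\<close> is relevant.\<close>

definition strictly_differentiable_within ::
    "('a::real_normed_vector \<Rightarrow> 'b::real_normed_vector) \<Rightarrow> 'a set \<Rightarrow> 'a \<Rightarrow> bool" where
  "strictly_differentiable_within f U u0 \<longleftrightarrow>
     (\<exists>A. linear A \<and>
        ((\<lambda>(u, u'). (f u' - f u - A (u' - u)) /\<^sub>R norm (u' - u)) \<longlongrightarrow> 0)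
          (at (u0, u0) within {(u, u'). u \<in> U \<and> u' \<in> U \<and> u \<noteq> u'}))"

section \<open>Set-valued mappings\<close>

definition gph :: "('a \<Rightarrow> 'b set) \<Rightarrow> ('a \<times> 'b) set" where
  "gph F = {(x, y). y \<in> F x}"

definition strict_derivative ::
    "('a::euclidean_space \<Rightarrow> 'b::euclidean_space set) \<Rightarrow> 'a \<Rightarrow> 'b \<Rightarrow> 'a \<Rightarrow> 'b set" where
  "strict_derivative F x y = (\<lambda>u. {v. (u, v) \<in> paratingent_cone (gph F) (x, y)})"

definition graphical_derivative ::
    "('a::euclidean_space \<Rightarrow> 'b::euclidean_space set) \<Rightarrow> 'a \<Rightarrow> 'b \<Rightarrow> 'a \<Rightarrow> 'b set" where
  "graphical_derivative F x y = (\<lambda>u. {v. (u, v) \<in> tangent_cone (gph F) (x, y)})"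

definition limiting_coderivative ::
    "('a::euclidean_space \<Rightarrow> 'b::euclidean_space set) \<Rightarrow> 'a \<Rightarrow> 'b \<Rightarrow> 'b \<Rightarrow> 'a set" where
  "limiting_coderivative F x y = (\<lambda>y'. {x'. (x', - y') \<in> limiting_normal_cone (gph F) (x, y)})"

definition strictly_proto_differentiable ::
    "('a::euclidean_space \<Rightarrow> 'b::euclidean_space set) \<Rightarrow> 'a \<Rightarrow> 'b \<Rightarrow> bool" where
  "strictly_proto_differentiable F x y \<longleftrightarrow> strictly_smooth (gph F) (x, y)"

definition graphically_regular ::
    "('a::euclidean_space \<Rightarrow> 'b::euclidean_space set) \<Rightarrow> 'a \<Rightarrow> 'b \<Rightarrow> bool" where
  "graphically_regular F x y \<longleftrightarrow>
     regular_normal_cone (gph F) (x, y) = limiting_normal_cone (gph F) (x, y)"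

definition graphically_lipschitzian_dim ::
    "nat \<Rightarrow> ('a::euclidean_space \<Rightarrow> 'b::euclidean_space set) \<Rightarrow> 'a \<Rightarrow> 'b \<Rightarrow> bool" where
  "graphically_lipschitzian_dim d F x y \<longleftrightarrow> lipschitz_manifold d (gph F) (x, y)"

definition graphically_lipschitzian ::
    "('a::euclidean_space \<Rightarrow> 'b::euclidean_space set) \<Rightarrow> 'a \<Rightarrow> 'b \<Rightarrow> bool" where
  "graphically_lipschitzian F x y \<longleftrightarrow> (\<exists>d. graphically_lipschitzian_dim d F x y)"

definition graphically_strictly_differentiable_dim ::
    "nat \<Rightarrow> ('a::euclidean_space \<Rightarrow> 'b::euclidean_space set) \<Rightarrow> 'a \<Rightarrow> 'b \<Rightarrow> bool" where
  "graphically_strictly_differentiable_dim d F x y \<longleftrightarrow>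
     (\<exists>W \<Phi> S U f u. lipschitz_chart d (gph F) (x, y) W \<Phi> S U f \<and>
        u \<in> U \<and> u + f u = \<Phi> (x, y) \<and> strictly_differentiable_within f U u)"

definition graphically_strictly_differentiable ::
    "('a::euclidean_space \<Rightarrow> 'b::euclidean_space set) \<Rightarrow> 'a \<Rightarrow> 'b \<Rightarrow> bool" where
  "graphically_strictly_differentiable F x y \<longleftrightarrow>
     (\<exists>d. graphically_strictly_differentiable_dim d F x y)"

section \<open>Generalized SC derivatives\<close>

definition orth_proj :: "'a::euclidean_space set \<Rightarrow> 'a \<Rightarrow> 'a" where
  "orth_proj L x = (THE p. p \<in> L \<and> x - p \<in> L\<^sup>\<bottom>)"

definition subspace_dist :: "'a::euclidean_space set \<Rightarrow> 'a set \<Rightarrow> real" where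
  "subspace_dist L1 L2 = onorm (\<lambda>x. orth_proj L1 x - orth_proj L2 x)"

definition adjoint_subspace ::
    "('a::euclidean_space \<times> 'b::euclidean_space) set \<Rightarrow> ('b \<times> 'a) set" where
  "adjoint_subspace L = {(y', x'). (x', - y') \<in> L\<^sup>\<bottom>}"

definition subspace_tangent_points ::
    "('a::euclidean_space \<Rightarrow> 'b::euclidean_space set) \<Rightarrow> ('a \<times> 'b) set" where
  "subspace_tangent_points F = {z \<in> gph F. subspace (tangent_cone (gph F) z)}"

definition SC_derivative ::
    "('a::euclidean_space \<Rightarrow> 'b::euclidean_space set) \<Rightarrow> 'a \<Rightarrow> 'b \<Rightarrow> ('a \<times> 'b) set set" where
  "SC_derivative F x y =
     {L. subspace L \<and>
         (\<exists>z :: nat \<Rightarrow> 'a \<times> 'b. z \<longlonglongrightarrow> (x, y) \<and> (\<forall>k. z k \<in> subspace_tangent_points F) \<and>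
            (\<lambda>k. subspace_dist (tangent_cone (gph F) (z k)) L) \<longlonglongrightarrow> 0)}"

definition adjoint_SC_derivative ::
    "('a::euclidean_space \<Rightarrow> 'b::euclidean_space set) \<Rightarrow> 'a \<Rightarrow> 'b \<Rightarrow> ('b \<times> 'a) set set" where
  "adjoint_SC_derivative F x y = adjoint_subspace ` SC_derivative F x y"

end

theory Submission
  imports Defs
begin

text \<open>
  The statement is about the set \<open>\<Omega> = gph F\<close> at a point \<open>z\<close>. Write \<open>T\<close>, \<open>T\<^sup>C\<close> and \<open>T\<^sup>P\<close> for
  the tangent, the regular tangent and the paratingent cone, so that \<open>T\<^sup>C \<subseteq> T \<subseteq> T\<^sup>P\<close> and strict
  proto-differentiability means \<open>T\<^sup>P \<subseteq> T\<^sup>C\<close>.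

  \<^bold>\<open>Sufficient conditions.\<close> A \<open>C\<^sup>1\<close> diffeomorphism is strictly differentiable, so a nonlinear chart can be
  replaced near \<open>z\<close> by its linearization: there is a linear map \<open>p\<close>, with range of dimension \<open>d\<close>, which
  is injective on \<open>\<Omega>\<close> near \<open>z\<close> with Lipschitz inverse and maps \<open>\<Omega>\<close> near \<open>z\<close> onto a relatively open
  subset of \<open>range p\<close> (locale \<open>lipschitz_patch\<close>). Vectors of \<open>T\<^sup>P\<close> are then bounded by their image under
  \<open>p\<close>, and \<open>p\<close> maps \<open>T\<close> onto \<open>range p\<close>. Two criteria for \<open>T\<^sup>P \<subseteq> T\<^sup>C\<close> follow by following points of
  \<open>\<Omega>\<close> with prescribed projection: (A) \<open>p\<close> maps \<open>T\<^sup>C\<close> onto \<open>range p\<close>; (B) \<open>p\<close> is injective on \<open>T\<^sup>P\<close>.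
  Every condition reduces to one of them.
  \<^item> If the function in the chart is strictly differentiable, \<open>T\<^sup>P\<close> lies in the linearized graph; this
    is (B), and so is the case that \<open>T\<^sup>P\<close> is a subspace.
  \<^item> If \<open>T\<^sup>C\<close> is a \<open>d\<close>-dimensional subspace, counting dimensions gives (A).
  \<^item> For a locally closed set the polar of the limiting normal cone \<open>N\<close> lies in \<open>T\<^sup>C\<close>. If \<open>N\<close> is a
    subspace, it meets the range of the adjoint of \<open>p\<close> only in \<open>0\<close> (this is where the Lipschitz property
    enters), whence \<open>p\<close> maps \<open>N\<^sup>\<bottom>\<close> onto \<open>range p\<close>. If \<open>\<Omega>\<close> is normally regular, \<open>T\<close> lies in the polar
    of \<open>N\<close>. Both give (A).
  \<^item> Suppose that the tangent subspaces at points near \<open>z\<close> have only one limit. Parametrize \<open>\<Omega>\<close> by a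
    Lipschitz map \<open>g\<close> which inverts \<open>p\<close>; the tangent cone at \<open>g e\<close> is the range of the derivative of
    \<open>g\<close> whenever the latter exists, so the derivatives converge as \<open>e \<rightarrow> z\<close>. By Rademacher's theorem they
    exist almost everywhere, and a mean value inequality turns their convergence into (A).

  \<^bold>\<open>Necessity.\<close> If \<open>T\<^sup>P = T\<^sup>C\<close>, this cone is convex and symmetric, hence a subspace \<open>L\<close>. As \<open>T\<^sup>P \<subseteq> L\<close>, the
  set is near \<open>z\<close> the graph of a Lipschitz function over a part of \<open>L\<close>, with vanishing strict
  derivative at the projection of \<open>z\<close>.
  As \<open>L \<subseteq> T\<^sup>C\<close> and \<open>\<Omega>\<close> is locally closed, this part is a full neighbourhood in \<open>L\<close>: from the point whose
  projection is nearest to a given target one can still move towards the target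
  (\<open>strictly_smooth_imp_local_graph\<close>). All other cones are then computed from \<open>L\<close>: the normal cones are
  \<open>L\<^sup>\<bottom>\<close>, and the only limit of tangent subspaces is \<open>L\<close>.

  \<^bold>\<open>Rademacher's theorem.\<close> On the line, a compact set at whose points a monotone function has slopes at
  least \<open>q\<close> forces an increment of at least \<open>q\<close> times its measure. If the slopes of a Lipschitz function
  oscillate at all points of a compact set, two such estimates bound the density of the set in every
  interval by a constant less than one, so it is null. Fubini's theorem transfers this to partial
  derivatives. Total differentiability follows almost everywhere because the points of a closed set at which
  it is porous form a null set: elsewhere one walks along the coordinate directions, always starting close to a
  point with the same approximate partial derivatives.
\<close>

section \<open>Slopes of Lipschitz functions on the line\<close>

text \<open>At the last point where \<open>g\<close> is still at least \<open>g c\<close>, the hypothesis would produce a later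
  one.\<close>

lemma right_nondecreasing_imp_le:
  fixes g :: "real \<Rightarrow> real"
  assumes cont: "continuous_on {c..d} g" and "c \<le> d"
    and step: "\<And>x e. c \<le> x \<Longrightarrow> x < d \<Longrightarrow> 0 < e \<Longrightarrow> \<exists>t>0. t < e \<and> g x \<le> g (x + t)"
  shows "g c \<le> g d"
proof -
  define Z where "Z = {s \<in> {c..d}. g c \<le> g s}"
  have "closed Z"
    unfolding Z_def using cont by (intro continuous_on_closed_Collect_le continuous_intros) auto
  moreover have Zb: "bdd_above Z" "Z \<noteq> {}"
    using \<open>c \<le> d\<close> by (auto simp: Z_def bdd_above_def)
  ultimately have "Sup Z \<in> Z"
    by (intro closed_contains_Sup)
  then have z: "c \<le> Sup Z" "Sup Z \<le> d" "g c \<le> g (Sup Z)" by (auto simp: Z_def)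
  have "Sup Z = d"
  proof (rule ccontr)
    assume "Sup Z \<noteq> d"
    with z have "Sup Z < d" "0 < d - Sup Z" by simp_all
    from step[OF z(1) this] obtain t where "t > 0" "t < d - Sup Z" "g (Sup Z) \<le> g (Sup Z + t)"
      by blast
    then have "Sup Z + t \<in> Z" using z by (auto simp: Z_def)
    then have "Sup Z + t \<le> Sup Z" using Zb by (intro cSup_upper)
    with \<open>t > 0\<close> show False by simp
  qed
  with z show ?thesis by simp
qed

text \<open>The sign \<open>\<sigma>\<close> selects the side on which comparison points are available; the left version is
  the right one for \<open>s \<mapsto> - h (- s)\<close>.\<close>

lemma one_sided_nondecreasing_imp_le:
  fixes h :: "real \<Rightarrow> real"
  assumes cont: "continuous_on UNIV h" and \<sigma>: "\<sigma> = 1 \<or> \<sigma> = -1"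
    and step: "\<And>x d. 0 < d \<Longrightarrow> \<exists>t>0. t < d \<and> 0 \<le> \<sigma> * (h (x + \<sigma> * t) - h x)"
    and "a \<le> b"
  shows "h a \<le> h b"
proof -
  from \<sigma> show ?thesis
  proof
    assume "\<sigma> = 1"
    show ?thesis
    proof (rule right_nondecreasing_imp_le[OF _ \<open>a \<le> b\<close>])
      show "continuous_on {a..b} h" using cont continuous_on_subset by blast
      show "\<exists>t>0. t < e \<and> h x \<le> h (x + t)" if "0 < e" for x e
        using step[OF that, of x] by (simp add: \<open>\<sigma> = 1\<close>)
    qed
  next
    assume s: "\<sigma> = -1"
    have "- h (- (- b)) \<le> - h (- (- a))"
    proof (rule right_nondecreasing_imp_le[of _ _ "\<lambda>s. - h (- s)"])
      show "continuous_on {- b..- a} (\<lambda>s. - h (- s))"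
        by (intro continuous_intros continuous_on_compose2[OF cont]) auto
      show "\<exists>t>0. t < d \<and> - h (- x) \<le> - h (- (x + t))" if "0 < d" for x d
        using step[OF that, of "-x"] by (auto simp: s algebra_simps)
    qed (use \<open>a \<le> b\<close> in auto)
    then show ?thesis by simp
  qed
qed

lemma cumulative_measure_diff:
  fixes C :: "real set"
  assumes "C \<in> lmeasurable" "s \<le> t"
  shows "measure lebesgue (C \<inter> {..t}) - measure lebesgue (C \<inter> {..s}) = measure lebesgue (C \<inter> {s<..t})"
    and "measure lebesgue (C \<inter> {s<..t}) \<le> t - s"
    and "0 \<le> measure lebesgue (C \<inter> {s<..t})"
proof -
  have m: "C \<inter> {..s} \<in> lmeasurable" "C \<inter> {s<..t} \<in> lmeasurable"
    using assms(1) by (auto intro!: fmeasurable_Int_fmeasurable)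
  have "C \<inter> {..t} = (C \<inter> {..s}) \<union> (C \<inter> {s<..t})" using \<open>s \<le> t\<close> by auto
  moreover have "(C \<inter> {..s}) \<inter> (C \<inter> {s<..t}) = {}" by auto
  ultimately show "measure lebesgue (C \<inter> {..t}) - measure lebesgue (C \<inter> {..s}) = measure lebesgue (C \<inter> {s<..t})"
    using measure_Un2[OF m] by (metis Diff_triv Int_commute add_diff_cancel_left')
  have "measure lebesgue (C \<inter> {s<..t}) \<le> measure lebesgue {s..t}"
    using m by (intro measure_mono_fmeasurable) auto
  then show "measure lebesgue (C \<inter> {s<..t}) \<le> t - s" using \<open>s \<le> t\<close> by simp
qed simp

lemma cumulative_measure_continuous:
  fixes C :: "real set"
  assumes "C \<in> lmeasurable"
  shows "continuous_on A (\<lambda>t. measure lebesgue (C \<inter> {..t}))"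
proof -
  have "\<bar>measure lebesgue (C \<inter> {..t}) - measure lebesgue (C \<inter> {..s})\<bar> \<le> 1 * \<bar>t - s\<bar>" for s t
    using cumulative_measure_diff[OF assms, of s t] cumulative_measure_diff[OF assms, of t s]
    by (smt (verit) mult_1)
  then have "1-lipschitz_on A (\<lambda>t. measure lebesgue (C \<inter> {..t}))"
    by (intro lipschitz_onI) (auto simp: dist_real_def)
  then show ?thesis by (rule lipschitz_on_continuous_on)
qed

text \<open>The function \<open>g\<close> minus \<open>q\<close> times the cumulative measure of \<open>C\<close> is nondecreasing: at points
  of \<open>C\<close> the measure grows at most with slope one, and outside the closed set \<open>C\<close> it is locally
  constant.\<close>

lemma steep_on_compact_imp_increment_ge:
  fixes g :: "real \<Rightarrow> real"
  assumes cont: "continuous_on UNIV g" and "mono g" and C: "compact C" and \<sigma>: "\<sigma> = 1 \<or> \<sigma> = -1"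
    and steep: "\<And>x d. x \<in> C \<Longrightarrow> 0 < d \<Longrightarrow> \<exists>t>0. t < d \<and> q * t \<le> \<sigma> * (g (x + \<sigma> * t) - g x)"
    and "a \<le> b"
  shows "q * measure lebesgue (C \<inter> {a<..b}) \<le> g b - g a"
proof (cases "q \<le> 0")
  case True
  then have "q * measure lebesgue (C \<inter> {a<..b}) \<le> 0" by (simp add: mult_nonpos_nonneg)
  also have "0 \<le> g b - g a" using \<open>mono g\<close> \<open>a \<le> b\<close> by (simp add: mono_def)
  finally show ?thesis .
next
  case False
  have Cm: "C \<in> lmeasurable" using C by (rule lmeasurable_compact)
  define \<mu> where "\<mu> t = measure lebesgue (C \<inter> {..t})" for t
  have diff: "\<mu> t - \<mu> s = measure lebesgue (C \<inter> {s<..t})" if "s \<le> t" for s t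
    unfolding \<mu>_def by (rule cumulative_measure_diff(1)[OF Cm that])
  have le: "0 \<le> \<mu> t - \<mu> s" "\<mu> t - \<mu> s \<le> t - s" if "s \<le> t" for s t
    using diff[OF that] cumulative_measure_diff(2)[OF Cm that] by auto
  have "g a - q * \<mu> a \<le> g b - q * \<mu> b"
  proof (rule one_sided_nondecreasing_imp_le[of "\<lambda>t. g t - q * \<mu> t" \<sigma>])
    show "continuous_on UNIV (\<lambda>t. g t - q * \<mu> t)"
      unfolding \<mu>_def by (intro continuous_intros cont cumulative_measure_continuous Cm)
    show "\<exists>t>0. t < d \<and> 0 \<le> \<sigma> * ((g (x + \<sigma> * t) - q * \<mu> (x + \<sigma> * t)) - (g x - q * \<mu> x))"
      if "0 < d" for x d
    proof (cases "x \<in> C")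
      case True
      from steep[OF this that] obtain t where t: "t > 0" "t < d" "q * t \<le> \<sigma> * (g (x + \<sigma> * t) - g x)" by blast
      have "\<sigma> * (\<mu> (x + \<sigma> * t) - \<mu> x) \<le> t"
        using \<sigma> le(2)[of x "x + t"] le(2)[of "x - t" x] t(1) by auto
      then have "q * (\<sigma> * (\<mu> (x + \<sigma> * t) - \<mu> x)) \<le> q * t" using False by simp
      with t show ?thesis by (intro exI[of _ t]) (auto simp: algebra_simps)
    next
      case x: False
      have "open (- C)" using C by (simp add: compact_imp_closed open_Compl)
      then obtain e where e: "e > 0" "cball x e \<subseteq> - C" using x by (meson open_contains_cball ComplI)
      define t where "t = min e (d/2)"
      have t: "t > 0" "t < d" "t \<le> e" using e that by (auto simp: t_def)
      have "C \<inter> {x<..x+t} = {}" "C \<inter> {x-t<..x} = {}" using e(2) t(3) by (force simp: dist_real_def)+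
      then have "\<mu> (x + t) = \<mu> x" "\<mu> (x - t) = \<mu> x"
        using diff[of x "x+t"] diff[of "x-t" x] t(1) by auto
      then have "\<mu> (x + \<sigma> * t) = \<mu> x" using \<sigma> by auto
      moreover have "0 \<le> \<sigma> * (g (x + \<sigma> * t) - g x)"
        using \<sigma> \<open>mono g\<close> t(1) by (auto simp: mono_def)
      ultimately show ?thesis using t by (intro exI[of _ t]) (auto simp: algebra_simps)
    qed
  qed fact+
  then show ?thesis using diff[OF \<open>a \<le> b\<close>] by (simp add: algebra_simps flip: right_diff_distrib)
qed

text \<open>For an open superset \<open>V\<close> of \<open>C\<close> the difference of \<open>\<theta>\<close> times the cumulative measure of \<open>V\<close>
  and that of \<open>C\<close> is nondecreasing, so \<open>C\<close> has measure at most \<open>\<theta>\<close> times that of \<open>V\<close>, and \<open>V\<close> can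
  be chosen with nearly the measure of \<open>C\<close>.\<close>

lemma compact_null_of_uniform_density_less_1:
  fixes C :: "real set"
  assumes C: "compact C" and \<theta>: "0 \<le> \<theta>" "\<theta> < 1"
    and dens: "\<And>a b. a \<le> b \<Longrightarrow> measure lebesgue (C \<inter> {a<..b}) \<le> \<theta> * (b - a)"
  shows "measure lebesgue C = 0"
proof (rule ccontr)
  let ?m = "measure lebesgue"
  assume "?m C \<noteq> 0"
  then have pos: "?m C > 0" by (simp add: zero_less_measure_iff)
  have Cm: "C \<in> lmeasurable" using C by (rule lmeasurable_compact)
  \<comment> \<open>Small enough for \<open>\<theta> (m C + \<delta>) < m C\<close>.\<close>
  define \<delta> where "\<delta> = (1 - \<theta>) * ?m C / 2"
  have "\<delta> > 0" using pos \<theta> by (simp add: \<delta>_def)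
  obtain O1 where O1: "open O1" "C \<subseteq> O1" "O1 - C \<in> lmeasurable" "emeasure lebesgue (O1 - C) < ennreal \<delta>"
    using sets_lebesgue_outer_open[OF fmeasurableD[OF Cm] \<open>\<delta> > 0\<close>] by blast
  obtain R where R: "R > 0" "C \<subseteq> ball 0 R"
    using C by (meson bounded_subset_ballD compact_imp_bounded)
  define V where "V = O1 \<inter> ball 0 R"
  have V: "open V" "C \<subseteq> V" "V \<in> lmeasurable"
    using O1 R by (auto simp: V_def intro: lmeasurable_open)
  have "?m (V - C) \<le> ?m (O1 - C)"
    using O1 V Cm by (intro measure_mono_fmeasurable) (auto simp: V_def)
  also have "\<dots> \<le> \<delta>"
    using O1(3,4) \<open>\<delta> > 0\<close> by (metis emeasure_eq_measure2 ennreal_less_iff less_imp_le measure_nonneg)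
  finally have VC: "?m V \<le> ?m C + \<delta>"
    using measurable_measure_Diff[OF V(3) _ V(2)] Cm by (simp add: fmeasurableD)
  define h where "h t = \<theta> * ?m (V \<inter> {..t}) - ?m (C \<inter> {..t})" for t
  have hd: "h t - h s = \<theta> * ?m (V \<inter> {s<..t}) - ?m (C \<inter> {s<..t})" if "s \<le> t" for s t
    using cumulative_measure_diff(1)[OF Cm that] cumulative_measure_diff(1)[OF V(3) that]
    by (simp add: h_def algebra_simps flip: right_diff_distrib)
  have "h (-R) \<le> h R"
  proof (rule one_sided_nondecreasing_imp_le[of h 1])
    show "continuous_on UNIV h" unfolding h_def
      by (intro continuous_intros cumulative_measure_continuous Cm V)
    show "\<exists>t>0. t < d \<and> 0 \<le> 1 * (h (x + 1 * t) - h x)" if "0 < d" for x d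
    proof (cases "x \<in> V")
      case True
      then obtain e where e: "e > 0" "cball x e \<subseteq> V" using V(1) open_contains_cball by blast
      define t where "t = min e (d/2)"
      have t: "t > 0" "t < d" "t \<le> e" using e that by (auto simp: t_def)
      have "V \<inter> {x<..x+t} = {x<..x+t}" using e(2) t(3) by (force simp: dist_real_def)
      then have "?m (V \<inter> {x<..x+t}) = t" using t(1) by simp
      then show ?thesis using t hd[of x "x+t"] dens[of x "x+t"] by (intro exI[of _ t]) auto
    next
      case False
      then have "x \<in> - C" using V by auto
      have "open (- C)" using C by (simp add: compact_imp_closed open_Compl)
      then obtain e where e: "e > 0" "cball x e \<subseteq> - C" using \<open>x \<in> - C\<close> by (meson open_contains_cball)
      define t where "t = min e (d/2)"
      have t: "t > 0" "t < d" "t \<le> e" using e that by (auto simp: t_def)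
      have "C \<inter> {x<..x+t} = {}" using e(2) t(3) by (force simp: dist_real_def)
      then show ?thesis using t hd[of x "x+t"] \<theta> by (intro exI[of _ t]) auto
    qed
  qed (use R in auto)
  moreover have "V \<inter> {..-R} = {}" "C \<inter> {..-R} = {}" "V \<inter> {..R} = V" "C \<inter> {..R} = C"
    using R by (auto simp: V_def dist_real_def subset_iff)
  ultimately have "?m C \<le> \<theta> * ?m V" by (simp add: h_def)
  also have "\<dots> \<le> \<theta> * (?m C + \<delta>)" using VC \<theta> by (simp add: mult_left_mono)
  also have "\<dots> \<le> \<theta> * ?m C + \<delta>" using \<theta> \<open>\<delta> > 0\<close> by (simp add: algebra_simps mult_left_le_one_le)
  finally have "(1 - \<theta>) * ?m C \<le> \<delta>" by (simp add: algebra_simps)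
  then show False using pos \<theta> by (simp add: \<delta>_def)
qed

text \<open>On a compact subset \<open>C\<close> of \<open>S\<close>, the monotone functions \<open>g t + K t\<close> and \<open>K t - g t\<close> have
  slopes at least \<open>q + K\<close> and \<open>K - p\<close>. Adding the two resulting increment estimates cancels \<open>g\<close>
  and leaves the density bound \<open>2 K / (2 K + (q - p))\<close>.\<close>

lemma distinct_slopes_negligible:
  fixes g :: "real \<Rightarrow> real"
  assumes lip: "K-lipschitz_on UNIV g" and "p < q" and \<sigma>: "\<sigma> = 1 \<or> \<sigma> = -1" and \<tau>: "\<tau> = 1 \<or> \<tau> = -1"
    and S: "S \<in> sets lebesgue"
    and hi: "\<And>x d. x \<in> S \<Longrightarrow> 0 < d \<Longrightarrow> \<exists>t>0. t < d \<and> q * t \<le> \<sigma> * (g (x + \<sigma> * t) - g x)"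
    and lo: "\<And>x d. x \<in> S \<Longrightarrow> 0 < d \<Longrightarrow> \<exists>t>0. t < d \<and> \<tau> * (g (x + \<tau> * t) - g x) \<le> p * t"
  shows "negligible S"
proof -
  let ?m = "measure lebesgue"
  have K: "0 \<le> K" using lip by (rule lipschitz_on_nonneg)
  have cont: "continuous_on UNIV g" using lip by (rule lipschitz_on_continuous_on)
  have lipD: "\<bar>g t - g s\<bar> \<le> K * (t - s)" if "s \<le> t" for s t
    using lipschitz_onD[OF lip, of t s] that by (simp add: dist_real_def)
  have mono1: "mono (\<lambda>t. g t + K * t)" and mono2: "mono (\<lambda>t. K * t - g t)"
    using lipD by (simp_all add: mono_def right_diff_distrib abs_le_iff) (smt (verit))+
  have compact_null: "?m C = 0" if C: "compact C" "C \<subseteq> S" for C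
  proof (rule compact_null_of_uniform_density_less_1[OF C(1), of "2 * K / (2 * K + (q - p))"])
    show "0 \<le> 2 * K / (2 * K + (q - p))" "2 * K / (2 * K + (q - p)) < 1"
      using K \<open>p < q\<close> by (auto simp: divide_simps)
    fix a b :: real assume ab: "a \<le> b"
    have "(q + K) * ?m (C \<inter> {a<..b}) \<le> (g b + K * b) - (g a + K * a)"
    proof (rule steep_on_compact_imp_increment_ge[OF _ mono1 C(1) \<sigma> _ ab])
      show "\<exists>t>0. t < d \<and> (q + K) * t \<le> \<sigma> * (g (x + \<sigma> * t) + K * (x + \<sigma> * t) - (g x + K * x))"
        if "x \<in> C" "0 < d" for x d
        using hi[of x d] that C(2) \<sigma> by (auto simp: algebra_simps)
    qed (intro continuous_intros cont)
    moreover have "(K - p) * ?m (C \<inter> {a<..b}) \<le> (K * b - g b) - (K * a - g a)"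
    proof (rule steep_on_compact_imp_increment_ge[OF _ mono2 C(1) \<tau> _ ab])
      show "\<exists>t>0. t < d \<and> (K - p) * t \<le> \<tau> * (K * (x + \<tau> * t) - g (x + \<tau> * t) - (K * x - g x))"
        if "x \<in> C" "0 < d" for x d
        using lo[of x d] that C(2) \<tau> by (auto simp: algebra_simps)
    qed (intro continuous_intros cont)
    ultimately have "(2 * K + (q - p)) * ?m (C \<inter> {a<..b}) \<le> 2 * K * (b - a)"
      by (simp add: algebra_simps)
    then show "?m (C \<inter> {a<..b}) \<le> 2 * K / (2 * K + (q - p)) * (b - a)"
      using K \<open>p < q\<close> by (simp add: field_simps)
  qed
  have closed_null: "negligible T" if T: "closed T" "T \<subseteq> S" for T
  proof -
    have "negligible (T \<inter> cball 0 (real n))" for n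
    proof -
      have c: "compact (T \<inter> cball 0 (real n))" using T(1) by (simp add: closed_Int_compact)
      then have "?m (T \<inter> cball 0 (real n)) = 0" using T(2) by (intro compact_null) auto
      with c show ?thesis unfolding negligible_iff_measure by (blast intro: lmeasurable_compact)
    qed
    then have "negligible (\<Union>n::nat. T \<inter> cball 0 (real n))"
      by (intro negligible_countable_Union) auto
    moreover have "T \<subseteq> (\<Union>n::nat. T \<inter> cball 0 (real n))" using real_arch_simple by fastforce
    ultimately show ?thesis by (rule negligible_subset)
  qed
  show ?thesis
    unfolding negligible_outer_le
  proof (intro allI impI)
    fix e :: real assume "e > 0"
    then obtain T where T: "closed T" "T \<subseteq> S" "S - T \<in> lmeasurable" "emeasure lebesgue (S - T) < ennreal e"
      using sets_lebesgue_inner_closed[OF S] by metis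
    have nT: "negligible T" by (rule closed_null[OF T(1,2)])
    have "?m (S - T) \<le> e"
      using T(3,4) \<open>e > 0\<close> by (metis emeasure_eq_measure2 ennreal_less_iff less_imp_le measure_nonneg)
    moreover have "?m ((S - T) \<union> T) = ?m (S - T)"
      using nT fmeasurableD[OF T(3)] unfolding negligible_iff_null_sets by (intro measure_Un_null_set)
    moreover have "(S - T) \<union> T \<in> lmeasurable"
      using T(3) negligible_imp_measurable[OF nT] by (rule fmeasurable.Un)
    ultimately show "\<exists>T. S \<subseteq> T \<and> T \<in> lmeasurable \<and> ?m T \<le> e"
      by (intro exI[of _ "(S - T) \<union> T"]) auto
  qed
qed

section \<open>Partial derivatives of Lipschitz functions\<close>

text \<open>Fubini's theorem for one coordinate of the product measure that defines \<open>lborel\<close>.\<close>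

lemma null_of_null_lines:
  fixes N :: "'a::euclidean_space set"
  assumes N: "N \<in> sets borel" and e: "e \<in> Basis"
    and lines: "\<And>x. negligible {t. x + t *\<^sub>R e \<in> N}"
  shows "negligible N"
proof -
  interpret product_sigma_finite "\<lambda>_::'a. lborel :: real measure"
    by standard
  let ?v = "\<lambda>f::'a \<Rightarrow> real. \<Sum>b\<in>Basis. f b *\<^sub>R b"
  have v[measurable]: "?v \<in> borel_measurable (\<Pi>\<^sub>M b\<in>Basis. lborel)" by measurable
  have [measurable]: "N \<in> sets borel" by fact
  have ins: "insert e (Basis - {e}) = Basis" using e by auto
  have sum_upd: "?v (f(e := y)) = (\<Sum>b\<in>Basis - {e}. f b *\<^sub>R b) + y *\<^sub>R e" for f y
    using e by (subst sum.remove[of _ e]) (auto intro!: sum.cong simp: add.commute)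
  have sets: "{t. x + t *\<^sub>R e \<in> N} \<in> sets borel" for x
    using measurable_sets[of "\<lambda>t::real. x + t *\<^sub>R e" borel borel N] by (simp add: vimage_def)
  have zero: "emeasure lborel {t. x + t *\<^sub>R e \<in> N} = 0" for x
    using lines[of x] sets[of x]
    by (simp add: negligible_iff_null_sets null_sets_completion_iff null_setsD1)
  have inner: "(\<integral>\<^sup>+y. indicator N (?v (f(e := y))) \<partial>lborel) = 0" for f
  proof -
    have "(\<integral>\<^sup>+y. indicator N (?v (f(e := y))) \<partial>lborel)
        = (\<integral>\<^sup>+y. indicator {t. (\<Sum>b\<in>Basis - {e}. f b *\<^sub>R b) + t *\<^sub>R e \<in> N} y \<partial>lborel)"
      by (simp only: sum_upd) (simp add: indicator_def)
    also have "\<dots> = 0" using sets zero by (subst nn_integral_indicator) auto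
    finally show ?thesis .
  qed
  have "emeasure lborel N = (\<integral>\<^sup>+x. indicator N x \<partial>lborel)" by simp
  also have "\<dots> = (\<integral>\<^sup>+f. indicator N (?v f) \<partial>(\<Pi>\<^sub>M b\<in>Basis. lborel))"
    by (subst lborel_eq, subst nn_integral_distr) auto
  also have "\<dots> = (\<integral>\<^sup>+f. (\<integral>\<^sup>+y. indicator N (?v (f(e := y))) \<partial>lborel) \<partial>(\<Pi>\<^sub>M b\<in>Basis - {e}. lborel))"
    using product_nn_integral_insert[of "Basis - {e}" e "\<lambda>f. indicator N (?v f)"]
    unfolding ins by simp
  also have "\<dots> = 0" by (simp only: inner nn_integral_const mult_zero_left)
  finally have "N \<in> null_sets lborel" using N by (auto simp: null_sets_def)
  then show ?thesis by (simp add: negligible_iff_null_sets null_sets_completionI)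
qed

lemma borel_Collect_arbitrarily_small:
  fixes H :: "real \<Rightarrow> 'a::topological_space \<Rightarrow> real"
  assumes "\<And>t. continuous_on UNIV (H t)"
  shows "{x. \<forall>d>0. \<exists>t>0. t < d \<and> 0 < H t x} \<in> sets borel"
proof -
  have "{x. \<forall>d>0. \<exists>t>0. t < d \<and> 0 < H t x}
      = (\<Inter>n::nat. \<Union>t\<in>{0<..<inverse (Suc n)}. {x. 0 < H t x})" (is "?L = ?R")
  proof
    show "?L \<subseteq> ?R"
    proof (intro subsetI INT_I)
      fix x and n :: nat assume "x \<in> ?L"
      moreover have "0 < inverse (real (Suc n))" by simp
      ultimately obtain t where "t > 0" "t < inverse (Suc n)" "0 < H t x" by blast
      then show "x \<in> (\<Union>t\<in>{0<..<inverse (Suc n)}. {x. 0 < H t x})"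
        by (intro UN_I[of t] CollectI) (simp_all only: greaterThanLessThan_iff)
    qed
    show "?R \<subseteq> ?L"
    proof clarify
      fix x and d :: real assume x: "x \<in> ?R" and "0 < d"
      then obtain n where "inverse (Suc n) < d" using reals_Archimedean by blast
      moreover from x have "x \<in> (\<Union>t\<in>{0<..<inverse (Suc n)}. {x. 0 < H t x})" by blast
      then obtain t where "t > 0" "t < inverse (Suc n)" "0 < H t x"
        by (auto simp only: UN_iff greaterThanLessThan_iff mem_Collect_eq)
      ultimately show "\<exists>t>0. t < d \<and> 0 < H t x" by (meson less_trans)
    qed
  qed
  moreover have "open (\<Union>t\<in>{0<..<inverse (real (Suc n))}. {x. 0 < H t x})" for n
    by (intro open_UN ballI open_Collect_less continuous_intros assms)
  ultimately show ?thesis by (auto intro!: borel_open sets.countable_INT)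
qed

text \<open>The limes inferior and superior are finite and differ, so two rational numbers fit between
  them.\<close>

lemma no_limit_imp_oscillation:
  fixes Q :: "'b \<Rightarrow> real"
  assumes "F \<noteq> bot" and bd: "\<And>t. \<bar>Q t\<bar> \<le> K" and no: "\<nexists>D. (Q \<longlongrightarrow> D) F"
  obtains p q where "p \<in> \<rat>" "q \<in> \<rat>" "p < q" "\<exists>\<^sub>F t in F. Q t < p" "\<exists>\<^sub>F t in F. q < Q t"
proof -
  let ?Q = "\<lambda>t. ereal (Q t)"
  let ?l = "Liminf F ?Q" and ?u = "Limsup F ?Q"
  have "ereal (-K) \<le> ?l"
    using bd by (intro Liminf_bounded always_eventually) (auto simp: abs_le_iff minus_le_iff)
  moreover have "?u \<le> ereal K" using bd by (intro Limsup_bounded always_eventually) (auto simp: abs_le_iff)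
  moreover have "?l \<le> ?u" by (rule Liminf_le_Limsup[OF \<open>F \<noteq> bot\<close>])
  ultimately obtain l u where lu: "?l = ereal l" "?u = ereal u" "l \<le> u"
    by (cases ?l; cases ?u) auto
  have "l \<noteq> u"
  proof
    assume "l = u"
    then have "(?Q \<longlongrightarrow> ereal l) F" using lu \<open>F \<noteq> bot\<close> by (subst tendsto_iff_Liminf_eq_Limsup) auto
    then show False using no by auto
  qed
  with lu obtain p where p: "p \<in> \<rat>" "l < p" "p < u" using Rats_dense_in_real[of l u] by auto
  then obtain q where q: "q \<in> \<rat>" "p < q" "q < u" using Rats_dense_in_real[of p u] by auto
  have "\<exists>\<^sub>F t in F. Q t < p"
  proof (rule ccontr)
    assume "\<not> ?thesis"
    then have "\<forall>\<^sub>F t in F. ereal p \<le> ?Q t" by (simp add: not_frequently not_less)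
    then have "ereal p \<le> ?l" by (rule Liminf_bounded)
    with lu p show False by simp
  qed
  moreover have "\<exists>\<^sub>F t in F. q < Q t"
  proof (rule ccontr)
    assume "\<not> ?thesis"
    then have "\<forall>\<^sub>F t in F. ?Q t \<le> ereal q" by (simp add: not_frequently not_less)
    then have "?u \<le> ereal q" by (rule Limsup_bounded)
    with lu q show False by simp
  qed
  ultimately show thesis using that p q by blast
qed

lemma frequently_at_0_one_sided:
  fixes P :: "real \<Rightarrow> bool"
  assumes "\<exists>\<^sub>F t in at 0. P t"
  obtains \<sigma> :: real where "\<sigma> = 1 \<or> \<sigma> = -1" "\<And>d. 0 < d \<Longrightarrow> \<exists>t>0. t < d \<and> P (\<sigma> * t)"
proof -
  from assms have "(\<exists>\<^sub>F t in at_left 0. P t) \<or> (\<exists>\<^sub>F t in at_right 0. P t)"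
    by (auto simp: frequently_def eventually_at_split)
  then show thesis
  proof
    assume "\<exists>\<^sub>F t in at_left 0. P t"
    then have l: "\<exists>t<0. -d < t \<and> P t" if "0 < d" for d
      using that unfolding frequently_def eventually_at_left_field by (meson neg_less_0_iff_less)
    show thesis
    proof (rule that[of "-1"])
      fix d :: real assume "0 < d"
      from l[OF this] obtain t where "t < 0" "- d < t" "P t" by blast
      then show "\<exists>t>0. t < d \<and> P (-1 * t)" by (intro exI[of _ "-t"]) auto
    qed auto
  next
    assume "\<exists>\<^sub>F t in at_right 0. P t"
    then have "\<exists>t>0. t < d \<and> P t" if "0 < d" for d
      using that unfolding frequently_def eventually_at_right_field by meson
    then show thesis by (intro that[of 1]) auto
  qed
qed

text \<open>If the partial derivative fails to exist at \<open>x\<close>, the quotients oscillate between two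
  rationals \<open>p < q\<close>, each reached on one of the two sides. This gives countably many Borel sets,
  each of which meets every line in direction \<open>e\<close> in a null set.\<close>

lemma lipschitz_no_partial_negligible:
  fixes g :: "'a::euclidean_space \<Rightarrow> real"
  assumes lip: "K-lipschitz_on UNIV g" and e: "e \<in> Basis"
  shows "negligible {x. \<nexists>D. ((\<lambda>t. (g (x + t *\<^sub>R e) - g x) / t) \<longlongrightarrow> D) (at 0)}"
proof -
  have cont: "continuous_on A g" for A
    using lipschitz_on_continuous_on[OF lip] continuous_on_subset by blast
  have cont': "continuous_on UNIV (\<lambda>x. g (x + c))" for c
    by (intro continuous_on_compose2[OF cont[of UNIV]] continuous_intros) auto
  define N where "N p q \<sigma> \<tau> =
      {x. \<forall>d>0. \<exists>t>0. t < d \<and> 0 < \<sigma> * (g (x + (\<sigma> * t) *\<^sub>R e) - g x) - q * t}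
    \<inter> {x. \<forall>d>0. \<exists>t>0. t < d \<and> 0 < p * t - \<tau> * (g (x + (\<tau> * t) *\<^sub>R e) - g x)}"
    for p q \<sigma> \<tau> :: real
  have Nb: "N p q \<sigma> \<tau> \<in> sets borel" for p q \<sigma> \<tau>
    unfolding N_def
    by (intro sets.Int borel_Collect_arbitrarily_small continuous_intros cont' cont)
  have "negligible (N p q \<sigma> \<tau>)" if "p < q" "\<sigma> \<in> {1,-1}" "\<tau> \<in> {1,-1}" for p q \<sigma> \<tau>
  proof (rule null_of_null_lines[OF Nb e])
    fix x
    let ?S = "{t. x + t *\<^sub>R e \<in> N p q \<sigma> \<tau>}"
    have "?S \<in> sets borel"
      using measurable_sets[OF _ Nb[of p q \<sigma> \<tau>], of "\<lambda>t::real. x + t *\<^sub>R e" borel] by (simp add: vimage_def)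
    then have S: "?S \<in> sets lebesgue" by simp
    show "negligible ?S"
    proof (rule distinct_slopes_negligible[OF _ \<open>p < q\<close> _ _ S, of K "\<lambda>t. g (x + t *\<^sub>R e)" \<sigma> \<tau>])
      show "K-lipschitz_on UNIV (\<lambda>t. g (x + t *\<^sub>R e))"
      proof (rule lipschitz_onI)
        fix s t :: real
        have "dist (g (x + s *\<^sub>R e)) (g (x + t *\<^sub>R e)) \<le> K * dist (x + s *\<^sub>R e) (x + t *\<^sub>R e)"
          by (rule lipschitz_onD[OF lip]) auto
        also have "dist (x + s *\<^sub>R e) (x + t *\<^sub>R e) = dist s t"
          using e by (simp add: dist_norm flip: scaleR_left_diff_distrib)
        finally show "dist (g (x + s *\<^sub>R e)) (g (x + t *\<^sub>R e)) \<le> K * dist s t" .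
      qed (rule lipschitz_on_nonneg[OF lip])
      show "\<exists>t>0. t < d \<and> q * t \<le> \<sigma> * (g (x + (s + \<sigma> * t) *\<^sub>R e) - g (x + s *\<^sub>R e))"
        if "s \<in> ?S" "0 < d" for s d
      proof -
        obtain t where "t > 0" "t < d" "0 < \<sigma> * (g (x + s *\<^sub>R e + (\<sigma> * t) *\<^sub>R e) - g (x + s *\<^sub>R e)) - q * t"
          using \<open>s \<in> ?S\<close> \<open>0 < d\<close> unfolding N_def by blast
        then show ?thesis by (intro exI[of _ t]) (auto simp: scaleR_left_distrib add.assoc)
      qed
      show "\<exists>t>0. t < d \<and> \<tau> * (g (x + (s + \<tau> * t) *\<^sub>R e) - g (x + s *\<^sub>R e)) \<le> p * t"
        if "s \<in> ?S" "0 < d" for s d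
      proof -
        obtain t where "t > 0" "t < d" "0 < p * t - \<tau> * (g (x + s *\<^sub>R e + (\<tau> * t) *\<^sub>R e) - g (x + s *\<^sub>R e))"
          using \<open>s \<in> ?S\<close> \<open>0 < d\<close> unfolding N_def by blast
        then show ?thesis by (intro exI[of _ t]) (auto simp: scaleR_left_distrib add.assoc)
      qed
    qed (use that in auto)
  qed
  then have neg: "negligible (\<Union>(p, q, \<sigma>, \<tau>)\<in>{(p, q, \<sigma>, \<tau>). p \<in> \<rat> \<and> q \<in> \<rat> \<and> p < q \<and> \<sigma> \<in> {1,-1} \<and> \<tau> \<in> {1,-1}}.
      N p q \<sigma> \<tau>)"
  proof (intro negligible_countable_Union countable_image)
    have "countable (\<rat> \<times> \<rat> \<times> {1::real,-1} \<times> {1::real,-1} :: (real \<times> real \<times> real \<times> real) set)"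
      by (intro countable_SIGMA countable_rat) auto
    then show "countable {(p::real, q::real, \<sigma>, \<tau>). p \<in> \<rat> \<and> q \<in> \<rat> \<and> p < q \<and> \<sigma> \<in> {1::real,-1} \<and> \<tau> \<in> {1::real,-1::real}}"
      by (rule countable_subset[rotated]) auto
  qed auto
  show ?thesis
  proof (rule negligible_subset[OF neg], clarify)
    fix x assume no: "\<nexists>D. ((\<lambda>t. (g (x + t *\<^sub>R e) - g x) / t) \<longlongrightarrow> D) (at 0)"
    let ?Q = "\<lambda>t. (g (x + t *\<^sub>R e) - g x) / t"
    have K: "0 \<le> K" using lip by (rule lipschitz_on_nonneg)
    have "\<bar>?Q t\<bar> \<le> K" for t
    proof (cases "t = 0")
      case False
      have "\<bar>g (x + t *\<^sub>R e) - g x\<bar> \<le> K * \<bar>t\<bar>"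
        using lipschitz_onD[OF lip, of "x + t *\<^sub>R e" x] e by (simp add: dist_norm)
      with False show ?thesis by (simp add: field_simps)
    qed (use K in auto)
    from no_limit_imp_oscillation[OF at_neq_bot this no]
    obtain p q where pq: "p \<in> \<rat>" "q \<in> \<rat>" "p < q"
      and lo: "\<exists>\<^sub>F t in at 0. ?Q t < p" and hi: "\<exists>\<^sub>F t in at 0. q < ?Q t" by blast
    obtain \<tau> where \<tau>: "\<tau> = 1 \<or> \<tau> = -1" "\<And>d. 0 < d \<Longrightarrow> \<exists>t>0. t < d \<and> ?Q (\<tau> * t) < p"
      using frequently_at_0_one_sided[OF lo] by blast
    obtain \<sigma> where \<sigma>: "\<sigma> = 1 \<or> \<sigma> = -1" "\<And>d. 0 < d \<Longrightarrow> \<exists>t>0. t < d \<and> q < ?Q (\<sigma> * t)"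
      using frequently_at_0_one_sided[OF hi] by blast
    have "x \<in> N p q \<sigma> \<tau>"
      unfolding N_def
    proof (intro IntI CollectI allI impI)
      fix d :: real assume "0 < d"
      from \<sigma>(2)[OF this] obtain t where t: "t > 0" "t < d" "q < ?Q (\<sigma> * t)" by blast
      then have "0 < \<sigma> * (g (x + (\<sigma> * t) *\<^sub>R e) - g x) - q * t"
        using \<sigma>(1) by (auto simp: field_simps)
      with t show "\<exists>t>0. t < d \<and> 0 < \<sigma> * (g (x + (\<sigma> * t) *\<^sub>R e) - g x) - q * t" by blast
    next
      fix d :: real assume "0 < d"
      from \<tau>(2)[OF this] obtain t where t: "t > 0" "t < d" "?Q (\<tau> * t) < p" by blast
      then have "0 < p * t - \<tau> * (g (x + (\<tau> * t) *\<^sub>R e) - g x)"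
        using \<tau>(1) by (auto simp: field_simps)
      with t show "\<exists>t>0. t < d \<and> 0 < p * t - \<tau> * (g (x + (\<tau> * t) *\<^sub>R e) - g x)" by blast
    qed
    with pq \<sigma>(1) \<tau>(1) show "x \<in> (\<Union>(p, q, \<sigma>, \<tau>)\<in>{(p, q, \<sigma>, \<tau>). p \<in> \<rat> \<and> q \<in> \<rat> \<and> p < q \<and> \<sigma> \<in> {1,-1} \<and> \<tau> \<in> {1,-1}}.
      N p q \<sigma> \<tau>)" by blast
  qed
qed

section \<open>Porous sets and Rademacher's theorem\<close>

text \<open>Cover \<open>P\<close>, up to a null set, by disjoint balls inside an open superset \<open>V\<close> of \<open>A\<close>, each
  containing a hole of \<open>A\<close> that occupies a fixed fraction of it. All holes lie in \<open>V - A\<close>, which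
  has small measure; so the balls have small total measure.\<close>

lemma porous_lmeasurable_negligible:
  fixes A :: "'a::euclidean_space set"
  assumes A: "A \<in> lmeasurable" and "P \<subseteq> A" and \<eta>: "0 < \<eta>" "\<eta> \<le> 1"
    and hole: "\<And>x d. x \<in> P \<Longrightarrow> 0 < d \<Longrightarrow> \<exists>h. 0 < norm h \<and> norm h < d \<and> ball (x + h) (\<eta> * norm h) \<inter> A = {}"
  shows "negligible P"
  unfolding negligible_outer_le
proof (intro allI impI)
  fix e :: real assume "e > 0"
  let ?m = "measure lebesgue"
  \<comment> \<open>The factor is the volume of a hole relative to its ball: radii \<open>\<eta> \<parallel>h\<parallel>\<close> and \<open>2 \<parallel>h\<parallel>\<close>.\<close>
  define \<delta> where "\<delta> = e * (\<eta> / 2) ^ DIM('a)"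
  have "\<delta> > 0" using \<open>e > 0\<close> \<eta> by (simp add: \<delta>_def)
  obtain V where V: "open V" "A \<subseteq> V" "V - A \<in> lmeasurable" "emeasure lebesgue (V - A) < ennreal \<delta>"
    using sets_lebesgue_outer_open[OF fmeasurableD[OF A] \<open>\<delta> > 0\<close>] by blast
  have VA: "?m (V - A) \<le> \<delta>"
    using V(3,4) \<open>\<delta> > 0\<close> by (metis emeasure_eq_measure2 ennreal_less_iff less_imp_le measure_nonneg)
  define I where "I = {(x, h). x \<in> P \<and> 0 < norm h \<and> cball x (2 * norm h) \<subseteq> V \<and> ball (x + h) (\<eta> * norm h) \<inter> A = {}}"
  let ?B = "\<lambda>i::'a \<times> 'a. cball (fst i) (2 * norm (snd i))"
  let ?H = "\<lambda>i::'a \<times> 'a. ball (fst i + snd i) (\<eta> * norm (snd i))"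
  obtain C where C: "countable C" "C \<subseteq> I"
    and disj: "pairwise (\<lambda>i j. disjnt (?B i) (?B j)) C"
    and neg: "negligible (P - (\<Union>i\<in>C. ?B i))"
  proof (rule Vitali_covering_theorem_cballs[of I "\<lambda>i. 2 * norm (snd i)" P fst])
    show "0 < 2 * norm (snd i)" if "i \<in> I" for i using that by (auto simp: I_def)
    show "\<exists>i. i \<in> I \<and> x \<in> ?B i \<and> 2 * norm (snd i) < d" if "x \<in> P" "0 < d" for x d
    proof -
      obtain r where r: "r > 0" "cball x r \<subseteq> V"
        using V(1,2) \<open>P \<subseteq> A\<close> \<open>x \<in> P\<close> by (meson open_contains_cball subsetD)
      obtain h where h: "0 < norm h" "norm h < min (d/2) (r/2)" "ball (x + h) (\<eta> * norm h) \<inter> A = {}"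
        using hole[OF \<open>x \<in> P\<close>, of "min (d/2) (r/2)"] \<open>0 < d\<close> r by (metis half_gt_zero min_less_iff_conj)
      have "cball x (2 * norm h) \<subseteq> cball x r" using h(2) by (intro subset_cball) auto
      then have "(x, h) \<in> I" using h r(2) that(1) by (auto simp: I_def)
      then show ?thesis using h by (intro exI[of _ "(x, h)"]) auto
    qed
  qed (use that in blast)
  have HB: "?H i \<subseteq> ?B i" for i
  proof
    fix z assume "z \<in> ?H i"
    then have "dist (fst i + snd i) z < \<eta> * norm (snd i)" by simp
    also have "\<dots> \<le> norm (snd i)" using \<eta> by (simp add: mult_left_le_one_le)
    finally have "dist (fst i) z \<le> norm (snd i) + norm (snd i)"
      using dist_triangle[of "fst i" z "fst i + snd i"] by (simp add: dist_norm)
    then show "z \<in> ?B i" by simp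
  qed
  have HV: "?H i \<subseteq> V - A" if "i \<in> C" for i
  proof -
    have "i \<in> I" using C(2) that by blast
    then have "?B i \<subseteq> V" "?H i \<inter> A = {}" unfolding I_def by (simp_all add: case_prod_unfold)
    with HB[of i] show ?thesis by blast
  qed
  have bound: "?m (\<Union>i\<in>F. ?B i) \<le> e" if F: "finite F" "F \<subseteq> C" for F
  proof -
    have scale: "?m (?B i) * (\<eta> / 2) ^ DIM('a) = ?m (?H i)" for i
      using \<eta> by (simp add: content_cball content_ball power_mult_distrib power_divide)
    have "?m (\<Union>i\<in>F. ?B i) \<le> (\<Sum>i\<in>F. ?m (?B i))"
      using F(1) by (intro measure_UNION_le) auto
    then have "?m (\<Union>i\<in>F. ?B i) * (\<eta> / 2) ^ DIM('a) \<le> (\<Sum>i\<in>F. ?m (?B i)) * (\<eta> / 2) ^ DIM('a)"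
      using \<eta> by (intro mult_right_mono) auto
    also have "\<dots> = (\<Sum>i\<in>F. ?m (?H i))" by (simp only: sum_distrib_right scale)
    also have "\<dots> = ?m (\<Union>i\<in>F. ?H i)"
    proof (rule measure_UNION'[symmetric, OF F(1)])
      show "pairwise (\<lambda>i j. disjnt (?H i) (?H j)) F"
        using disj F(2) HB unfolding pairwise_def disjnt_def by blast
    qed auto
    also have "\<dots> \<le> ?m (V - A)"
      using HV F V(3) by (intro measure_mono_fmeasurable) (auto intro!: sets.finite_UN)
    also have "\<dots> \<le> e * (\<eta> / 2) ^ DIM('a)" using VA by (simp add: \<delta>_def)
    finally show ?thesis using \<eta> by simp
  qed
  have U: "(\<Union>i\<in>C. ?B i) \<in> lmeasurable"
    by (rule fmeasurable_UN_bound[OF C(1) _ bound]) simp_all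
  have mU: "?m (\<Union>i\<in>C. ?B i) \<le> e"
    by (rule measure_UN_bound[OF C(1) _ bound]) simp_all
  let ?N = "P - (\<Union>i\<in>C. ?B i)"
  have "?m ((\<Union>i\<in>C. ?B i) \<union> ?N) = ?m (\<Union>i\<in>C. ?B i)"
    using neg fmeasurableD[OF U] unfolding negligible_iff_null_sets by (intro measure_Un_null_set)
  moreover have "(\<Union>i\<in>C. ?B i) \<union> ?N \<in> lmeasurable"
    using U negligible_imp_measurable[OF neg] by (rule fmeasurable.Un)
  ultimately show "\<exists>T. P \<subseteq> T \<and> T \<in> lmeasurable \<and> ?m T \<le> e"
    using mU by (intro exI[of _ "(\<Union>i\<in>C. ?B i) \<union> ?N"]) auto
qed

lemma porous_negligible:
  fixes A :: "'a::euclidean_space set"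
  assumes A: "closed A" and "P \<subseteq> A" and \<eta>: "0 < \<eta>" "\<eta> \<le> 1"
    and hole: "\<And>x d. x \<in> P \<Longrightarrow> 0 < d \<Longrightarrow> \<exists>h. 0 < norm h \<and> norm h < d \<and> ball (x + h) (\<eta> * norm h) \<inter> A = {}"
  shows "negligible P"
proof -
  have "negligible (P \<inter> cball 0 (real n))" for n
  proof (rule porous_lmeasurable_negligible[OF _ _ \<eta>])
    show "A \<inter> cball 0 (real n) \<in> lmeasurable"
      using A by (simp add: closed_Int_compact lmeasurable_compact)
    show "\<exists>h. 0 < norm h \<and> norm h < d \<and> ball (x + h) (\<eta> * norm h) \<inter> (A \<inter> cball 0 (real n)) = {}"
      if "x \<in> P \<inter> cball 0 (real n)" "0 < d" for x d
      using hole[of x d] that by blast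
  qed (use \<open>P \<subseteq> A\<close> in auto)
  then have "negligible (\<Union>n::nat. P \<inter> cball 0 (real n))"
    by (intro negligible_countable_Union) auto
  moreover have "P \<subseteq> (\<Union>n::nat. P \<inter> cball 0 (real n))" using real_arch_simple by fastforce
  ultimately show ?thesis by (rule negligible_subset)
qed

text \<open>Take a point with all partial derivatives and with the following property for all parameters
  from a countable dense set: if it belongs to the closed set \<open>A y \<epsilon> \<delta>\<close> of points whose coordinate
  increments up to length \<open>\<delta>\<close> are those of \<open>y\<close> up to a relative error \<open>\<epsilon>\<close>, then this set is not
  porous there. Almost every point is of this kind. An increment \<open>h\<close> is split into coordinate
  steps; since each intermediate point is close to \<open>A y \<epsilon> \<delta>\<close>, each step changes \<open>g\<close> almost as
  prescribed by \<open>y\<close>.\<close>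

lemma rademacher_real:
  fixes g :: "'a::euclidean_space \<Rightarrow> real"
  assumes lip: "K-lipschitz_on UNIV g"
  shows "negligible {x. \<not> g differentiable (at x)}"
proof -
  have K: "0 \<le> K" using lip by (rule lipschitz_on_nonneg)
  have lipD: "\<bar>g u - g v\<bar> \<le> K * norm (u - v)" for u v
    using lipschitz_onD[OF lip, of u v] by (simp add: dist_norm)
  have cont: "continuous_on A g" for A
    using lipschitz_on_continuous_on[OF lip] continuous_on_subset by blast
  have cont': "continuous_on UNIV (\<lambda>x. g (x + c))" for c
    by (intro continuous_on_compose2[OF cont[of UNIV]] continuous_intros) auto
  obtain D :: "'a set" where D: "countable D" "\<And>X. open X \<Longrightarrow> X \<noteq> {} \<Longrightarrow> \<exists>d\<in>D. d \<in> X"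
    using countable_dense_setE by blast
  define A where "A y \<epsilon> \<delta> = {x. \<forall>b\<in>Basis. \<forall>t. \<bar>t\<bar> \<le> \<delta> \<longrightarrow> \<bar>g (x + t *\<^sub>R b) - g x - t * (y \<bullet> b)\<bar> \<le> \<epsilon> * \<bar>t\<bar>}"
    for y :: 'a and \<epsilon> \<delta>
  define P where "P y \<epsilon> \<delta> \<eta> = {x \<in> A y \<epsilon> \<delta>. \<forall>d>0. \<exists>h. 0 < norm h \<and> norm h < d \<and> ball (x + h) (\<eta> * norm h) \<inter> A y \<epsilon> \<delta> = {}}"
    for y \<epsilon> \<delta> \<eta>
  define r where "r n = inverse (real (Suc n))" for n
  have r: "0 < r n" "r n \<le> 1" for n by (auto simp: r_def field_simps)
  define N where "N = (\<Union>b\<in>Basis. {x. \<nexists>D. ((\<lambda>t. (g (x + t *\<^sub>R b) - g x) / t) \<longlongrightarrow> D) (at 0)})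
      \<union> (\<Union>y\<in>D. \<Union>n. \<Union>m. P y (2 * r n) (r m) (r n))"
  have "closed (A y \<epsilon> \<delta>)" for y \<epsilon> \<delta>
  proof -
    have "A y \<epsilon> \<delta> = (\<Inter>b\<in>Basis. \<Inter>t\<in>{t. \<bar>t\<bar> \<le> \<delta>}.
        {x. \<bar>g (x + t *\<^sub>R b) - g x - t * (y \<bullet> b)\<bar> \<le> \<epsilon> * \<bar>t\<bar>})"
      unfolding A_def by blast
    also have "closed \<dots>"
      by (intro closed_INT ballI closed_Collect_le continuous_intros cont cont')
    finally show ?thesis .
  qed
  then have Pn: "negligible (P y \<epsilon> \<delta> (r n))" for y \<epsilon> \<delta> n
    by (rule porous_negligible[OF _ _ r]) (auto simp: P_def)
  have "negligible (\<Union>b\<in>Basis. {x. \<nexists>D. ((\<lambda>t. (g (x + t *\<^sub>R b) - g x) / t) \<longlongrightarrow> D) (at 0)})"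
    by (rule negligible_Union) (auto simp only: finite_imageI finite_Basis dest!: lipschitz_no_partial_negligible[OF lip])
  moreover have "negligible (\<Union>m. P y (2 * r n) (r m) (r n))" for y n
    by (rule negligible_countable_Union) (auto simp only: countable_image countableI_type Pn)
  then have "negligible (\<Union>n. \<Union>m. P y (2 * r n) (r m) (r n))" for y
    by (intro negligible_countable_Union) (auto simp only: countable_image countableI_type)
  then have "negligible (\<Union>y\<in>D. \<Union>n. \<Union>m. P y (2 * r n) (r m) (r n))"
    by (intro negligible_countable_Union countable_image D(1)) (auto simp only:)
  ultimately have "negligible N"
    unfolding N_def by (rule negligible_Un)
  moreover have "g differentiable (at x)" if "x \<notin> N" for x
  proof -
    have "\<exists>D. ((\<lambda>t. (g (x + t *\<^sub>R b) - g x) / t) \<longlongrightarrow> D) (at 0)" if "b \<in> Basis" for b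
      using \<open>x \<notin> N\<close> that by (auto simp: N_def)
    then obtain d where d: "((\<lambda>t. (g (x + t *\<^sub>R b) - g x) / t) \<longlongrightarrow> d b) (at 0)" if "b \<in> Basis" for b
      by metis
    define y0 where "y0 = (\<Sum>b\<in>Basis. d b *\<^sub>R b)"
    have y0: "y0 \<bullet> b = d b" if "b \<in> Basis" for b using that by (simp add: y0_def)
    have "(g has_derivative (\<lambda>h. y0 \<bullet> h)) (at x)"
      unfolding has_derivative_at_alt
    proof (intro conjI allI impI bounded_linear_inner_right)
      fix e :: real assume "0 < e"
      \<comment> \<open>Each of the coordinate steps contributes a relative error \<open>2 K + 2\<close>, in units of \<open>r n\<close>;
        the last unit comes from replacing \<open>y0\<close> by \<open>y\<close>.\<close>
      define c where "c = real DIM('a) * (2 * K + 2) + 1"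
      have c: "c > 0" using K by (auto simp: c_def intro!: add_nonneg_pos mult_nonneg_nonneg)
      obtain n where n: "r n < e / c"
        using reals_Archimedean[of "e / c"] \<open>0 < e\<close> c by (auto simp: r_def)
      obtain y where y: "y \<in> D" "norm (y - y0) < r n"
        using D(2)[of "ball y0 (r n)"] r(1)[of n] by (auto simp: dist_norm norm_minus_commute)
      have "\<forall>\<^sub>F t in at 0. \<forall>b\<in>Basis. dist ((g (x + t *\<^sub>R b) - g x) / t) (d b) < r n"
        by (intro eventually_ball_finite ballI tendstoD d r) auto
      then obtain \<delta>0 where \<delta>0: "\<delta>0 > 0" "\<And>t b. t \<noteq> 0 \<Longrightarrow> \<bar>t\<bar> < \<delta>0 \<Longrightarrow> b \<in> Basis \<Longrightarrow>
          \<bar>(g (x + t *\<^sub>R b) - g x) / t - d b\<bar> < r n"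
        unfolding eventually_at by (auto simp: dist_real_def)
      obtain m where m: "r m < \<delta>0" using reals_Archimedean[OF \<delta>0(1)] by (auto simp: r_def)
      have xA: "x \<in> A y (2 * r n) (r m)"
        unfolding A_def
      proof (intro CollectI ballI allI impI)
        fix b :: 'a and t :: real assume b: "b \<in> Basis" and t: "\<bar>t\<bar> \<le> r m"
        show "\<bar>g (x + t *\<^sub>R b) - g x - t * (y \<bullet> b)\<bar> \<le> 2 * r n * \<bar>t\<bar>"
        proof (cases "t = 0")
          case False
          then have "\<bar>(g (x + t *\<^sub>R b) - g x) / t - d b\<bar> < r n"
            using \<delta>0(2)[OF False _ b] t m by simp
          moreover have "\<bar>d b - y \<bullet> b\<bar> \<le> r n"
            using y(2) Basis_le_norm[OF b, of "y - y0"] by (simp add: y0[OF b] inner_diff_left)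
          ultimately have "\<bar>(g (x + t *\<^sub>R b) - g x) / t - y \<bullet> b\<bar> \<le> 2 * r n" by linarith
          then have "\<bar>(g (x + t *\<^sub>R b) - g x) / t - y \<bullet> b\<bar> * \<bar>t\<bar> \<le> 2 * r n * \<bar>t\<bar>"
            by (intro mult_right_mono) auto
          moreover have "((g (x + t *\<^sub>R b) - g x) / t - y \<bullet> b) * t = g (x + t *\<^sub>R b) - g x - t * (y \<bullet> b)"
            using False by (simp add: field_simps)
          ultimately show ?thesis by (simp flip: abs_mult)
        qed simp
      qed
      moreover have "x \<notin> P y (2 * r n) (r m) (r n)" using \<open>x \<notin> N\<close> y(1) by (auto simp: N_def)
      ultimately obtain d0 where d0: "d0 > 0"
        "\<And>h. 0 < norm h \<Longrightarrow> norm h < d0 \<Longrightarrow> ball (x + h) (r n * norm h) \<inter> A y (2 * r n) (r m) \<noteq> {}"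
        unfolding P_def by blast
      show "\<exists>d>0. \<forall>z. norm (z - x) < d \<longrightarrow> norm (g z - g x - y0 \<bullet> (z - x)) \<le> e * norm (z - x)"
      proof (intro exI[of _ "min d0 (r m)"] conjI allI impI)
        fix z assume z: "norm (z - x) < min d0 (r m)"
        define h where "h = z - x"
        define S where "S I = (\<Sum>b\<in>I. (h \<bullet> b) *\<^sub>R b)" for I
        \<comment> \<open>One coordinate step at a time. Both ends of each step are compared with the step from a
          nearby point \<open>a\<close> of the set \<open>A\<close>.\<close>
        have walk: "\<bar>g (x + S I) - g x - y \<bullet> S I\<bar> \<le> card I * ((2 * K + 2) * (r n * norm h))"
          if "finite I" "I \<subseteq> Basis" for I
          using that
        proof (induction I rule: finite_induct)
          case (insert b I)
          have b: "b \<in> Basis" using insert by auto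
          have SI: "norm (S I) \<le> norm h"
          proof (rule norm_le_componentwise)
            fix c :: 'a assume "c \<in> Basis"
            have "S I \<bullet> c = (\<Sum>b\<in>I. if b = c then h \<bullet> c else 0)"
              using insert \<open>c \<in> Basis\<close> unfolding S_def inner_sum_left
              by (intro sum.cong) (auto simp: inner_Basis)
            also have "\<dots> = (if c \<in> I then h \<bullet> c else 0)"
              using insert by simp
            finally show "\<bar>S I \<bullet> c\<bar> \<le> \<bar>h \<bullet> c\<bar>" by auto
          qed
          obtain a where a: "a \<in> A y (2 * r n) (r m)" "norm (x + S I - a) \<le> r n * norm h"
          proof (cases "S I = 0")
            case True
            then show ?thesis using xA r(1)[of n] by (intro that[of x]) (auto intro: mult_nonneg_nonneg less_imp_le)
          next
            case False
            then obtain a where "a \<in> A y (2 * r n) (r m)" "a \<in> ball (x + S I) (r n * norm (S I))"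
              using d0(2)[of "S I"] SI z by (auto simp: h_def)
            moreover have "r n * norm (S I) \<le> r n * norm h" using SI r(1)[of n] by simp
            ultimately show ?thesis by (intro that[of a]) (auto simp: dist_norm)
          qed
          define t where "t = h \<bullet> b"
          have t: "\<bar>t\<bar> \<le> norm h" using Basis_le_norm[OF b] by (simp add: t_def)
          have 1: "\<bar>g (a + t *\<^sub>R b) - g a - t * (y \<bullet> b)\<bar> \<le> 2 * r n * norm h"
          proof -
            have "\<bar>g (a + t *\<^sub>R b) - g a - t * (y \<bullet> b)\<bar> \<le> 2 * r n * \<bar>t\<bar>"
              using a(1) b t z unfolding A_def h_def by force
            also have "\<dots> \<le> 2 * r n * norm h" using t r(1)[of n] by simp
            finally show ?thesis .
          qed
          have 2: "\<bar>g (x + S I) - g a\<bar> \<le> K * (r n * norm h)"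
            using lipD[of "x + S I" a] mult_left_mono[OF a(2) K] by linarith
          have 3: "\<bar>g (x + S I + t *\<^sub>R b) - g (a + t *\<^sub>R b)\<bar> \<le> K * (r n * norm h)"
            using lipD[of "x + S I + t *\<^sub>R b" "a + t *\<^sub>R b"] mult_left_mono[OF a(2) K] by simp
          have 4: "\<bar>g (x + S I) - g x - y \<bullet> S I\<bar> \<le> card I * ((2 * K + 2) * (r n * norm h))"
            using insert by auto
          have "S (insert b I) = S I + t *\<^sub>R b"
            using insert by (simp add: S_def t_def)
          then have "g (x + S (insert b I)) - g x - y \<bullet> S (insert b I)
              = (g (x + S I) - g x - y \<bullet> S I) + (g (x + S I + t *\<^sub>R b) - g (a + t *\<^sub>R b))
                + (g (a + t *\<^sub>R b) - g a - t * (y \<bullet> b)) - (g (x + S I) - g a)"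
            by (simp add: inner_add_right add.assoc)
          moreover have "real (card (insert b I)) * ((2 * K + 2) * (r n * norm h))
              = card I * ((2 * K + 2) * (r n * norm h)) + 2 * (K * (r n * norm h)) + 2 * r n * norm h"
            using insert by (simp add: algebra_simps)
          ultimately show ?case using 1 2 3 4 by linarith
        qed (simp add: S_def)
        have Sh: "S Basis = h" by (simp add: S_def euclidean_representation)
        have "\<bar>y \<bullet> h - y0 \<bullet> h\<bar> \<le> norm (y - y0) * norm h"
          by (metis Cauchy_Schwarz_ineq2 inner_diff_left)
        also have "\<dots> \<le> r n * norm h" using y(2) by (intro mult_right_mono) auto
        finally have "\<bar>g (x + h) - g x - y0 \<bullet> h\<bar> \<le> DIM('a) * ((2 * K + 2) * (r n * norm h)) + r n * norm h"
          using walk[of Basis] unfolding Sh by simp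
        also have "\<dots> = (c * r n) * norm h" by (simp add: c_def algebra_simps)
        also have "\<dots> \<le> e * norm h"
          using n c by (intro mult_right_mono) (auto simp: field_simps)
        finally show "norm (g z - g x - y0 \<bullet> (z - x)) \<le> e * norm (z - x)" by (simp add: h_def)
      qed (use d0 r in auto)
    qed
    then show ?thesis by (auto simp: differentiable_def)
  qed
  ultimately show ?thesis by (elim negligible_subset) auto
qed

text \<open>McShane's formula: the lower envelope of the cones of slope \<open>L\<close> over the graph.\<close>

lemma lipschitz_extension_real:
  fixes k :: "'a::metric_space \<Rightarrow> real"
  assumes lip: "L-lipschitz_on S k"
  obtains k' where "L-lipschitz_on UNIV k'" "\<And>x. x \<in> S \<Longrightarrow> k' x = k x"
proof (cases "S = {}")
  case True
  then show thesis
    using lipschitz_on_nonneg[OF lip] by (intro that[of "\<lambda>_. 0"]) (auto intro: lipschitz_onI)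
next
  case False
  have L: "0 \<le> L" using lip by (rule lipschitz_on_nonneg)
  define k' where "k' x = (INF u\<in>S. k u + L * dist x u)" for x
  obtain u0 where u0: "u0 \<in> S" using False by blast
  have lower: "k u0 - L * dist x u0 \<le> k u + L * dist x u" if "u \<in> S" for x u
  proof -
    have "k u0 - k u \<le> L * dist u0 u"
      using lipschitz_onD[OF lip u0 that] by (simp add: dist_real_def)
    also have "\<dots> \<le> L * (dist x u0 + dist x u)"
      using L dist_triangle2[of u0 u x] by (intro mult_left_mono) (auto simp: dist_commute)
    finally show ?thesis by (simp add: algebra_simps)
  qed
  have bdd: "bdd_below ((\<lambda>u. k u + L * dist x u) ` S)" for x
    using lower by (auto simp: bdd_below_def)
  have half: "k' x \<le> k' y + L * dist x y" for x y
  proof -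
    have "k' x - L * dist x y \<le> k' y"
      unfolding k'_def[of y]
    proof (rule cINF_greatest[OF False])
      fix u assume u: "u \<in> S"
      have "k' x \<le> k u + L * dist x u" unfolding k'_def by (rule cINF_lower[OF bdd u])
      also have "\<dots> \<le> k u + L * (dist x y + dist y u)"
        using L by (intro add_left_mono mult_left_mono dist_triangle)
      finally show "k' x - L * dist x y \<le> k u + L * dist y u" by (simp add: algebra_simps)
    qed
    then show ?thesis by simp
  qed
  show thesis
  proof (rule that[of k'])
    show "L-lipschitz_on UNIV k'"
    proof (rule lipschitz_onI[OF _ L])
      show "dist (k' x) (k' y) \<le> L * dist x y" for x y
        using half[of x y] half[of y x] by (simp add: dist_real_def dist_commute abs_le_iff)
    qed
    fix x assume x: "x \<in> S"
    show "k' x = k x"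
    proof (rule antisym)
      show "k' x \<le> k x" unfolding k'_def using cINF_lower[OF bdd x, of x] by simp
      show "k x \<le> k' x" unfolding k'_def
      proof (rule cINF_greatest[OF False])
        fix u assume u: "u \<in> S"
        show "k x \<le> k u + L * dist x u"
          using lipschitz_onD[OF lip x u] by (simp add: dist_real_def)
      qed
    qed
  qed
qed

lemma lipschitz_inner_right:
  fixes g :: "'a::metric_space \<Rightarrow> 'b::euclidean_space"
  assumes lip: "L-lipschitz_on G g" and "norm c \<le> 1"
  shows "L-lipschitz_on G (\<lambda>x. g x \<bullet> c)"
proof (rule lipschitz_onI)
  fix x y assume xy: "x \<in> G" "y \<in> G"
  have "dist (g x \<bullet> c) (g y \<bullet> c) \<le> norm (g x - g y) * norm c"
    using Cauchy_Schwarz_ineq2[of "g x - g y" c] by (simp add: dist_real_def inner_diff_left)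
  also have "\<dots> \<le> dist (g x) (g y)"
    using \<open>norm c \<le> 1\<close> by (simp add: dist_norm mult_left_le)
  also have "\<dots> \<le> L * dist x y" by (rule lipschitz_onD[OF lip xy])
  finally show "dist (g x \<bullet> c) (g y \<bullet> c) \<le> L * dist x y" .
qed (rule lipschitz_on_nonneg[OF lip])

text \<open>Componentwise, after extending the components to the whole space.\<close>

theorem rademacher:
  fixes g :: "'a::euclidean_space \<Rightarrow> 'b::euclidean_space"
  assumes lip: "L-lipschitz_on G g" and G: "open G"
  shows "negligible {x \<in> G. \<not> g differentiable (at x)}"
proof -
  have "\<exists>k. L-lipschitz_on UNIV k \<and> (\<forall>x\<in>G. k x = g x \<bullet> b)" if "b \<in> Basis" for b
    using lipschitz_extension_real[OF lipschitz_inner_right[OF lip, of b]] that by (metis norm_Basis order_refl)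
  then obtain k where k: "\<And>b. b \<in> Basis \<Longrightarrow> L-lipschitz_on UNIV (k b)"
    "\<And>b x. b \<in> Basis \<Longrightarrow> x \<in> G \<Longrightarrow> k b x = g x \<bullet> b" by metis
  have "negligible (\<Union>b\<in>Basis. {x. \<not> k b differentiable (at x)})"
    by (rule negligible_Union) (auto simp only: finite_imageI finite_Basis dest!: k(1) intro: rademacher_real)
  then show ?thesis
  proof (rule negligible_subset, clarify)
    fix x assume x: "x \<in> G" "\<not> g differentiable (at x)"
    then obtain b where b: "b \<in> Basis" "\<not> (\<lambda>x. g x \<bullet> b) differentiable (at x)"
      using differentiable_componentwise_within[of g x UNIV] by auto
    have "\<not> k b differentiable (at x)"
    proof
      assume "k b differentiable (at x)"
      then obtain k' where "(k b has_derivative k') (at x)" by (auto simp: differentiable_def)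
      then have "((\<lambda>x. g x \<bullet> b) has_derivative k') (at x)"
        by (rule has_derivative_transform_within_open[OF _ G x(1)]) (rule k(2)[OF b(1)])
      with b(2) show False by (auto simp: differentiable_def)
    qed
    with b(1) show "x \<in> (\<Union>b\<in>Basis. {x. \<not> k b differentiable (at x)})" by blast
  qed
qed

section \<open>A mean value inequality for Lipschitz functions\<close>

text \<open>A segment may lie in the exceptional null set. Averaging \<open>k\<close> over the translates of the
  segment by a small ball \<open>Q\<close> repairs this: along the segment, the averages have one-sided slopes
  at most \<open>M\<close> by dominated convergence, and they differ from \<open>k\<close> by at most the Lipschitz constant
  times the radius of \<open>Q\<close>.\<close>

lemma lipschitz_increment_le_of_ae_derivative_real:
  fixes k :: "'a::euclidean_space \<Rightarrow> real"
  assumes lip: "L-lipschitz_on UNIV k" and N: "negligible N" and V: "open V" "convex V"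
    and deriv: "\<And>e. e \<in> V \<Longrightarrow> e \<notin> N \<Longrightarrow> \<exists>k'. (k has_derivative k') (at e) \<and> k' v \<le> M"
    and "0 \<le> T" and a: "a \<in> V" "a + T *\<^sub>R v \<in> V"
  shows "k (a + T *\<^sub>R v) - k a \<le> M * T"
proof -
  have L: "0 \<le> L" using lip by (rule lipschitz_on_nonneg)
  have lipD: "\<bar>k u - k w\<bar> \<le> L * norm (u - w)" for u w
    using lipschitz_onD[OF lip, of u w] by (simp add: dist_norm)
  have cont: "continuous_on A k" for A
    using lipschitz_on_continuous_on[OF lip] continuous_on_subset by blast
  have kc: "continuous_on A (\<lambda>w. k (c + w))" for A c
    by (intro continuous_on_compose2[OF cont[of UNIV]] continuous_intros) auto
  obtain \<rho>0 where \<rho>0: "\<rho>0 > 0" "cball a \<rho>0 \<subseteq> V" "cball (a + T *\<^sub>R v) \<rho>0 \<subseteq> V"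
  proof -
    obtain r1 r2 where "r1 > 0" "cball a r1 \<subseteq> V" "r2 > 0" "cball (a + T *\<^sub>R v) r2 \<subseteq> V"
      using a V(1) open_contains_cball by metis
    moreover have "cball a (min r1 r2) \<subseteq> cball a r1" "cball (a + T *\<^sub>R v) (min r1 r2) \<subseteq> cball (a + T *\<^sub>R v) r2"
      by (auto intro: subset_cball)
    ultimately show thesis by (intro that[of "min r1 r2"]) auto
  qed
  have averaged: "k (a + T *\<^sub>R v) - k a \<le> (M + \<eta>) * T + 2 * L * \<rho>"
    if \<rho>: "0 < \<rho>" "\<rho> \<le> \<rho>0" and \<eta>: "0 < \<eta>" for \<rho> \<eta>
  proof -
    define Q where "Q = cball (0::'a) \<rho>"
    define \<mu> where "\<mu> = lebesgue_on Q"
    define c where "c = measure lebesgue Q"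
    have Q: "Q \<in> lmeasurable" by (simp add: Q_def)
    then have fin: "finite_measure \<mu>" unfolding \<mu>_def by (rule finite_measure_lebesgue_on)
    interpret finite_measure \<mu> by fact
    have cpos: "c > 0" using \<rho> by (simp add: c_def Q_def)
    have space: "space \<mu> = Q" by (simp add: \<mu>_def)
    have c_meas: "measure \<mu> Q = c"
      using Q by (simp add: \<mu>_def c_def measure_restrict_space fmeasurableD)
    have meas: "(\<lambda>w. k (b + w)) \<in> borel_measurable \<mu>" for b
      unfolding \<mu>_def by (intro continuous_imp_measurable_on_sets_lebesgue kc) (simp add: Q fmeasurableD)
    have int: "integrable \<mu> (\<lambda>w. k (b + w))" for b
    proof (rule integrable_const_bound[OF _ meas])
      show "AE w in \<mu>. norm (k (b + w)) \<le> \<bar>k b\<bar> + L * \<rho>"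
      proof (rule AE_I2)
        fix w assume "w \<in> space \<mu>"
        then have "norm w \<le> \<rho>" by (simp add: space Q_def)
        then have "L * norm w \<le> L * \<rho>" using L by (rule mult_left_mono)
        with lipD[of "b + w" b] show "norm (k (b + w)) \<le> \<bar>k b\<bar> + L * \<rho>" by simp
      qed
    qed
    define \<Phi> where "\<Phi> s = (\<integral>w. k (a + s *\<^sub>R v + w) \<partial>\<mu>)" for s
    have \<Phi>_lip: "\<bar>\<Phi> s - \<Phi> t\<bar> \<le> (L * norm v * c) * \<bar>s - t\<bar>" for s t
    proof -
      have "\<Phi> s - \<Phi> t = (\<integral>w. k (a + s *\<^sub>R v + w) - k (a + t *\<^sub>R v + w) \<partial>\<mu>)"
        unfolding \<Phi>_def by (rule Bochner_Integration.integral_diff[symmetric]) (rule int)+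
      also have "norm \<dots> \<le> (\<integral>w. L * norm v * \<bar>s - t\<bar> \<partial>\<mu>)"
      proof (rule Bochner_Integration.integral_norm_bound_integral)
        fix w
        have "norm ((a + s *\<^sub>R v + w) - (a + t *\<^sub>R v + w)) = \<bar>s - t\<bar> * norm v"
          by (simp flip: scaleR_left_diff_distrib)
        then show "norm (k (a + s *\<^sub>R v + w) - k (a + t *\<^sub>R v + w)) \<le> L * norm v * \<bar>s - t\<bar>"
          using lipD[of "a + s *\<^sub>R v + w" "a + t *\<^sub>R v + w"] by (simp add: mult_ac)
      qed (auto intro: int)
      also have "\<dots> = (L * norm v * c) * \<bar>s - t\<bar>" by (simp add: space c_meas)
      finally show ?thesis by simp
    qed
    have \<Phi>_near: "\<bar>\<Phi> s - k (a + s *\<^sub>R v) * c\<bar> \<le> L * \<rho> * c" for s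
    proof -
      have "\<Phi> s - k (a + s *\<^sub>R v) * c = (\<integral>w. k (a + s *\<^sub>R v + w) - k (a + s *\<^sub>R v) \<partial>\<mu>)"
        unfolding \<Phi>_def by (subst Bochner_Integration.integral_diff) (auto intro: int simp: space c_meas)
      also have "norm \<dots> \<le> (\<integral>w. L * \<rho> \<partial>\<mu>)"
      proof (rule Bochner_Integration.integral_norm_bound_integral)
        fix w assume "w \<in> space \<mu>"
        then have "norm w \<le> \<rho>" by (simp add: space Q_def)
        then have "L * norm w \<le> L * \<rho>" using L by (rule mult_left_mono)
        with lipD[of "a + s *\<^sub>R v + w" "a + s *\<^sub>R v"]
        show "norm (k (a + s *\<^sub>R v + w) - k (a + s *\<^sub>R v)) \<le> L * \<rho>" by simp
      qed (auto intro: int)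
      also have "\<dots> = L * \<rho> * c" by (simp add: space c_meas)
      finally show ?thesis by simp
    qed
    have "(M + \<eta>) * 0 * c - \<Phi> 0 \<le> (M + \<eta>) * T * c - \<Phi> T"
    proof (rule right_nondecreasing_imp_le[OF _ \<open>0 \<le> T\<close>, of "\<lambda>s. (M + \<eta>) * s * c - \<Phi> s"])
      have "(L * norm v * c)-lipschitz_on {0..T} \<Phi>"
        using \<Phi>_lip L cpos by (intro lipschitz_onI) (auto simp: dist_real_def)
      then show "continuous_on {0..T} (\<lambda>s. (M + \<eta>) * s * c - \<Phi> s)"
        by (intro continuous_intros lipschitz_on_continuous_on)
      fix s e :: real assume s: "0 \<le> s" "s < T" and e: "0 < e"
      define r where "r n = min (e/2) (T - s) / real (Suc n)" for n
      have r: "0 < r n" "r n < e" for n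
      proof -
        have m: "0 < min (e/2) (T - s)" "min (e/2) (T - s) < e" using s e by auto
        then show "0 < r n" by (simp add: r_def)
        have "r n \<le> min (e/2) (T - s) / 1"
          unfolding r_def using m by (intro divide_left_mono) auto
        with m show "r n < e" by simp
      qed
      have "(\<lambda>n. min (e/2) (T - s) * inverse (real (Suc n))) \<longlonglongrightarrow> min (e/2) (T - s) * 0"
        by (intro tendsto_intros LIMSEQ_inverse_real_of_nat)
      then have r0: "r \<longlonglongrightarrow> 0" by (simp only: r_def[abs_def] divide_inverse mult_zero_right)
      define q where "q n w = (k (a + (s + r n) *\<^sub>R v + w) - k (a + s *\<^sub>R v + w)) / r n" for n w
      \<comment> \<open>The quotients converge for almost every \<open>w\<close>; the total function \<open>lim\<close> yields a measurable
        limit.\<close>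
      define f where "f w = lim (\<lambda>n. q n w)" for w
      have qm: "q n \<in> borel_measurable \<mu>" for n
        unfolding q_def by (intro borel_measurable_divide borel_measurable_diff meas borel_measurable_const)
      have fm: "f \<in> borel_measurable \<mu>"
        unfolding f_def by (intro borel_measurable_lim_metric qm)
      have inV: "a + s *\<^sub>R v + w \<in> V" if "w \<in> Q" for w
      proof -
        have "norm w \<le> \<rho>0" using that \<rho> by (simp add: Q_def)
        then have "a + w \<in> V" "a + T *\<^sub>R v + w \<in> V" using \<rho>0 by (auto simp: subset_iff dist_norm)
        then have "(1 - s/T) *\<^sub>R (a + w) + (s/T) *\<^sub>R (a + T *\<^sub>R v + w) \<in> V"
          using s by (intro convexD[OF V(2)]) auto
        also have "(1 - s/T) *\<^sub>R (a + w) + (s/T) *\<^sub>R (a + T *\<^sub>R v + w) = a + s *\<^sub>R v + w"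
          using s by (simp add: algebra_simps)
        finally show ?thesis .
      qed
      have lim: "(\<lambda>n. q n w) \<longlonglongrightarrow> f w \<and> f w \<le> M" if w: "w \<in> Q" "a + s *\<^sub>R v + w \<notin> N" for w
      proof -
        obtain k' where k': "(k has_derivative k') (at (a + s *\<^sub>R v + w))" "k' v \<le> M"
          using deriv[OF inV[OF w(1)] w(2)] by blast
        have "((\<lambda>t. k (a + s *\<^sub>R v + w + t *\<^sub>R v)) has_derivative (\<lambda>t. k' (t *\<^sub>R v))) (at 0)"
          by (rule has_derivative_compose[of "\<lambda>t. a + s *\<^sub>R v + w + t *\<^sub>R v" _ 0 UNIV k k'])
            (use k'(1) in \<open>auto intro!: derivative_eq_intros\<close>)
        moreover have "(\<lambda>t. k' (t *\<^sub>R v)) = (*) (k' v)"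
          using linear_cmul[OF has_derivative_linear[OF k'(1)]] by (auto simp: mult.commute)
        ultimately have "((\<lambda>t. k (a + s *\<^sub>R v + w + t *\<^sub>R v)) has_field_derivative k' v) (at 0)"
          by (simp add: has_field_derivative_def)
        then have "((\<lambda>t. (k (a + s *\<^sub>R v + w + t *\<^sub>R v) - k (a + s *\<^sub>R v + w)) / t) \<longlongrightarrow> k' v) (at 0)"
          by (simp add: DERIV_def)
        then have "(\<lambda>n. (k (a + s *\<^sub>R v + w + r n *\<^sub>R v) - k (a + s *\<^sub>R v + w)) / r n) \<longlonglongrightarrow> k' v"
          by (rule filterlim_compose) (use r r0 in \<open>auto simp: filterlim_at less_imp_neq[symmetric] intro!: always_eventually\<close>)
        also have "(\<lambda>n. (k (a + s *\<^sub>R v + w + r n *\<^sub>R v) - k (a + s *\<^sub>R v + w)) / r n) = (\<lambda>n. q n w)"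
          by (simp add: q_def scaleR_left_distrib algebra_simps)
        finally show ?thesis using k'(2) by (auto simp: f_def limI)
      qed
      have nullt: "negligible ((\<lambda>w. - (a + s *\<^sub>R v) + w) ` N)" by (rule negligible_translation[OF N])
      have AEw: "AE w in \<mu>. a + s *\<^sub>R v + w \<notin> N"
      proof -
        have "AE w in lebesgue. w \<notin> (\<lambda>w. - (a + s *\<^sub>R v) + w) ` N"
          using nullt by (intro AE_not_in) (simp add: negligible_iff_null_sets)
        then have "AE w in lebesgue. a + s *\<^sub>R v + w \<notin> N"
        proof eventually_elim
          case (elim w)
          show ?case
          proof
            assume "a + s *\<^sub>R v + w \<in> N"
            then have "- (a + s *\<^sub>R v) + (a + s *\<^sub>R v + w) \<in> (\<lambda>w. - (a + s *\<^sub>R v) + w) ` N"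
              by (rule imageI)
            moreover have "- (a + s *\<^sub>R v) + (a + s *\<^sub>R v + w) = w" by simp
            ultimately show False using elim by simp
          qed
        qed
        then show ?thesis unfolding \<mu>_def by (subst AE_restrict_space_iff) (auto simp: Q_def)
      qed
      have AEq: "AE w in \<mu>. (\<lambda>n. q n w) \<longlonglongrightarrow> f w \<and> f w \<le> M"
        using AEw AE_space by eventually_elim (use lim space in auto)
      have bd: "norm (q n w) \<le> L * norm v" for n w
      proof -
        have "norm ((a + (s + r n) *\<^sub>R v + w) - (a + s *\<^sub>R v + w)) = r n * norm v"
          using r(1)[of n] by (simp flip: scaleR_left_diff_distrib)
        then have "\<bar>k (a + (s + r n) *\<^sub>R v + w) - k (a + s *\<^sub>R v + w)\<bar> \<le> L * (r n * norm v)"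
          using lipD[of "a + (s + r n) *\<^sub>R v + w" "a + s *\<^sub>R v + w"] by simp
        then show ?thesis using r(1)[of n] by (simp add: q_def field_simps)
      qed
      note dc = fm qm integrable_const[of "L * norm v"]
      have AElim: "AE w in \<mu>. (\<lambda>n. q n w) \<longlonglongrightarrow> f w" and AEbd: "AE w in \<mu>. norm (q n w) \<le> L * norm v" for n
        using AEq bd by auto
      have conv: "(\<lambda>n. integral\<^sup>L \<mu> (q n)) \<longlonglongrightarrow> integral\<^sup>L \<mu> f"
        by (rule integral_dominated_convergence[OF dc AElim AEbd])
      have "integrable \<mu> f"
        by (rule integrable_dominated_convergence[OF dc AElim AEbd])
      have "integral\<^sup>L \<mu> f \<le> (\<integral>w. M \<partial>\<mu>)"
        using AEq \<open>integrable \<mu> f\<close> by (intro integral_mono_AE) auto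
      then have "integral\<^sup>L \<mu> f < (M + \<eta>) * c" using mult_pos_pos[OF \<eta> cpos] by (simp add: space c_meas algebra_simps)
      then have "\<forall>\<^sub>F n in sequentially. integral\<^sup>L \<mu> (q n) < (M + \<eta>) * c"
        by (rule order_tendstoD(2)[OF conv])
      then obtain n where n: "integral\<^sup>L \<mu> (q n) < (M + \<eta>) * c" by (auto simp: eventually_sequentially)
      have "integral\<^sup>L \<mu> (q n) = (\<Phi> (s + r n) - \<Phi> s) / r n"
        unfolding q_def \<Phi>_def by (simp add: Bochner_Integration.integral_diff int)
      then have "(\<Phi> (s + r n) - \<Phi> s) / r n \<le> (M + \<eta>) * c" using n by simp
      then have "\<Phi> (s + r n) - \<Phi> s \<le> (M + \<eta>) * c * r n"
        using r(1)[of n] by (simp only: pos_divide_le_eq)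
      then show "\<exists>t>0. t < e \<and> (M + \<eta>) * s * c - \<Phi> s \<le> (M + \<eta>) * (s + t) * c - \<Phi> (s + t)"
        using r[of n] by (intro exI[of _ "r n"]) (auto simp: algebra_simps)
    qed
    then have "\<Phi> T - \<Phi> 0 \<le> (M + \<eta>) * T * c" by simp
    then have "k (a + T *\<^sub>R v) * c - k a * c \<le> (M + \<eta>) * T * c + 2 * (L * \<rho> * c)"
      using \<Phi>_near[of T] \<Phi>_near[of 0] by simp
    then have "(k (a + T *\<^sub>R v) - k a) * c \<le> ((M + \<eta>) * T + 2 * L * \<rho>) * c" by (simp add: algebra_simps)
    then show ?thesis using cpos by simp
  qed
  show ?thesis
  proof (rule field_le_epsilon)
    fix e :: real assume "0 < e"
    define \<eta> where "\<eta> = e / (2 * (T + 1))"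
    define \<rho> where "\<rho> = min \<rho>0 (e / (4 * (L + 1)))"
    have "0 < \<eta>" "0 < \<rho>" "\<rho> \<le> \<rho>0" using \<open>0 < e\<close> \<open>0 \<le> T\<close> L \<rho>0 by (auto simp: \<eta>_def \<rho>_def)
    moreover have "\<eta> * T \<le> e / 2"
      using \<open>0 < e\<close> \<open>0 \<le> T\<close> by (simp add: \<eta>_def field_simps)
    moreover have "2 * L * \<rho> \<le> e / 2"
    proof -
      have "2 * L * \<rho> \<le> 2 * L * (e / (4 * (L + 1)))"
        using L by (intro mult_left_mono) (auto simp: \<rho>_def)
      also have "\<dots> \<le> e / 2" using L \<open>0 < e\<close> by (simp add: field_simps)
      finally show ?thesis .
    qed
    ultimately show "k (a + T *\<^sub>R v) - k a \<le> M * T + e"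
      using averaged[of \<rho> \<eta>] by (simp add: algebra_simps)
  qed
qed

text \<open>Apply the scalar inequality to the component of \<open>g\<close> in the direction of the error vector.\<close>

theorem lipschitz_increment_of_derivative_near:
  fixes g :: "'a::euclidean_space \<Rightarrow> 'b::euclidean_space"
  assumes lip: "L-lipschitz_on V g" and V: "open V" "convex V"
    and deriv: "\<And>e A. e \<in> V \<Longrightarrow> (g has_derivative A) (at e) \<Longrightarrow> norm (A v - l) \<le> \<epsilon>"
    and "0 \<le> t" and a: "a \<in> V" "a + t *\<^sub>R v \<in> V"
  shows "norm (g (a + t *\<^sub>R v) - g a - t *\<^sub>R l) \<le> \<epsilon> * t"
proof -
  define D where "D = g (a + t *\<^sub>R v) - g a - t *\<^sub>R l"
  define c where "c = sgn D"
  have c: "norm c \<le> 1" by (simp add: c_def norm_sgn)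
  obtain k where k: "L-lipschitz_on UNIV k" "\<And>x. x \<in> V \<Longrightarrow> k x = g x \<bullet> c"
    using lipschitz_extension_real[OF lipschitz_inner_right[OF lip c]] by metis
  have "k (a + t *\<^sub>R v) - k a \<le> (l \<bullet> c + \<epsilon>) * t"
  proof (rule lipschitz_increment_le_of_ae_derivative_real[OF k(1) rademacher[OF lip V(1)] V _ \<open>0 \<le> t\<close> a])
    fix e assume e: "e \<in> V" "e \<notin> {x \<in> V. \<not> g differentiable at x}"
    then obtain A where A: "(g has_derivative A) (at e)" by (auto simp: differentiable_def)
    then have "((\<lambda>x. g x \<bullet> c) has_derivative (\<lambda>h. A h \<bullet> c)) (at e)"
      by (rule has_derivative_inner_left)
    then have "(k has_derivative (\<lambda>h. A h \<bullet> c)) (at e)"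
      by (rule has_derivative_transform_within_open[OF _ V(1) e(1)]) (simp add: k(2))
    moreover have "A v \<bullet> c \<le> l \<bullet> c + \<epsilon>"
    proof -
      have "(A v - l) \<bullet> c \<le> norm (A v - l) * norm c" by (rule norm_cauchy_schwarz)
      also have "\<dots> \<le> norm (A v - l)" using c by (simp add: mult_left_le)
      also have "\<dots> \<le> \<epsilon>" by (rule deriv[OF e(1) A])
      finally show ?thesis by (simp add: inner_diff_left)
    qed
    ultimately show "\<exists>k'. (k has_derivative k') (at e) \<and> k' v \<le> l \<bullet> c + \<epsilon>" by blast
  qed
  then have "D \<bullet> c \<le> \<epsilon> * t" by (simp add: D_def k(2) a inner_diff_left algebra_simps)
  moreover have "D \<bullet> c = norm D"
    by (cases "D = 0") (simp_all add: c_def sgn_div_norm power2_norm_eq_inner[symmetric] power2_eq_square)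
  ultimately show ?thesis by (simp add: D_def)
qed

section \<open>Tangent cones by difference quotients\<close>

lemma inverse_Suc_seq:
  obtains r :: "nat \<Rightarrow> real" where "\<And>k. 0 < r k" "r \<longlonglongrightarrow> 0"
  using LIMSEQ_inverse_real_of_nat by (rule that[rotated]) simp

lemma nonpos_of_le_mult_epsilon:
  fixes x c :: real
  assumes le: "\<And>e. 0 < e \<Longrightarrow> e \<le> 1 \<Longrightarrow> x \<le> e * c"
  shows "x \<le> 0"
proof (rule field_le_epsilon)
  fix d :: real assume "0 < d"
  define e where "e = min 1 (d / (\<bar>c\<bar> + 1))"
  have e: "0 < e" "e \<le> 1" "e \<le> d / (\<bar>c\<bar> + 1)" using \<open>0 < d\<close> by (auto simp: e_def add_nonneg_pos)
  have "x \<le> e * (\<bar>c\<bar> + 1)" using le[OF e(1,2)] mult_left_mono[of c "\<bar>c\<bar> + 1" e] e(1) by linarith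
  also have "\<dots> \<le> d" using e(3) by (subst (asm) pos_le_divide_eq) auto
  finally show "x \<le> 0 + d" by simp
qed

lemma dist_null_imp_tendsto:
  assumes "\<And>k. dist (a k) z \<le> r k" "r \<longlonglongrightarrow> 0"
  shows "a \<longlonglongrightarrow> z"
  by (rule iffD2[OF tendsto_dist_iff], rule tendsto_sandwich[OF _ _ tendsto_const assms(2)])
    (auto intro!: always_eventually simp: assms(1))

lemma bounded_subsequence:
  fixes q :: "nat \<Rightarrow> 'a::euclidean_space"
  assumes "\<And>k. norm (q k) \<le> c"
  obtains s w where "strict_mono s" "(\<lambda>k. q (s k)) \<longlonglongrightarrow> w"
proof -
  have "bounded (range q)" using assms by (auto simp: bounded_iff)
  then obtain w s where "strict_mono s" "(q \<circ> s) \<longlonglongrightarrow> w"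
    using bounded_imp_convergent_subsequence by blast
  with that show thesis by (simp add: o_def)
qed

lemma edist_set_less_iff: "edist_set x C < ereal e \<longleftrightarrow> (\<exists>c\<in>C. dist x c < e)"
  by (simp add: edist_set_def INF_less_iff)

lemma edist_set_nonneg: "0 \<le> edist_set x C"
  unfolding edist_set_def by (intro INF_greatest) simp

text \<open>Both set limits are used only through this and the next description, in which the extended
  distance no longer occurs.\<close>

lemma mem_outer_limit_iff:
  "x \<in> outer_limit G C \<longleftrightarrow> (\<forall>e>0. \<exists>\<^sub>F t in G. \<exists>c\<in>C t. dist x c < e)"
proof
  assume x: "x \<in> outer_limit G C"
  show "\<forall>e>0. \<exists>\<^sub>F t in G. \<exists>c\<in>C t. dist x c < e"
  proof (intro allI impI, rule ccontr)
    fix e :: real assume "0 < e" "\<not> (\<exists>\<^sub>F t in G. \<exists>c\<in>C t. dist x c < e)"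
    then have "\<forall>\<^sub>F t in G. ereal e \<le> edist_set x (C t)"
      by (simp add: not_frequently not_less flip: edist_set_less_iff)
    then have "ereal e \<le> Liminf G (\<lambda>t. edist_set x (C t))" by (rule Liminf_bounded)
    with x \<open>0 < e\<close> show False by (simp add: outer_limit_def)
  qed
next
  assume f: "\<forall>e>0. \<exists>\<^sub>F t in G. \<exists>c\<in>C t. dist x c < e"
  have "Liminf G (\<lambda>t. edist_set x (C t)) \<le> 0"
  proof (rule ccontr)
    assume "\<not> ?thesis"
    then obtain e where e: "0 < ereal e" "ereal e < Liminf G (\<lambda>t. edist_set x (C t))"
      using ereal_dense2[of 0] by (auto simp: not_le)
    from less_LiminfD[OF e(2)] have "\<forall>\<^sub>F t in G. \<not> (\<exists>c\<in>C t. dist x c < e)"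
      by eventually_elim (use edist_set_less_iff in \<open>metis less_asym\<close>)
    with f e(1) show False by (simp add: frequently_def)
  qed
  moreover have "0 \<le> Liminf G (\<lambda>t. edist_set x (C t))"
    by (intro Liminf_bounded always_eventually allI edist_set_nonneg)
  ultimately show "x \<in> outer_limit G C" by (simp add: outer_limit_def)
qed

lemma mem_inner_limit_iff:
  assumes "G \<noteq> bot"
  shows "x \<in> inner_limit G C \<longleftrightarrow> (\<forall>e>0. \<forall>\<^sub>F t in G. \<exists>c\<in>C t. dist x c < e)"
proof
  assume x: "x \<in> inner_limit G C"
  show "\<forall>e>0. \<forall>\<^sub>F t in G. \<exists>c\<in>C t. dist x c < e"
  proof (intro allI impI)
    fix e :: real assume "0 < e"
    then have "Limsup G (\<lambda>t. edist_set x (C t)) < ereal e" using x by (simp add: inner_limit_def)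
    from Limsup_lessD[OF this] show "\<forall>\<^sub>F t in G. \<exists>c\<in>C t. dist x c < e" by (simp add: edist_set_less_iff)
  qed
next
  assume f: "\<forall>e>0. \<forall>\<^sub>F t in G. \<exists>c\<in>C t. dist x c < e"
  have "Limsup G (\<lambda>t. edist_set x (C t)) \<le> 0"
  proof (rule ccontr)
    assume "\<not> ?thesis"
    then obtain e where e: "0 < ereal e" "ereal e < Limsup G (\<lambda>t. edist_set x (C t))"
      using ereal_dense2[of 0] by (auto simp: not_le)
    have "\<forall>\<^sub>F t in G. edist_set x (C t) \<le> ereal e"
      using f e(1) by (auto elim!: eventually_mono simp: less_imp_le simp flip: edist_set_less_iff)
    then have "Limsup G (\<lambda>t. edist_set x (C t)) \<le> ereal e" by (rule Limsup_bounded)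
    with e(2) show False by simp
  qed
  moreover have "0 \<le> Limsup G (\<lambda>t. edist_set x (C t))"
    by (rule order_trans[OF _ Liminf_le_Limsup[OF assms]])
      (intro Liminf_bounded always_eventually allI edist_set_nonneg)
  ultimately show "x \<in> inner_limit G C" by (simp add: inner_limit_def)
qed

lemma eventually_nhds_in:
  fixes z :: "'a::metric_space"
  shows "eventually P (nhds_in \<Omega> z) \<longleftrightarrow> (\<exists>d>0. \<forall>a\<in>\<Omega>. dist a z < d \<longrightarrow> P a)"
  by (auto simp: nhds_in_def eventually_inf_principal eventually_nhds_metric)

lemma eventually_nhds_in_times_at_right:
  fixes z :: "'a::metric_space"
  shows "eventually P (nhds_in \<Omega> z \<times>\<^sub>F at_right 0)
    \<longleftrightarrow> (\<exists>d>0::real. \<forall>a\<in>\<Omega>. \<forall>t. dist a z < d \<longrightarrow> 0 < t \<longrightarrow> t < d \<longrightarrow> P (a, t))" (is "_ \<longleftrightarrow> ?R")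
proof
  assume "eventually P (nhds_in \<Omega> z \<times>\<^sub>F at_right 0)"
  then obtain P1 P2 where P: "eventually P1 (nhds_in \<Omega> z)" "eventually P2 (at_right (0::real))"
    "\<And>a t. P1 a \<Longrightarrow> P2 t \<Longrightarrow> P (a, t)" by (auto simp: eventually_prod_filter)
  obtain d1 where d1: "d1 > 0" "\<And>a. a \<in> \<Omega> \<Longrightarrow> dist a z < d1 \<Longrightarrow> P1 a"
    using P(1) by (auto simp: eventually_nhds_in)
  obtain d2 where d2: "d2 > 0" "\<And>t. 0 < t \<Longrightarrow> t < d2 \<Longrightarrow> P2 t"
    using P(2) by (auto simp: eventually_at_right_field)
  show ?R using d1 d2 P(3) by (intro exI[of _ "min d1 d2"]) auto
next
  assume ?R
  then obtain d where d: "d > 0" "\<And>a t. a \<in> \<Omega> \<Longrightarrow> dist a z < d \<Longrightarrow> 0 < t \<Longrightarrow> t < d \<Longrightarrow> P (a, t)"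
    by blast
  show "eventually P (nhds_in \<Omega> z \<times>\<^sub>F at_right 0)"
    unfolding eventually_prod_filter
  proof (intro exI conjI allI impI)
    show "\<forall>\<^sub>F a in nhds_in \<Omega> z. a \<in> \<Omega> \<and> dist a z < d" using d(1) by (auto simp: eventually_nhds_in)
    show "\<forall>\<^sub>F t in at_right 0. 0 < t \<and> t < d" using d(1) by (auto simp: eventually_at_right_field)
  qed (use d(2) in auto)
qed

lemma norm_scaleR_inverse_le:
  fixes x :: "'a::real_normed_vector"
  assumes "0 < t" "norm x \<le> c * t"
  shows "norm (x /\<^sub>R t) \<le> c"
proof -
  have "norm (x /\<^sub>R t) = norm x / t" using assms(1) by (simp add: divide_inverse mult.commute)
  then show ?thesis using assms by (simp only: pos_divide_le_eq)
qed

lemma diff_quot_near_iff: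
  assumes "0 < t"
  shows "(\<exists>c\<in>diff_quot \<Omega> a t. dist w c < e) \<longleftrightarrow> (\<exists>b\<in>\<Omega>. norm (b - a - t *\<^sub>R w) < e * t)"
proof -
  have "dist w ((b - a) /\<^sub>R t) < e \<longleftrightarrow> norm (b - a - t *\<^sub>R w) < e * t" for b
  proof -
    have "b - a - t *\<^sub>R w = - (t *\<^sub>R (w - (b - a) /\<^sub>R t))"
      using assms by (simp add: scaleR_diff_right)
    then have "norm (b - a - t *\<^sub>R w) = t * dist w ((b - a) /\<^sub>R t)"
      using assms by (simp add: dist_norm)
    then show ?thesis using assms by (simp add: mult.commute)
  qed
  then show ?thesis by (auto simp: diff_quot_def)
qed

lemma mem_tangent_cone_iff:
  "w \<in> tangent_cone \<Omega> z \<longleftrightarrow>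
    (\<forall>e>0. \<forall>d>0. \<exists>t. 0 < t \<and> t < d \<and> (\<exists>b\<in>\<Omega>. norm (b - z - t *\<^sub>R w) < e * t))"
  unfolding tangent_cone_def mem_outer_limit_iff frequently_def eventually_at_right_field
  using diff_quot_near_iff by (auto; metis)

lemma mem_paratingent_cone_iff:
  "w \<in> paratingent_cone \<Omega> z \<longleftrightarrow>
    (\<forall>e>0. \<forall>d>0. \<exists>a\<in>\<Omega>. \<exists>t. dist a z < d \<and> 0 < t \<and> t < d \<and> (\<exists>b\<in>\<Omega>. norm (b - a - t *\<^sub>R w) < e * t))"
  unfolding paratingent_cone_def mem_outer_limit_iff frequently_def eventually_nhds_in_times_at_right
  using diff_quot_near_iff by (auto; metis)

lemma nhds_in_times_at_right_neq_bot:
  fixes z :: "'a::metric_space"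
  assumes "z \<in> \<Omega>"
  shows "nhds_in \<Omega> z \<times>\<^sub>F at_right (0::real) \<noteq> bot"
proof
  assume "nhds_in \<Omega> z \<times>\<^sub>F at_right (0::real) = bot"
  then have "eventually (\<lambda>_. False) (nhds_in \<Omega> z \<times>\<^sub>F at_right (0::real))" by simp
  then obtain d :: real where "d > 0" "\<And>a t. a \<in> \<Omega> \<Longrightarrow> dist a z < d \<Longrightarrow> 0 < t \<Longrightarrow> t < d \<Longrightarrow> False"
    unfolding eventually_nhds_in_times_at_right by blast
  from this(2)[of z "d/2"] this(1) assms show False by simp
qed

lemma mem_regular_tangent_cone_iff:
  assumes "z \<in> \<Omega>"
  shows "w \<in> regular_tangent_cone \<Omega> z \<longleftrightarrow>
    (\<forall>e>0. \<exists>d>0. \<forall>a\<in>\<Omega>. \<forall>t. dist a z < d \<longrightarrow> 0 < t \<longrightarrow> t < d \<longrightarrow> (\<exists>b\<in>\<Omega>. norm (b - a - t *\<^sub>R w) < e * t))"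
  unfolding regular_tangent_cone_def mem_inner_limit_iff[OF nhds_in_times_at_right_neq_bot[OF assms]]
    eventually_nhds_in_times_at_right
  using diff_quot_near_iff by (auto; metis)

lemma regular_tangent_coneE:
  assumes "w \<in> regular_tangent_cone \<Omega> z" "z \<in> \<Omega>" "0 < e"
  obtains d where "0 < d"
    "\<And>a t. a \<in> \<Omega> \<Longrightarrow> dist a z < d \<Longrightarrow> 0 < t \<Longrightarrow> t < d \<Longrightarrow> \<exists>b\<in>\<Omega>. norm (b - a - t *\<^sub>R w) < e * t"
proof -
  from assms(1,3) obtain d where d: "0 < d"
    "\<forall>a\<in>\<Omega>. \<forall>t. dist a z < d \<longrightarrow> 0 < t \<longrightarrow> t < d \<longrightarrow> (\<exists>b\<in>\<Omega>. norm (b - a - t *\<^sub>R w) < e * t)"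
    unfolding mem_regular_tangent_cone_iff[OF assms(2)] by (elim allE[of _ e] impE exE conjE) assumption+
  show thesis by (rule that[OF d(1)]) (rule d(2)[rule_format])
qed

lemma not_regular_tangent_coneE:
  assumes "w \<notin> regular_tangent_cone \<Omega> z" "z \<in> \<Omega>"
  obtains e where "0 < e"
    "\<And>d. 0 < d \<Longrightarrow> \<exists>a t. a \<in> \<Omega> \<and> dist a z < d \<and> 0 < t \<and> t < d \<and> (\<forall>b\<in>\<Omega>. \<not> norm (b - a - t *\<^sub>R w) < e * t)"
proof -
  define R where "R e a t \<longleftrightarrow> (\<exists>b\<in>\<Omega>. norm (b - a - t *\<^sub>R w) < e * t)" for e a t
  have "\<not> (\<forall>e>0. \<exists>d>0. \<forall>a\<in>\<Omega>. \<forall>t. dist a z < d \<longrightarrow> 0 < t \<longrightarrow> t < d \<longrightarrow> R e a t)"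
    using assms(1) unfolding mem_regular_tangent_cone_iff[OF assms(2)] R_def .
  then obtain e where "0 < e" "\<not> (\<exists>d>0. \<forall>a\<in>\<Omega>. \<forall>t. dist a z < d \<longrightarrow> 0 < t \<longrightarrow> t < d \<longrightarrow> R e a t)"
    by (simp only: not_all not_imp) (elim exE conjE)
  then have "\<exists>a t. a \<in> \<Omega> \<and> dist a z < d \<and> 0 < t \<and> t < d \<and> \<not> R e a t" if "0 < d" for d
    using that by metis
  then show thesis using that[OF \<open>0 < e\<close>] unfolding R_def bex_simps(8)[symmetric] by (metis (lifting))
qed

lemma mem_limiting_normal_cone_iff:
  "v \<in> limiting_normal_cone \<Omega> z \<longleftrightarrow>
    (\<forall>e>0. \<forall>d>0. \<exists>a\<in>\<Omega>. dist a z < d \<and> (\<exists>c\<in>regular_normal_cone \<Omega> a. norm (v - c) < e))"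
  unfolding limiting_normal_cone_def mem_outer_limit_iff frequently_def eventually_nhds_in dist_norm
  by (auto; metis)

lemma tangent_subset_paratingent:
  assumes "z \<in> \<Omega>" shows "tangent_cone \<Omega> z \<subseteq> paratingent_cone \<Omega> z"
  using assms unfolding mem_tangent_cone_iff mem_paratingent_cone_iff subset_iff by (metis dist_self)

lemma regular_tangent_subset_tangent:
  assumes z: "z \<in> \<Omega>" shows "regular_tangent_cone \<Omega> z \<subseteq> tangent_cone \<Omega> z"
proof
  fix w assume w: "w \<in> regular_tangent_cone \<Omega> z"
  show "w \<in> tangent_cone \<Omega> z"
    unfolding mem_tangent_cone_iff
  proof (intro allI impI)
    fix e d :: real assume "0 < e" "0 < d"
    obtain d' where d': "0 < d'" "\<And>a t. a \<in> \<Omega> \<Longrightarrow> dist a z < d' \<Longrightarrow> 0 < t \<Longrightarrow> t < d' \<Longrightarrow>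
        (\<exists>b\<in>\<Omega>. norm (b - a - t *\<^sub>R w) < e * t)"
      using regular_tangent_coneE[OF w z \<open>0 < e\<close>] by metis
    show "\<exists>t. 0 < t \<and> t < d \<and> (\<exists>b\<in>\<Omega>. norm (b - z - t *\<^sub>R w) < e * t)"
      using d'(1) d'(2)[of z "min d d' / 2"] z \<open>0 < d\<close> by (intro exI[of _ "min d d' / 2"]) auto
  qed
qed

lemma paratingent_cone_sequentially:
  assumes "w \<in> paratingent_cone \<Omega> z"
  obtains a b t where "\<And>k::nat. a k \<in> \<Omega>" "\<And>k. b k \<in> \<Omega>" "\<And>k. 0 < t k" "a \<longlonglongrightarrow> z" "b \<longlonglongrightarrow> z" "t \<longlonglongrightarrow> 0"
    "(\<lambda>k. (b k - a k) /\<^sub>R t k) \<longlonglongrightarrow> w"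
proof -
  obtain r :: "nat \<Rightarrow> real" where r: "\<And>k. 0 < r k" and r0: "r \<longlonglongrightarrow> 0" using inverse_Suc_seq by blast
  have "\<exists>a t b. a \<in> \<Omega> \<and> dist a z < r k \<and> 0 < t \<and> t < r k \<and> b \<in> \<Omega> \<and> norm (b - a - t *\<^sub>R w) < r k * t" for k
    using assms r[of k] unfolding mem_paratingent_cone_iff by blast
  then obtain a t b where abt: "\<And>k. a k \<in> \<Omega>" "\<And>k. dist (a k) z < r k" "\<And>k. 0 < t k" "\<And>k. t k < r k"
      "\<And>k. b k \<in> \<Omega>" "\<And>k. norm (b k - a k - t k *\<^sub>R w) < r k * t k"
    by metis
  have a: "a \<longlonglongrightarrow> z" by (rule dist_null_imp_tendsto[OF less_imp_le[OF abt(2)] r0])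
  have "dist (t k) 0 \<le> r k" for k using abt(3,4)[of k] by simp
  then have t: "t \<longlonglongrightarrow> 0" by (rule dist_null_imp_tendsto[OF _ r0])
  have "norm ((b k - a k) /\<^sub>R t k - w) \<le> r k" for k
  proof -
    have "(b k - a k) /\<^sub>R t k - w = (b k - a k - t k *\<^sub>R w) /\<^sub>R t k"
      using abt(3)[of k] by (simp add: scaleR_diff_right)
    then show ?thesis
      using norm_scaleR_inverse_le[OF abt(3) less_imp_le[OF abt(6)]] by simp
  qed
  then have "(\<lambda>k. (b k - a k) /\<^sub>R t k - w) \<longlonglongrightarrow> 0"
    by (intro Lim_null_comparison[OF always_eventually r0] allI)
  then have q: "(\<lambda>k. (b k - a k) /\<^sub>R t k) \<longlonglongrightarrow> w" by (rule LIM_zero_cancel)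
  have "(\<lambda>k. a k + t k *\<^sub>R ((b k - a k) /\<^sub>R t k)) \<longlonglongrightarrow> z + 0 *\<^sub>R w"
    by (intro tendsto_intros a t q)
  moreover have "a k + t k *\<^sub>R ((b k - a k) /\<^sub>R t k) = b k" for k using abt(3)[of k] by simp
  ultimately have "b \<longlonglongrightarrow> z" by simp
  with that abt(1,3,5) a t q show thesis by blast
qed

lemma paratingent_coneI_sequentially:
  fixes a b :: "nat \<Rightarrow> 'a::real_normed_vector"
  assumes ab: "\<And>k. a k \<in> \<Omega>" "\<And>k. b k \<in> \<Omega>" and t: "\<And>k. 0 < t k" "t \<longlonglongrightarrow> 0" and a: "a \<longlonglongrightarrow> z"
    and q: "(\<lambda>k. (b k - a k) /\<^sub>R t k) \<longlonglongrightarrow> w"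
  shows "w \<in> paratingent_cone \<Omega> z"
  unfolding mem_paratingent_cone_iff
proof (intro allI impI)
  fix e d :: real assume "0 < e" "0 < d"
  have "\<forall>\<^sub>F k in sequentially. dist (a k) z < d \<and> t k < d \<and> dist ((b k - a k) /\<^sub>R t k) w < e"
    using \<open>0 < e\<close> \<open>0 < d\<close> by (intro eventually_conj tendstoD[OF a] order_tendstoD(2)[OF t(2)] tendstoD[OF q])
  then obtain k where k: "dist (a k) z < d" "t k < d" "dist ((b k - a k) /\<^sub>R t k) w < e"
    by (auto simp: eventually_sequentially)
  have "\<exists>c\<in>diff_quot \<Omega> (a k) (t k). dist w c < e"
    using k(3) ab by (auto simp: diff_quot_def dist_commute)
  then show "\<exists>a\<in>\<Omega>. \<exists>t. dist a z < d \<and> 0 < t \<and> t < d \<and> (\<exists>b\<in>\<Omega>. norm (b - a - t *\<^sub>R w) < e * t)"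
    using ab(1) t(1) k(1,2) diff_quot_near_iff[OF t(1)] by blast
qed

lemma tangent_coneI_sequentially:
  fixes b :: "nat \<Rightarrow> 'a::real_normed_vector"
  assumes b: "\<And>k. b k \<in> \<Omega>" and t: "\<And>k. 0 < t k" "t \<longlonglongrightarrow> 0"
    and q: "(\<lambda>k. (b k - z) /\<^sub>R t k) \<longlonglongrightarrow> w"
  shows "w \<in> tangent_cone \<Omega> z"
  unfolding mem_tangent_cone_iff
proof (intro allI impI)
  fix e d :: real assume "0 < e" "0 < d"
  have "\<forall>\<^sub>F k in sequentially. t k < d \<and> dist ((b k - z) /\<^sub>R t k) w < e"
    using \<open>0 < e\<close> \<open>0 < d\<close> by (intro eventually_conj order_tendstoD(2)[OF t(2)] tendstoD[OF q])
  then obtain k where k: "t k < d" "dist ((b k - z) /\<^sub>R t k) w < e"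
    by (auto simp: eventually_sequentially)
  have "\<exists>c\<in>diff_quot \<Omega> z (t k). dist w c < e"
    using k(2) b by (auto simp: diff_quot_def dist_commute)
  then show "\<exists>t. 0 < t \<and> t < d \<and> (\<exists>b\<in>\<Omega>. norm (b - z - t *\<^sub>R w) < e * t)"
    using t(1) k(1) diff_quot_near_iff[OF t(1)] by blast
qed

text \<open>This produces tangent vectors from sequences of steps of proportional length; constant base
  points give tangents, moving ones only paratingents.\<close>

lemma bounded_quotients_cluster:
  fixes a b :: "nat \<Rightarrow> 'a::euclidean_space"
  assumes ab: "\<And>k. a k \<in> \<Omega>" "\<And>k. b k \<in> \<Omega>" and t: "\<And>k. 0 < t k" "t \<longlonglongrightarrow> 0" and a: "a \<longlonglongrightarrow> z"
    and bound: "\<And>k. norm (b k - a k) \<le> c * t k"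
  obtains w s where "strict_mono s" "(\<lambda>k. (b (s k) - a (s k)) /\<^sub>R t (s k)) \<longlonglongrightarrow> w"
    "w \<in> paratingent_cone \<Omega> z" "(\<And>k. a k = z) \<Longrightarrow> w \<in> tangent_cone \<Omega> z"
proof -
  have "norm ((b k - a k) /\<^sub>R t k) \<le> c" for k by (rule norm_scaleR_inverse_le[OF t(1) bound])
  then obtain w s where s: "strict_mono s" and q: "(\<lambda>k. (b (s k) - a (s k)) /\<^sub>R t (s k)) \<longlonglongrightarrow> w"
    using bounded_subsequence[of "\<lambda>k. (b k - a k) /\<^sub>R t k" c] by blast
  have ts: "(\<lambda>k. t (s k)) \<longlonglongrightarrow> 0" and as: "(\<lambda>k. a (s k)) \<longlonglongrightarrow> z"
    using LIMSEQ_subseq_LIMSEQ[OF t(2) s] LIMSEQ_subseq_LIMSEQ[OF a s] by (simp_all add: o_def)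
  show thesis
  proof (rule that[OF s q])
    show "w \<in> paratingent_cone \<Omega> z" by (rule paratingent_coneI_sequentially[OF ab t(1) ts as q])
    show "w \<in> tangent_cone \<Omega> z" if "\<And>k. a k = z"
      using q by (intro tangent_coneI_sequentially[OF ab(2) t(1) ts]) (simp add: that)
  qed
qed

text \<open>A negative factor exchanges the roles of the two sequences, which is what makes the
  paratingent cone symmetric.\<close>

lemma paratingent_cone_scale:
  assumes w: "w \<in> paratingent_cone \<Omega> z" and z: "z \<in> \<Omega>"
  shows "c *\<^sub>R w \<in> paratingent_cone \<Omega> z"
proof -
  obtain a b t where s: "\<And>k::nat. a k \<in> \<Omega>" "\<And>k. b k \<in> \<Omega>" "\<And>k. 0 < t k" "a \<longlonglongrightarrow> z" "b \<longlonglongrightarrow> z" "t \<longlonglongrightarrow> 0"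
    "(\<lambda>k. (b k - a k) /\<^sub>R t k) \<longlonglongrightarrow> w"
    using paratingent_cone_sequentially[OF w] by blast
  consider "c = 0" | "c > 0" | "c < 0" by linarith
  then show ?thesis
  proof cases
    case 1
    have "c *\<^sub>R w = 0" using 1 by simp
    moreover have "0 \<in> paratingent_cone \<Omega> z"
      by (rule paratingent_coneI_sequentially[of "\<lambda>_. z" _ "\<lambda>_. z" t]) (use z s in auto)
    ultimately show ?thesis by (simp only:)
  next
    case 2
    have "(\<lambda>k. t k / c) \<longlonglongrightarrow> 0 / c" using 2 by (intro tendsto_intros s) auto
    moreover have "(\<lambda>k. c *\<^sub>R ((b k - a k) /\<^sub>R t k)) \<longlonglongrightarrow> c *\<^sub>R w" by (intro tendsto_intros s)
    ultimately show ?thesis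
      using 2 s by (intro paratingent_coneI_sequentially[of a _ b "\<lambda>k. t k / c"]) (auto simp: divide_inverse mult.commute)
  next
    case 3
    have "(\<lambda>k. t k / - c) \<longlonglongrightarrow> 0 / - c" using 3 by (intro tendsto_intros s) auto
    moreover have "(\<lambda>k. c *\<^sub>R ((b k - a k) /\<^sub>R t k)) \<longlonglongrightarrow> c *\<^sub>R w" by (intro tendsto_intros s)
    moreover have "c *\<^sub>R ((b k - a k) /\<^sub>R t k) = (a k - b k) /\<^sub>R (t k / - c)" for k
      using 3 by (simp add: divide_inverse algebra_simps)
    ultimately show ?thesis
      using 3 s by (intro paratingent_coneI_sequentially[of b _ a "\<lambda>k. t k / - c"])
        (auto simp: divide_less_0_iff zero_less_divide_iff)
  qed
qed

text \<open>Two moves in succession: the point reached by the first is still close to \<open>z\<close>, so the second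
  is available from there.\<close>

lemma regular_tangent_cone_add:
  assumes v: "v \<in> regular_tangent_cone \<Omega> z" and w: "w \<in> regular_tangent_cone \<Omega> z" and z: "z \<in> \<Omega>"
  shows "v + w \<in> regular_tangent_cone \<Omega> z"
  unfolding mem_regular_tangent_cone_iff[OF z]
proof (intro allI impI)
  fix e :: real assume "0 < e"
  obtain d1 where d1: "d1 > 0" "\<And>a t. a \<in> \<Omega> \<Longrightarrow> dist a z < d1 \<Longrightarrow> 0 < t \<Longrightarrow> t < d1 \<Longrightarrow>
      (\<exists>b\<in>\<Omega>. norm (b - a - t *\<^sub>R v) < (e/2) * t)"
    using regular_tangent_coneE[OF v z half_gt_zero[OF \<open>0 < e\<close>]] by metis
  obtain d2 where d2: "d2 > 0" "\<And>a t. a \<in> \<Omega> \<Longrightarrow> dist a z < d2 \<Longrightarrow> 0 < t \<Longrightarrow> t < d2 \<Longrightarrow>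
      (\<exists>b\<in>\<Omega>. norm (b - a - t *\<^sub>R w) < (e/2) * t)"
    using regular_tangent_coneE[OF w z half_gt_zero[OF \<open>0 < e\<close>]] by metis
  define c where "c = 1 + norm v + e / 2"
  have c: "c \<ge> 1" using \<open>0 < e\<close> by (simp add: c_def)
  define d where "d = min d1 (d2 / (1 + c))"
  have d: "0 < d" "d \<le> d1" "d \<le> d2 / (1 + c)" using d1(1) d2(1) c by (auto simp: d_def)
  have dc: "d * (1 + c) \<le> d2" using d(3) c by (simp add: field_simps)
  show "\<exists>d>0. \<forall>a\<in>\<Omega>. \<forall>t. dist a z < d \<longrightarrow> 0 < t \<longrightarrow> t < d \<longrightarrow> (\<exists>b\<in>\<Omega>. norm (b - a - t *\<^sub>R (v + w)) < e * t)"
  proof (intro exI conjI ballI allI impI)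
    fix a t assume a: "a \<in> \<Omega>" "dist a z < d" and t: "0 < t" "t < d"
    obtain b where b: "b \<in> \<Omega>" "norm (b - a - t *\<^sub>R v) < (e/2) * t"
      using d1(2)[of a t] a t d by auto
    have "dist b z \<le> dist a z + norm (b - a)"
      using dist_triangle[of b z a] by (simp add: dist_norm)
    also have "norm (b - a) \<le> norm (b - a - t *\<^sub>R v) + norm (t *\<^sub>R v)"
      using norm_triangle_ineq[of "b - a - t *\<^sub>R v" "t *\<^sub>R v"] by simp
    also have "\<dots> \<le> t * c" using b(2) t by (simp add: c_def algebra_simps)
    also have "\<dots> \<le> d * c" using t c by simp
    finally have "dist b z < d * (1 + c)" using a(2) by (simp add: algebra_simps)
    moreover have "d \<le> d2" using dc d(1) c by (smt (verit) mult_le_cancel_left1)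
    ultimately obtain b' where b': "b' \<in> \<Omega>" "norm (b' - b - t *\<^sub>R w) < (e/2) * t"
      using d2(2)[OF b(1), of t] dc t by auto
    have "b' - a - t *\<^sub>R (v + w) = (b' - b - t *\<^sub>R w) + (b - a - t *\<^sub>R v)" by (simp add: algebra_simps)
    then have "norm (b' - a - t *\<^sub>R (v + w)) \<le> norm (b' - b - t *\<^sub>R w) + norm (b - a - t *\<^sub>R v)"
      by (simp only: norm_triangle_ineq)
    then have "norm (b' - a - t *\<^sub>R (v + w)) < e * t" using b(2) b'(2) by linarith
    with b'(1) show "\<exists>b\<in>\<Omega>. norm (b - a - t *\<^sub>R (v + w)) < e * t" by blast
  qed (rule d)
qed

lemma strictly_smooth_iff_paratingent_subset:
  assumes z: "z \<in> \<Omega>"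
  shows "strictly_smooth \<Omega> z \<longleftrightarrow> paratingent_cone \<Omega> z \<subseteq> regular_tangent_cone \<Omega> z"
  using tangent_subset_paratingent[OF z] regular_tangent_subset_tangent[OF z]
  by (auto simp: strictly_smooth_def set_limit_exists_def paratingent_cone_def regular_tangent_cone_def)

lemma strictly_smooth_cones_eq:
  assumes "strictly_smooth \<Omega> z" "z \<in> \<Omega>"
  shows "tangent_cone \<Omega> z = paratingent_cone \<Omega> z" "regular_tangent_cone \<Omega> z = paratingent_cone \<Omega> z"
  using assms strictly_smooth_iff_paratingent_subset[OF assms(2)]
    tangent_subset_paratingent[OF assms(2)] regular_tangent_subset_tangent[OF assms(2)] by auto

text \<open>The regular tangent cone is closed under addition and the paratingent cone under arbitrary
  scaling.\<close>

lemma strictly_smooth_imp_subspace: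
  assumes s: "strictly_smooth \<Omega> z" and z: "z \<in> \<Omega>"
  shows "subspace (paratingent_cone \<Omega> z)"
proof -
  note eq = strictly_smooth_cones_eq[OF s z]
  have "0 \<in> paratingent_cone \<Omega> z"
    unfolding eq(1)[symmetric] mem_tangent_cone_iff
  proof (intro allI impI)
    fix e d :: real assume "0 < e" "0 < d"
    then show "\<exists>t. 0 < t \<and> t < d \<and> (\<exists>b\<in>\<Omega>. norm (b - z - t *\<^sub>R 0) < e * t)"
      using z by (intro exI[of _ "d/2"] conjI bexI[of _ z]) auto
  qed
  then show ?thesis
    using regular_tangent_cone_add[OF _ _ z] paratingent_cone_scale[OF _ z]
    unfolding subspace_def eq(2) by blast
qed

section \<open>Sets with a bi-Lipschitz linear projection\<close>

text \<open>A \<open>C\<^sup>1\<close> image of a Lipschitz graph has such a projection near each of its points. The number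
  \<open>d\<close> of a chart is the dimension of \<open>range p\<close>; the target space of \<open>p\<close> is the ambient space so
  that no type depends on \<open>d\<close>.\<close>

locale lipschitz_patch =
  fixes p :: "'a::euclidean_space \<Rightarrow> 'a" and \<Omega> W :: "'a set" and K :: real
  assumes lin: "linear p" and K: "0 \<le> K" and open_W: "open W"
    and contr: "\<And>a b. a \<in> \<Omega> \<Longrightarrow> a \<in> W \<Longrightarrow> b \<in> \<Omega> \<Longrightarrow> b \<in> W \<Longrightarrow> norm (a - b) \<le> K * norm (p a - p b)"
    and openin_proj: "openin (top_of_set (range p)) (p ` (\<Omega> \<inter> W))"
begin

lemma bounded_linear_p: "bounded_linear p" using lin linear_conv_bounded_linear by blast

lemma subspace_range: "subspace (range p)" using lin by (simp add: linear_subspace_image)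

lemma norm_p_le: obtains B where "0 < B" "\<And>x. norm (p x) \<le> B * norm x"
  using linear_bounded_pos[OF lin] by blast

text \<open>From every point of \<open>\<Omega>\<close> near \<open>z\<close> one can move within \<open>\<Omega>\<close> so that the projection moves by \<open>t
  h\<close>, with step size proportional to \<open>t\<close>.\<close>

lemma horizontal_step:
  assumes z: "z \<in> \<Omega>" "z \<in> W" and h: "h \<in> range p"
  obtains d where "0 < d"
    "\<And>a t. a \<in> \<Omega> \<Longrightarrow> dist a z < d \<Longrightarrow> 0 \<le> t \<Longrightarrow> t < d \<Longrightarrow>
      a \<in> W \<and> (\<exists>c\<in>\<Omega> \<inter> W. p c = p a + t *\<^sub>R h \<and> norm (c - a) \<le> K * t * norm h)"
proof -
  obtain B where B: "0 < B" "\<And>x. norm (p x) \<le> B * norm x" using norm_p_le by blast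
  obtain r where r: "r > 0" "ball (p z) r \<inter> range p \<subseteq> p ` (\<Omega> \<inter> W)"
    using openin_proj z unfolding openin_contains_ball by blast
  obtain r' where r': "r' > 0" "ball z r' \<subseteq> W" using open_W z(2) open_contains_ball by blast
  define d where "d = min r' (r / (B + norm h))"
  show thesis
  proof (rule that)
    have Bh: "B + norm h > 0" using B by (simp add: add_pos_nonneg)
    show "0 < d" using r r' Bh by (simp add: d_def)
    fix a t assume a: "a \<in> \<Omega>" "dist a z < d" and t: "0 \<le> t" "t < d"
    have aW: "a \<in> W" using a(2) r' by (auto simp: d_def dist_commute)
    have "norm (p a + t *\<^sub>R h - p z) \<le> norm (p (a - z)) + norm (t *\<^sub>R h)"
      using norm_triangle_ineq[of "p (a - z)" "t *\<^sub>R h"] by (simp add: linear_diff[OF lin] algebra_simps)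
    also have "\<dots> \<le> B * norm (a - z) + t * norm h" using B(2)[of "a - z"] t by simp
    also have "\<dots> < d * (B + norm h)"
      using a(2) t B(1) by (simp add: dist_norm algebra_simps) (smt (verit) mult_strict_left_mono mult_right_mono norm_ge_zero)
    also have "\<dots> \<le> r"
      using min.cobounded2[of r' "r / (B + norm h)"] unfolding d_def pos_le_divide_eq[OF Bh] .
    finally have "p a + t *\<^sub>R h \<in> ball (p z) r" by (simp add: dist_norm norm_minus_commute)
    moreover have "p a + t *\<^sub>R h \<in> range p"
      using h subspace_range by (intro subspace_add subspace_scale) auto
    ultimately obtain c where c: "c \<in> \<Omega> \<inter> W" "p c = p a + t *\<^sub>R h" using r(2) by (auto simp: subset_iff image_iff)
    then have "norm (c - a) \<le> K * norm (t *\<^sub>R h)" using contr[of c a] a aW by auto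
    with t c aW show "a \<in> W \<and> (\<exists>c\<in>\<Omega> \<inter> W. p c = p a + t *\<^sub>R h \<and> norm (c - a) \<le> K * t * norm h)" by auto
  qed
qed

lemma paratingent_norm_le:
  assumes z: "z \<in> W" and w: "w \<in> paratingent_cone \<Omega> z"
  shows "norm w \<le> K * norm (p w)"
proof -
  obtain a b t where s: "\<And>k::nat. a k \<in> \<Omega>" "\<And>k. b k \<in> \<Omega>" "\<And>k. 0 < t k" "a \<longlonglongrightarrow> z" "b \<longlonglongrightarrow> z" "t \<longlonglongrightarrow> 0"
    "(\<lambda>k. (b k - a k) /\<^sub>R t k) \<longlonglongrightarrow> w"
    using paratingent_cone_sequentially[OF w] by blast
  have "\<forall>\<^sub>F k in sequentially. a k \<in> W \<and> b k \<in> W"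
    using topological_tendstoD[OF s(4) open_W z] topological_tendstoD[OF s(5) open_W z] by (rule eventually_conj)
  then have "\<forall>\<^sub>F k in sequentially. norm ((b k - a k) /\<^sub>R t k) \<le> K * norm (p ((b k - a k) /\<^sub>R t k))"
  proof eventually_elim
    case (elim k)
    then have "norm (b k - a k) \<le> K * norm (p (b k - a k))"
      using contr[of "b k" "a k"] s(1,2) by (simp add: linear_diff[OF lin])
    then have "inverse (t k) * norm (b k - a k) \<le> inverse (t k) * (K * norm (p (b k - a k)))"
      using s(3)[of k] by (intro mult_left_mono) auto
    then show ?case using s(3)[of k] by (simp add: linear_cmul[OF lin] mult_ac)
  qed
  moreover have "(\<lambda>k. K * norm (p ((b k - a k) /\<^sub>R t k))) \<longlonglongrightarrow> K * norm (p w)"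
    by (intro tendsto_intros bounded_linear.tendsto[OF bounded_linear_p] s)
  moreover have "(\<lambda>k. norm ((b k - a k) /\<^sub>R t k)) \<longlonglongrightarrow> norm w" by (intro tendsto_intros s)
  ultimately show ?thesis by (intro tendsto_le[OF sequentially_bot])
qed

text \<open>Divide the steps with projection \<open>t h\<close> by \<open>t \<rightarrow> 0\<close> and take a cluster point.\<close>

lemma tangent_lift:
  assumes z: "z \<in> \<Omega>" "z \<in> W" and h: "h \<in> range p"
  obtains w where "w \<in> tangent_cone \<Omega> z" "p w = h"
proof -
  obtain d where d: "0 < d" "\<And>a t. a \<in> \<Omega> \<Longrightarrow> dist a z < d \<Longrightarrow> 0 \<le> t \<Longrightarrow> t < d \<Longrightarrow>
      a \<in> W \<and> (\<exists>c\<in>\<Omega> \<inter> W. p c = p a + t *\<^sub>R h \<and> norm (c - a) \<le> K * t * norm h)"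
    using horizontal_step[OF z h] by blast
  obtain r :: "nat \<Rightarrow> real" where r: "\<And>k. 0 < r k" "r \<longlonglongrightarrow> 0" using inverse_Suc_seq by blast
  define t where "t k = min (r k) (d/2)" for k
  have t: "0 < t k" "t k < d" "t k \<le> r k" for k using d(1) r(1)[of k] by (auto simp: t_def)
  have "dist (t k) 0 \<le> r k" for k using t[of k] by simp
  then have t0: "t \<longlonglongrightarrow> 0" by (rule dist_null_imp_tendsto[OF _ r(2)])
  have "\<exists>c\<in>\<Omega> \<inter> W. p c = p z + t k *\<^sub>R h \<and> norm (c - z) \<le> K * t k * norm h" for k
    using d(2)[of z "t k"] z d(1) t[of k] by auto
  then obtain c where c: "\<And>k. c k \<in> \<Omega>" "\<And>k. p (c k) = p z + t k *\<^sub>R h" "\<And>k. norm (c k - z) \<le> K * t k * norm h"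
    by (metis IntD1)
  have bound: "norm (c k - z) \<le> (K * norm h) * t k" for k using c(3)[of k] by (simp add: mult_ac)
  obtain w s where q: "(\<lambda>k. (c (s k) - z) /\<^sub>R t (s k)) \<longlonglongrightarrow> w" and w: "w \<in> tangent_cone \<Omega> z"
    using bounded_quotients_cluster[OF z(1) c(1) t(1) t0 tendsto_const bound] by metis
  have "p ((c k - z) /\<^sub>R t k) = h" for k
    using t(1)[of k] by (simp add: linear_cmul[OF lin] linear_diff[OF lin] c)
  then have "p w = h" using bounded_linear.tendsto[OF bounded_linear_p q] by (simp add: LIMSEQ_const_iff)
  with w that show thesis by blast
qed

text \<open>Given a paratingent \<open>w\<close> realized by steps from \<open>a\<close> to \<open>b\<close>, choose \<open>l\<close> in the regular tangent
  cone with the same projection and steps from the same \<open>a\<close> to \<open>b'\<close> that realize \<open>l\<close>. Then \<open>b\<close> and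
  \<open>b'\<close> have almost the same projection, so they almost coincide and \<open>w = l\<close>.\<close>

lemma strictly_smooth_of_regular_tangent_onto:
  assumes z: "z \<in> \<Omega>" "z \<in> W" and onto: "range p \<subseteq> p ` regular_tangent_cone \<Omega> z"
  shows "strictly_smooth \<Omega> z"
  unfolding strictly_smooth_iff_paratingent_subset[OF z(1)]
proof
  fix w assume w: "w \<in> paratingent_cone \<Omega> z"
  obtain l where l: "l \<in> regular_tangent_cone \<Omega> z" "p l = p w" using onto by (metis imageE rangeI subsetD)
  obtain B where B: "0 < B" "\<And>x. norm (p x) \<le> B * norm x" using norm_p_le by blast
  obtain r where r: "r > 0" "ball z r \<subseteq> W" using open_W z(2) open_contains_ball by blast
  have "norm (w - l) \<le> e * (2 * K * B + 2)" if e: "0 < e" for e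
  proof -
    obtain d where d: "d > 0" "\<And>a t. a \<in> \<Omega> \<Longrightarrow> dist a z < d \<Longrightarrow> 0 < t \<Longrightarrow> t < d \<Longrightarrow>
        (\<exists>b\<in>\<Omega>. norm (b - a - t *\<^sub>R l) < e * t)"
      using regular_tangent_coneE[OF l(1) z(1) e] by metis
    define c where "c = 1 + norm w + norm l + e"
    have c: "c \<ge> 1" using e by (simp add: c_def)
    define d' where "d' = min d (r / (1 + c))"
    have c1: "1 + c > 0" using c by simp
    have d': "0 < d'" "d' \<le> d" using d(1) r(1) c1 by (auto simp: d'_def)
    have d'r: "d' * (1 + c) \<le> r"
      using min.cobounded2[of d "r / (1 + c)"] unfolding d'_def pos_le_divide_eq[OF c1] .
    obtain a t b where abt: "a \<in> \<Omega>" "dist a z < d'" "0 < t" "t < d'" "b \<in> \<Omega>" "norm (b - a - t *\<^sub>R w) < e * t"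
      using w e d'(1) unfolding mem_paratingent_cone_iff by blast
    obtain b' where b': "b' \<in> \<Omega>" "norm (b' - a - t *\<^sub>R l) < e * t" using d(2)[of a t] abt d'(2) by auto
    have inW: "x \<in> W" if "norm (x - a - t *\<^sub>R u) < e * t" "norm u \<le> norm w + norm l" for x u
    proof -
      have "norm (x - a) \<le> norm (x - a - t *\<^sub>R u) + norm (t *\<^sub>R u)"
        using norm_triangle_ineq[of "x - a - t *\<^sub>R u" "t *\<^sub>R u"] by simp
      also have "\<dots> \<le> e * t + t * (norm w + norm l)" using that abt(3) by (intro add_mono) auto
      also have "\<dots> \<le> t * c" using abt(3) by (simp add: c_def algebra_simps)
      also have "\<dots> \<le> d' * c" using abt(4) c by simp
      finally have "dist x z < d' * (1 + c)"
        using dist_triangle[of x z a] abt(2) by (simp add: dist_norm algebra_simps)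
      then show ?thesis using d'r r(2) by (auto simp: dist_commute)
    qed
    have "b \<in> W" "b' \<in> W" using inW[OF abt(6)] inW[OF b'(2)] by auto
    have pbb: "p b - p b' = p ((b - a - t *\<^sub>R w) - (b' - a - t *\<^sub>R l))"
      by (simp add: linear_diff[OF lin] linear_cmul[OF lin] l(2))
    have bb: "norm ((b - a - t *\<^sub>R w) - (b' - a - t *\<^sub>R l)) \<le> 2 * (e * t)"
      using norm_triangle_ineq4[of "b - a - t *\<^sub>R w" "b' - a - t *\<^sub>R l"] abt(6) b'(2) by simp
    have "norm (p b - p b') \<le> B * (2 * (e * t))"
      unfolding pbb using B(2) bb B(1) by (meson order_trans mult_left_mono less_imp_le)
    then have "norm (b - b') \<le> K * (B * (2 * (e * t)))"
      using contr[OF abt(5) \<open>b \<in> W\<close> b'(1) \<open>b' \<in> W\<close>] K by (meson order_trans mult_left_mono)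
    moreover have "t *\<^sub>R (w - l) = (b - b') - ((b - a - t *\<^sub>R w) - (b' - a - t *\<^sub>R l))"
      by (simp add: algebra_simps)
    then have "norm (t *\<^sub>R (w - l)) \<le> norm (b - b') + norm ((b - a - t *\<^sub>R w) - (b' - a - t *\<^sub>R l))"
      using norm_triangle_ineq4 by metis
    moreover have "norm (t *\<^sub>R (w - l)) = t * norm (w - l)" using abt(3) by simp
    moreover have "K * (B * (2 * (e * t))) + 2 * (e * t) = t * (e * (2 * K * B + 2))"
      by (simp add: algebra_simps)
    ultimately have "t * norm (w - l) \<le> t * (e * (2 * K * B + 2))"
      using bb by linarith
    then show ?thesis using abt(3) by simp
  qed
  then have "norm (w - l) \<le> 0" by (rule nonpos_of_le_mult_epsilon)
  then show "w \<in> regular_tangent_cone \<Omega> z" using l(1) by simp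
qed

text \<open>If \<open>w\<close> were not in the regular tangent cone, there would be base points \<open>a\<close> and step sizes
  \<open>t\<close> tending to \<open>z\<close> and \<open>0\<close> for which \<open>a + t w\<close> stays away from \<open>\<Omega>\<close>. The steps from \<open>a\<close> with
  projection \<open>t (p w)\<close> cluster at a paratingent with the projection of \<open>w\<close>, which by injectivity
  is \<open>w\<close>.\<close>

lemma strictly_smooth_of_inj_on_paratingent:
  assumes z: "z \<in> \<Omega>" "z \<in> W" and inj: "inj_on p (paratingent_cone \<Omega> z)"
  shows "strictly_smooth \<Omega> z"
  unfolding strictly_smooth_iff_paratingent_subset[OF z(1)]
proof
  fix w assume w: "w \<in> paratingent_cone \<Omega> z"
  show "w \<in> regular_tangent_cone \<Omega> z"
  proof (rule ccontr)
    assume "\<not> ?thesis"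
    then obtain e where e: "0 < e"
      "\<And>d. 0 < d \<Longrightarrow> \<exists>a t. a \<in> \<Omega> \<and> dist a z < d \<and> 0 < t \<and> t < d \<and> (\<forall>b\<in>\<Omega>. \<not> norm (b - a - t *\<^sub>R w) < e * t)"
      using not_regular_tangent_coneE[OF _ z(1)] by metis
    obtain d where d: "0 < d" "\<And>a t. a \<in> \<Omega> \<Longrightarrow> dist a z < d \<Longrightarrow> 0 \<le> t \<Longrightarrow> t < d \<Longrightarrow>
      a \<in> W \<and> (\<exists>c\<in>\<Omega> \<inter> W. p c = p a + t *\<^sub>R p w \<and> norm (c - a) \<le> K * t * norm (p w))"
      using horizontal_step[OF z, of "p w"] by blast
    obtain r0 :: "nat \<Rightarrow> real" where r0: "\<And>k. 0 < r0 k" "r0 \<longlonglongrightarrow> 0" using inverse_Suc_seq by blast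
    define r where "r k = min (r0 k) d" for k
    have r: "0 < r k" "r k \<le> d" "r k \<le> r0 k" for k using d(1) r0(1)[of k] by (auto simp: r_def)
    have "\<exists>a t. a \<in> \<Omega> \<and> dist a z < r k \<and> 0 < t \<and> t < r k \<and> (\<forall>b\<in>\<Omega>. \<not> norm (b - a - t *\<^sub>R w) < e * t)" for k
      by (rule e(2)[OF r(1)])
    then obtain a t where at: "\<And>k. a k \<in> \<Omega>" "\<And>k. dist (a k) z < r k" "\<And>k. 0 < t k" "\<And>k. t k < r k"
      "\<And>k b. b \<in> \<Omega> \<Longrightarrow> \<not> norm (b - a k - t k *\<^sub>R w) < e * t k" by metis
    have near: "dist (a k) z \<le> r0 k" "dist (t k) 0 \<le> r0 k" for k using at(2-4)[of k] r(3)[of k] by simp_all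
    note a0 = dist_null_imp_tendsto[OF near(1) r0(2)] and t0 = dist_null_imp_tendsto[OF near(2) r0(2)]
    have "\<exists>c\<in>\<Omega>. p c = p (a k) + t k *\<^sub>R p w \<and> norm (c - a k) \<le> K * t k * norm (p w)" for k
      using d(2)[of "a k" "t k"] at(1-4)[of k] r(2)[of k] by auto
    then obtain c where c: "\<And>k. c k \<in> \<Omega>" "\<And>k. p (c k) = p (a k) + t k *\<^sub>R p w" "\<And>k. norm (c k - a k) \<le> K * t k * norm (p w)"
      by metis
    have bound: "norm (c k - a k) \<le> (K * norm (p w)) * t k" for k using c(3)[of k] by (simp add: mult_ac)
    obtain w' s where q: "(\<lambda>k. (c (s k) - a (s k)) /\<^sub>R t (s k)) \<longlonglongrightarrow> w'" and w': "w' \<in> paratingent_cone \<Omega> z"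
      using bounded_quotients_cluster[OF at(1) c(1) at(3) t0 a0 bound] by metis
    have "p ((c k - a k) /\<^sub>R t k) = p w" for k
      using at(3)[of k] by (simp add: linear_cmul[OF lin] linear_diff[OF lin] c)
    then have "p w' = p w" using bounded_linear.tendsto[OF bounded_linear_p q] by (simp add: LIMSEQ_const_iff)
    then have "w' = w" using inj w w' by (simp add: inj_on_eq_iff)
    then obtain k where "dist ((c (s k) - a (s k)) /\<^sub>R t (s k)) w < e"
      using tendstoD[OF q e(1)] by (auto simp: eventually_sequentially)
    then have "\<exists>c\<in>diff_quot \<Omega> (a (s k)) (t (s k)). dist w c < e"
      using c(1) by (auto simp: diff_quot_def dist_commute)
    then show False using diff_quot_near_iff[OF at(3)] at(5) by blast
  qed
qed

lemma inj_on_paratingent_if_subspace: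
  assumes z: "z \<in> W" and L: "subspace L" "L \<subseteq> paratingent_cone \<Omega> z"
  shows "inj_on p L"
proof (rule inj_onI)
  fix v w assume vw: "v \<in> L" "w \<in> L" "p v = p w"
  then have "v - w \<in> paratingent_cone \<Omega> z" using L subspace_diff by blast
  from paratingent_norm_le[OF z this] vw(3) show "v = w" by (simp add: linear_diff[OF lin])
qed

text \<open>The projection is injective on the paratingent cone and onto \<open>range p\<close> already on the
  tangent cone.\<close>

lemma dim_paratingent_cone:
  assumes z: "z \<in> \<Omega>" "z \<in> W" and sub: "subspace (paratingent_cone \<Omega> z)"
  shows "dim (paratingent_cone \<Omega> z) = dim (range p)"
proof -
  have "h \<in> p ` paratingent_cone \<Omega> z" if "h \<in> range p" for h
    using tangent_lift[OF z that] tangent_subset_paratingent[OF z(1)] by (metis imageI subsetD)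
  then have "p ` paratingent_cone \<Omega> z = range p" by blast
  moreover have "dim (p ` paratingent_cone \<Omega> z) = dim (paratingent_cone \<Omega> z)"
    using inj_on_paratingent_if_subspace[OF z(2) sub order_refl] sub
    by (intro dim_image_eq[OF lin]) (simp add: span_eq_iff[THEN iffD2])
  ultimately show ?thesis by simp
qed

lemma strictly_smooth_of_regular_tangent_dim:
  assumes z: "z \<in> \<Omega>" "z \<in> W" and sub: "subspace (regular_tangent_cone \<Omega> z)"
    and dim: "dim (regular_tangent_cone \<Omega> z) = dim (range p)"
  shows "strictly_smooth \<Omega> z"
proof (rule strictly_smooth_of_regular_tangent_onto[OF z])
  let ?T = "regular_tangent_cone \<Omega> z"
  have "?T \<subseteq> paratingent_cone \<Omega> z"
    using regular_tangent_subset_tangent[OF z(1)] tangent_subset_paratingent[OF z(1)] by blast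
  then have "dim (p ` ?T) = dim ?T"
    using inj_on_paratingent_if_subspace[OF z(2) sub] sub
    by (intro dim_image_eq[OF lin]) (simp add: span_eq_iff[THEN iffD2])
  then have "p ` ?T = range p"
    using dim by (intro subspace_dim_equal linear_subspace_image[OF lin] sub subspace_range) auto
  then show "range p \<subseteq> p ` ?T" by simp
qed

end

section \<open>Orthogonal projections\<close>

lemma orth_proj_unique:
  assumes "subspace L" "q \<in> L" "x - q \<in> L\<^sup>\<bottom>"
  shows "orth_proj L x = q"
  unfolding orth_proj_def
proof (rule the_equality)
  fix q' assume q': "q' \<in> L \<and> x - q' \<in> L\<^sup>\<bottom>"
  have "q' - q \<in> L" using assms q' by (simp add: subspace_diff)
  moreover have "(x - q) - (x - q') \<in> L\<^sup>\<bottom>" 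
    using subspace_diff[OF subspace_orthogonal_comp, of "x - q" L "x - q'"] assms q' by blast
  ultimately have "orthogonal (q' - q) (q' - q)" by (simp add: orthogonal_comp_def)
  then show "q' = q" by (simp add: orthogonal_self)
qed (use assms in auto)

lemma orth_proj:
  assumes L: "subspace L"
  shows orth_proj_in: "orth_proj L x \<in> L" and orth_proj_compl: "x - orth_proj L x \<in> L\<^sup>\<bottom>"
proof -
  obtain q r where "q \<in> span L" "\<And>w. w \<in> span L \<Longrightarrow> orthogonal r w" "x = q + r"
    using orthogonal_subspace_decomp_exists[of L x] by metis
  moreover have "span L = L" using L by (simp add: span_eq_iff)
  ultimately have q: "q \<in> L" "x - q \<in> L\<^sup>\<bottom>" by (auto simp: orthogonal_comp_def orthogonal_commute)
  then show "orth_proj L x \<in> L" "x - orth_proj L x \<in> L\<^sup>\<bottom>" using orth_proj_unique[OF L q] by auto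
qed

lemma linear_orth_proj:
  assumes L: "subspace L" shows "linear (orth_proj L)"
proof (rule linearI)
  note [simp] = orth_proj_in[OF L] orth_proj_compl[OF L]
  show "orth_proj L (x + y) = orth_proj L x + orth_proj L y" for x y
  proof (rule orth_proj_unique[OF L])
    have "(x - orth_proj L x) + (y - orth_proj L y) \<in> L\<^sup>\<bottom>"
      by (intro subspace_add subspace_orthogonal_comp) simp_all
    then show "x + y - (orth_proj L x + orth_proj L y) \<in> L\<^sup>\<bottom>" by (simp add: algebra_simps)
  qed (simp add: L subspace_add)
  show "orth_proj L (c *\<^sub>R x) = c *\<^sub>R orth_proj L x" for c x
  proof (rule orth_proj_unique[OF L])
    have "c *\<^sub>R (x - orth_proj L x) \<in> L\<^sup>\<bottom>"
      by (intro subspace_scale subspace_orthogonal_comp) simp_all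
    then show "c *\<^sub>R x - c *\<^sub>R orth_proj L x \<in> L\<^sup>\<bottom>" by (simp add: algebra_simps)
  qed (simp add: L subspace_scale)
qed

lemma orth_proj_id: "subspace L \<Longrightarrow> x \<in> L \<Longrightarrow> orth_proj L x = x"
  by (rule orth_proj_unique) (auto simp: subspace_0 subspace_orthogonal_comp)

lemma orth_proj_eq_0: "subspace L \<Longrightarrow> x \<in> L\<^sup>\<bottom> \<Longrightarrow> orth_proj L x = 0"
  by (rule orth_proj_unique) (auto simp: subspace_0)

lemma orth_proj_inner:
  assumes L: "subspace L" shows "orth_proj L x \<bullet> y = orth_proj L x \<bullet> orth_proj L y"
proof -
  have "orthogonal (orth_proj L x) (y - orth_proj L y)"
    using orth_proj_in[OF L] orth_proj_compl[OF L] by (simp add: orthogonal_comp_def)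
  then show ?thesis by (simp add: orthogonal_def inner_diff_right)
qed

lemma orth_proj_norm_le:
  assumes L: "subspace L" shows "norm (orth_proj L x) \<le> norm x"
proof -
  have "norm (orth_proj L x) * norm (orth_proj L x) = orth_proj L x \<bullet> x"
    using orth_proj_inner[OF L, of x x] by (simp add: power2_norm_eq_inner[symmetric] power2_eq_square)
  also have "\<dots> \<le> norm (orth_proj L x) * norm x" by (rule norm_cauchy_schwarz)
  finally show ?thesis by (cases "orth_proj L x = 0") auto
qed

lemma range_orth_proj:
  assumes L: "subspace L" shows "range (orth_proj L) = L"
proof
  show "range (orth_proj L) \<subseteq> L" using orth_proj_in[OF L] by blast
  show "L \<subseteq> range (orth_proj L)"
  proof
    fix x assume "x \<in> L"
    then show "x \<in> range (orth_proj L)" using orth_proj_id[OF L] by (metis rangeI)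
  qed
qed

lemma span_Basis_orthogonal_comp:
  fixes S :: "'a::euclidean_space set"
  assumes S: "S \<subseteq> Basis" shows "(span S)\<^sup>\<bottom> = span (Basis - S)"
proof -
  have "x \<in> (span S)\<^sup>\<bottom> \<longleftrightarrow> (\<forall>b\<in>S. x \<bullet> b = 0)" for x
  proof
    assume "x \<in> (span S)\<^sup>\<bottom>"
    then show "\<forall>b\<in>S. x \<bullet> b = 0" by (auto simp: orthogonal_comp_def orthogonal_def span_base inner_commute)
  next
    assume x: "\<forall>b\<in>S. x \<bullet> b = 0"
    have "orthogonal x y" if "y \<in> span S" for y
      by (rule orthogonal_to_span[OF that]) (simp add: orthogonal_def x)
    then show "x \<in> (span S)\<^sup>\<bottom>" by (auto simp: orthogonal_comp_def orthogonal_commute)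
  qed
  moreover have "x \<in> span (Basis - S) \<longleftrightarrow> (\<forall>b\<in>S. x \<bullet> b = 0)" for x
    using S by (subst span_substd_basis) auto
  ultimately show ?thesis by blast
qed

section \<open>Linearization of charts\<close>

text \<open>Mean value inequality for \<open>f - M\<close>, whose derivative is small near \<open>z\<close>.\<close>

lemma C1_imp_strict_derivative:
  fixes f :: "'a::euclidean_space \<Rightarrow> 'b::euclidean_space"
  assumes C1: "continuously_differentiable_on f W" and W: "open W" "z \<in> W"
  obtains M where "(f has_derivative M) (at z)"
    "\<And>e. 0 < e \<Longrightarrow> \<exists>d>0. ball z d \<subseteq> W \<and> (\<forall>a\<in>ball z d. \<forall>b\<in>ball z d. norm (f b - f a - M (b - a)) \<le> e * norm (b - a))"
proof -
  obtain f' :: "'a \<Rightarrow> 'a \<Rightarrow>\<^sub>L 'b" where f': "\<And>x. x \<in> W \<Longrightarrow> (f has_derivative blinfun_apply (f' x)) (at x)"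
    "continuous_on W f'"
    using C1 by (auto simp: continuously_differentiable_on_def)
  show thesis
  proof (rule that)
    show "(f has_derivative blinfun_apply (f' z)) (at z)" using f' W by blast
    fix e :: real assume "0 < e"
    obtain d1 where d1: "d1 > 0" "\<And>x. x \<in> W \<Longrightarrow> dist x z < d1 \<Longrightarrow> dist (f' x) (f' z) < e"
      using f'(2) W(2) \<open>0 < e\<close> unfolding continuous_on_iff by blast
    obtain d2 where d2: "d2 > 0" "ball z d2 \<subseteq> W" using W open_contains_ball by blast
    define d where "d = min d1 d2"
    have d: "d > 0" "ball z d \<subseteq> W" "\<And>x. x \<in> ball z d \<Longrightarrow> norm (f' x - f' z) \<le> e"
      using d1 d2 by (auto simp: d_def dist_commute dist_norm subset_iff intro!: less_imp_le)
    have "norm (f b - f a - f' z (b - a)) \<le> norm (b - a) * e" if ab: "a \<in> ball z d" "b \<in> ball z d" for a b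
    proof (rule differentiable_bound_linearization[where S = "ball z d" and f' = "\<lambda>x. blinfun_apply (f' x)"])
      show "a + t *\<^sub>R (b - a) \<in> ball z d" if "t \<in> {0..1}" for t
      proof -
        have "(1 - t) *\<^sub>R a + t *\<^sub>R b \<in> ball z d" using ab that by (intro convexD[OF convex_ball]) auto
        then show ?thesis by (simp add: algebra_simps)
      qed
      show "(f has_derivative blinfun_apply (f' x)) (at x within ball z d)" if "x \<in> ball z d" for x
        using f'(1) d(2) that by (blast intro: has_derivative_at_withinI)
      show "onorm (blinfun_apply (f' x) - blinfun_apply (f' z)) \<le> e" if "x \<in> ball z d" for x
      proof -
        have "blinfun_apply (f' x) - blinfun_apply (f' z) = blinfun_apply (f' x - f' z)"
          by (auto simp: blinfun.diff_left)
        then show ?thesis using d(3)[OF that] by (simp add: norm_blinfun.rep_eq)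
      qed
      show "z \<in> ball z d" using d(1) by simp
    qed
    then show "\<exists>d>0. ball z d \<subseteq> W \<and> (\<forall>a\<in>ball z d. \<forall>b\<in>ball z d. norm (f b - f a - f' z (b - a)) \<le> e * norm (b - a))"
      using d by (auto simp: mult.commute)
  qed
qed

lemma diffeo_derivative_bijective:
  fixes \<Phi> :: "'a::euclidean_space \<Rightarrow> 'a"
  assumes diffeo: "C1_diffeo_on \<Phi> W" and z: "z \<in> W" and M: "(\<Phi> has_derivative M) (at z)"
  obtains G where "linear G" "\<And>x. G (M x) = x" "\<And>x. M (G x) = x"
proof -
  have W: "open W" "inj_on \<Phi> W" "open (\<Phi> ` W)" and C: "continuously_differentiable_on (inv_into W \<Phi>) (\<Phi> ` W)"
    using diffeo by (auto simp: C1_diffeo_on_def)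
  obtain G where G: "(inv_into W \<Phi> has_derivative G) (at (\<Phi> z))"
    using C z by (auto simp: continuously_differentiable_on_def)
  have linG: "linear G" and linM: "linear M" using G M by (auto dest: has_derivative_linear)
  have "((\<lambda>x. inv_into W \<Phi> (\<Phi> x)) has_derivative (\<lambda>x. G (M x))) (at z)"
    by (rule has_derivative_compose[OF M G])
  then have "((\<lambda>x. x) has_derivative (\<lambda>x. G (M x))) (at z)"
    by (rule has_derivative_transform_within_open[OF _ W(1) z]) (simp add: W(2))
  then have GM: "G (M x) = x" for x
    using has_derivative_unique[OF _ has_derivative_ident] by metis
  have "inj M" using GM by (metis injI)
  then have "surj M" using linear_injective_imp_surjective[OF linM] by blast
  then have "M (G x) = x" for x using GM by (metis surjD)
  with that linG GM show thesis by blast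
qed

lemma lipschitz_chart_coordinates:
  assumes chart: "lipschitz_chart d \<Omega> z W \<Phi> S U f"
  shows chart_proj: "u \<in> U \<Longrightarrow> orth_proj (span S) (u + f u) = u"
    and chart_graph: "a \<in> \<Omega> \<Longrightarrow> a \<in> W \<Longrightarrow>
      orth_proj (span S) (\<Phi> a) \<in> U \<and> \<Phi> a = orth_proj (span S) (\<Phi> a) + f (orth_proj (span S) (\<Phi> a))"
proof -
  have S: "S \<subseteq> Basis" and U: "openin (top_of_set (span S)) U" and f: "f ` U \<subseteq> span (Basis - S)"
    and graph: "\<Phi> ` (\<Omega> \<inter> W) = (\<lambda>u. u + f u) ` U"
    using chart by (auto simp: lipschitz_chart_def)
  show P: "orth_proj (span S) (u + f u) = u" if "u \<in> U" for u
  proof -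
    have "f u \<in> (span S)\<^sup>\<bottom>" using f that span_Basis_orthogonal_comp[OF S] by auto
    moreover have "u \<in> span S" using U that openin_imp_subset by blast
    ultimately show ?thesis using orth_proj_unique[OF subspace_span, of u S "u + f u"] by simp
  qed
  assume "a \<in> \<Omega>" "a \<in> W"
  then have "\<Phi> a \<in> (\<lambda>u. u + f u) ` U" using graph by blast
  then show "orth_proj (span S) (\<Phi> a) \<in> U \<and> \<Phi> a = orth_proj (span S) (\<Phi> a) + f (orth_proj (span S) (\<Phi> a))"
    using P by auto
qed

text \<open>With \<open>M\<close> the derivative of the chart at \<open>z\<close>, take for \<open>p\<close> the coordinate projection after
  \<open>M\<close>. On \<open>\<Omega>\<close> near \<open>z\<close> it differs from the chart coordinate \<open>u\<close> by a map with small Lipschitz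
  constant, so it inherits the bi-Lipschitz estimate; its image is open by invariance of domain.
  The strict derivative is part of the conclusion because it is needed again to compute the
  paratingent cone.\<close>

lemma lipschitz_chart_imp_patch:
  fixes z :: "'a::euclidean_space"
  assumes chart: "lipschitz_chart d \<Omega> z W \<Phi> S U f" and z: "z \<in> \<Omega>"
  obtains M W' K where "linear M" "inj M"
    "\<And>e. 0 < e \<Longrightarrow> \<exists>r>0. ball z r \<subseteq> W \<and> (\<forall>a\<in>ball z r. \<forall>b\<in>ball z r. norm (\<Phi> b - \<Phi> a - M (b - a)) \<le> e * norm (b - a))"
    "z \<in> W'" "lipschitz_patch (orth_proj (span S) \<circ> M) \<Omega> W' K"
    "range (orth_proj (span S) \<circ> M) = span S"
proof -
  let ?P = "orth_proj (span S)"
  have zW: "z \<in> W" and diffeo: "C1_diffeo_on \<Phi> W" and U: "openin (top_of_set (span S)) U"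
    and graph: "\<Phi> ` (\<Omega> \<inter> W) = (\<lambda>u. u + f u) ` U"
    using chart by (auto simp: lipschitz_chart_def)
  obtain L where L: "L-lipschitz_on U f" using chart by (auto simp: lipschitz_chart_def)
  have W: "open W" "inj_on \<Phi> W" "open (\<Phi> ` W)" and C: "continuously_differentiable_on \<Phi> W"
    and C': "continuously_differentiable_on (inv_into W \<Phi>) (\<Phi> ` W)"
    using diffeo by (auto simp: C1_diffeo_on_def)
  have L0: "0 \<le> L" using L by (rule lipschitz_on_nonneg)
  have subS: "subspace (span S)" by simp
  note linP = linear_orth_proj[OF subS]
  note Pu = chart_proj[OF chart]
  obtain M where M: "(\<Phi> has_derivative M) (at z)"
    and strict: "\<And>e. 0 < e \<Longrightarrow> \<exists>r>0. ball z r \<subseteq> W \<and> (\<forall>a\<in>ball z r. \<forall>b\<in>ball z r. norm (\<Phi> b - \<Phi> a - M (b - a)) \<le> e * norm (b - a))"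
    using C1_imp_strict_derivative[OF C W(1) zW] by metis
  have linM: "linear M" using M by (rule has_derivative_linear)
  obtain G where G: "linear G" "\<And>x. G (M x) = x" "\<And>x. M (G x) = x"
    using diffeo_derivative_bijective[OF diffeo zW M] by blast
  obtain B where B: "0 < B" "\<And>x. norm (G x) \<le> B * norm x" using linear_bounded_pos[OF G(1)] by blast
  define C0 where "C0 = 2 * B * (1 + L)"
  have C0: "C0 > 0" using B L0 by (simp add: C0_def)
  \<comment> \<open>The first bound compares \<open>b - a\<close> with the increment of the chart, the second one the
    increments of \<open>u\<close> and of the linearized projection.\<close>
  define e where "e = min (1 / (2 * B)) (1 / (2 * C0))"
  have e: "e > 0" "B * e \<le> 1/2" "C0 * e \<le> 1/2"
  proof -
    show "e > 0" using B C0 by (simp add: e_def)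
    have "B * e \<le> B * (1 / (2 * B))" using B by (intro mult_left_mono) (auto simp: e_def)
    then show "B * e \<le> 1/2" using B by simp
    have "C0 * e \<le> C0 * (1 / (2 * C0))" using C0 by (intro mult_left_mono) (auto simp: e_def)
    then show "C0 * e \<le> 1/2" using C0 by simp
  qed
  obtain r where r: "r > 0" "ball z r \<subseteq> W"
    "\<And>a b. a \<in> ball z r \<Longrightarrow> b \<in> ball z r \<Longrightarrow> norm (\<Phi> b - \<Phi> a - M (b - a)) \<le> e * norm (b - a)"
    using strict[OF e(1)] by blast
  define W' where "W' = ball z r"
  let ?p = "?P \<circ> M"
  have coords: "\<exists>u\<in>U. \<Phi> a = u + f u \<and> ?P (\<Phi> a) = u" if "a \<in> \<Omega>" "a \<in> W" for a
    using chart_graph[OF chart that] by blast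
  have contr: "norm (b - a) \<le> 2 * C0 * norm (?p b - ?p a)" if ab: "a \<in> \<Omega>" "a \<in> W'" "b \<in> \<Omega>" "b \<in> W'" for a b
  proof -
    have abW: "a \<in> W" "b \<in> W" using ab r(2) by (auto simp: W'_def)
    let ?D = "\<Phi> b - \<Phi> a - M (b - a)"
    have D: "norm ?D \<le> e * norm (b - a)" using r(3) ab by (simp add: W'_def)
    have "norm (M (b - a)) \<le> norm (\<Phi> b - \<Phi> a) + norm ?D"
      using norm_triangle_ineq4[of "\<Phi> b - \<Phi> a" ?D] by simp
    also have "\<dots> \<le> norm (\<Phi> b - \<Phi> a) + e * norm (b - a)" using D by simp
    finally have "B * norm (M (b - a)) \<le> B * (norm (\<Phi> b - \<Phi> a) + e * norm (b - a))"
      using B(1) by (intro mult_left_mono) auto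
    then have "norm (b - a) \<le> B * norm (\<Phi> b - \<Phi> a) + (B * e) * norm (b - a)"
      using B(2)[of "M (b - a)"] by (simp add: G(2) algebra_simps)
    moreover have "(B * e) * norm (b - a) \<le> (1/2) * norm (b - a)" using e(2) by (rule mult_right_mono) simp
    ultimately have 1: "norm (b - a) \<le> 2 * B * norm (\<Phi> b - \<Phi> a)" by simp
    obtain u u' where u: "u \<in> U" "\<Phi> a = u + f u" "?P (\<Phi> a) = u" and u': "u' \<in> U" "\<Phi> b = u' + f u'" "?P (\<Phi> b) = u'"
      using coords ab abW by metis
    have "norm (\<Phi> b - \<Phi> a) \<le> norm (u' - u) + norm (f u' - f u)"
      using norm_triangle_ineq[of "u' - u" "f u' - f u"] by (simp add: u(2) u'(2) algebra_simps)
    also have "\<dots> \<le> (1 + L) * norm (u' - u)"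
      using lipschitz_onD[OF L u'(1) u(1)] by (simp add: dist_norm algebra_simps)
    finally have "2 * B * norm (\<Phi> b - \<Phi> a) \<le> 2 * B * ((1 + L) * norm (u' - u))"
      using B(1) by (intro mult_left_mono) auto
    with 1 have 2: "norm (b - a) \<le> C0 * norm (u' - u)" by (simp add: C0_def mult.assoc)
    have "u' - u = (?p b - ?p a) + ?P ?D"
      using u(3) u'(3) by (simp add: linear_diff[OF linP] linear_diff[OF linM])
    then have "norm (u' - u) \<le> norm (?p b - ?p a) + norm (?P ?D)" by (metis norm_triangle_ineq)
    moreover have "norm (?P ?D) \<le> e * norm (b - a)" using orth_proj_norm_le[OF subS] D order_trans by blast
    ultimately have "C0 * norm (u' - u) \<le> C0 * (norm (?p b - ?p a) + e * norm (b - a))"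
      using C0 by (intro mult_left_mono) auto
    also have "\<dots> = C0 * norm (?p b - ?p a) + (C0 * e) * norm (b - a)" by (simp add: algebra_simps)
    finally have "norm (b - a) \<le> C0 * norm (?p b - ?p a) + (C0 * e) * norm (b - a)" using 2 by simp
    moreover have "(C0 * e) * norm (b - a) \<le> (1/2) * norm (b - a)" using e(3) by (rule mult_right_mono) simp
    ultimately show ?thesis by simp
  qed
  have range: "range ?p = span S"
  proof -
    have "surj M" using G(3) by (metis surjI)
    then have "range ?p = range ?P" by (simp only: image_comp[symmetric])
    then show ?thesis using range_orth_proj[OF subS] by simp
  qed
  define \<psi> where "\<psi> u = inv_into W \<Phi> (u + f u)" for u
  have \<psi>: "\<psi> u \<in> \<Omega> \<inter> W" "\<Phi> (\<psi> u) = u + f u" if "u \<in> U" for u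
  proof -
    have "u + f u \<in> \<Phi> ` (\<Omega> \<inter> W)" unfolding graph using that by (rule imageI)
    then obtain a where a: "a \<in> \<Omega>" "a \<in> W" "\<Phi> a = u + f u" by auto
    then have "\<psi> u = a" using W(2) by (simp add: \<psi>_def flip: a(3))
    with a show "\<psi> u \<in> \<Omega> \<inter> W" "\<Phi> (\<psi> u) = u + f u" by auto
  qed
  have \<psi>c: "continuous_on U \<psi>"
  proof -
    have "continuous_on (\<Phi> ` W) (inv_into W \<Phi>)"
      using C' unfolding continuously_differentiable_on_def
      by (meson continuous_at_imp_continuous_on has_derivative_continuous)
    moreover have "continuous_on U (\<lambda>u. u + f u)"
      using lipschitz_on_continuous_on[OF L] by (intro continuous_intros)
    moreover have "(\<lambda>u. u + f u) ` U \<subseteq> \<Phi> ` W" using graph by blast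
    ultimately show ?thesis unfolding \<psi>_def by (rule continuous_on_compose2)
  qed
  define U' where "U' = U \<inter> \<psi> -` W'"
  have "openin (top_of_set U) U'"
    using \<psi>c unfolding U'_def W'_def by (rule continuous_openin_preimage_gen) simp
  then have U': "openin (top_of_set (span S)) U'" using U by (rule openin_trans)
  have img: "?p ` (\<Omega> \<inter> W') = (?p \<circ> \<psi>) ` U'"
  proof -
    have "\<Omega> \<inter> W' = \<psi> ` U'"
    proof
      show "\<psi> ` U' \<subseteq> \<Omega> \<inter> W'" using \<psi>(1) by (auto simp: U'_def)
      show "\<Omega> \<inter> W' \<subseteq> \<psi> ` U'"
      proof
        fix a assume a: "a \<in> \<Omega> \<inter> W'"
        then have aW: "a \<in> W" using r(2) by (auto simp: W'_def)
        obtain u where u: "u \<in> U" "\<Phi> a = u + f u" using coords a aW by blast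
        then have "\<psi> u = a" using W(2) aW by (simp add: \<psi>_def flip: u(2))
        then show "a \<in> \<psi> ` U'" using u a by (auto simp: U'_def)
      qed
    qed
    then show ?thesis by (simp add: image_comp)
  qed
  have "openin (top_of_set (span S)) ((?p \<circ> \<psi>) ` U')"
  proof (rule invariance_of_domain_subspaces[OF U' subS subS order_refl])
    have "bounded_linear ?p" using linear_compose[OF linM linP] by (simp only: linear_conv_bounded_linear)
    then have "continuous_on (\<psi> ` U') ?p" by (rule linear_continuous_on)
    moreover have "continuous_on U' \<psi>" using \<psi>c by (rule continuous_on_subset) (simp add: U'_def)
    ultimately show "continuous_on U' (?p \<circ> \<psi>)" by (rule continuous_on_compose[rotated])
    show "?p \<circ> \<psi> \<in> U' \<rightarrow> span S" using range by (auto simp: orth_proj_in[OF subS])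
    show "inj_on (?p \<circ> \<psi>) U'"
    proof (rule inj_onI)
      fix u u' assume u: "u \<in> U'" "u' \<in> U'" "(?p \<circ> \<psi>) u = (?p \<circ> \<psi>) u'"
      then have "\<psi> u = \<psi> u'" using contr[of "\<psi> u'" "\<psi> u"] \<psi>(1) by (auto simp: U'_def)
      then have "u + f u = u' + f u'" using \<psi>(2) u by (metis IntD1 U'_def)
      then show "u = u'" using Pu u by (metis IntD1 U'_def)
    qed
  qed
  then have op: "openin (top_of_set (range ?p)) (?p ` (\<Omega> \<inter> W'))" unfolding range img .
  have "lipschitz_patch ?p \<Omega> W' (2 * C0)"
  proof (rule lipschitz_patch.intro)
    show "linear ?p" by (rule linear_compose[OF linM linP])
    show "norm (a - b) \<le> 2 * C0 * norm (?p a - ?p b)" if "a \<in> \<Omega>" "a \<in> W'" "b \<in> \<Omega>" "b \<in> W'" for a b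
      using contr that by blast
  qed (use C0 op in \<open>auto simp: W'_def\<close>)
  moreover have "z \<in> W'" using r(1) by (simp add: W'_def)
  moreover have "inj M" using G(2) by (metis injI)
  ultimately show thesis using that linM strict range by blast
qed

lemma lipschitz_manifold_imp_patch:
  fixes z :: "'a::euclidean_space"
  assumes "lipschitz_manifold d \<Omega> z" and z: "z \<in> \<Omega>"
  obtains p W K where "lipschitz_patch p \<Omega> W K" "z \<in> W" "dim (range p) = d"
proof -
  obtain W \<Phi> S U f where chart: "lipschitz_chart d \<Omega> z W \<Phi> S U f"
    using assms by (auto simp: lipschitz_manifold_def)
  then have S: "S \<subseteq> Basis" "card S = d" by (auto simp: lipschitz_chart_def)
  have "dim (span S) = d" using S by (simp add: independent_substdbasis dim_eq_card_independent)
  then show thesis using lipschitz_chart_imp_patch[OF chart z] that by metis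
qed

text \<open>A paratingent \<open>w\<close> satisfies \<open>M w = u + A u\<close>, where \<open>u\<close> is the projection of \<open>w\<close> and \<open>A\<close> the
  strict derivative of \<open>f\<close>. So \<open>w\<close> is determined by its projection.\<close>

lemma strictly_differentiable_chart_imp_strictly_smooth:
  fixes z :: "'a::euclidean_space"
  assumes chart: "lipschitz_chart d \<Omega> z W \<Phi> S U f" and z: "z \<in> \<Omega>"
    and u0: "u0 \<in> U" "u0 + f u0 = \<Phi> z" and diff: "strictly_differentiable_within f U u0"
  shows "strictly_smooth \<Omega> z"
proof -
  let ?P = "orth_proj (span S)"
  obtain M W' K where M: "linear M" "inj M"
    "\<And>e. 0 < e \<Longrightarrow> \<exists>r>0. ball z r \<subseteq> W \<and> (\<forall>a\<in>ball z r. \<forall>b\<in>ball z r. norm (\<Phi> b - \<Phi> a - M (b - a)) \<le> e * norm (b - a))"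
    and W': "z \<in> W'" and patch: "lipschitz_patch (?P \<circ> M) \<Omega> W' K"
    using lipschitz_chart_imp_patch[OF chart z] by metis
  have subS: "subspace (span S)" by simp
  note linP = linear_orth_proj[OF subS]
  note Pu = chart_proj[OF chart]
  note coords = chart_graph[OF chart]
  obtain A where A: "linear A"
    and lim: "((\<lambda>(u, u'). (f u' - f u - A (u' - u)) /\<^sub>R norm (u' - u)) \<longlongrightarrow> 0)
          (at (u0, u0) within {(u, u'). u \<in> U \<and> u' \<in> U \<and> u \<noteq> u'})"
    using diff by (auto simp: strictly_differentiable_within_def)
  have strict: "\<exists>r>0. \<forall>u\<in>U. \<forall>u'\<in>U. dist u u0 < r \<longrightarrow> dist u' u0 < r \<longrightarrow> norm (f u' - f u - A (u' - u)) \<le> e * norm (u' - u)"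
    if e0: "0 < e" for e
  proof -
    obtain r where r: "r > 0" "\<And>u u'. u \<in> U \<Longrightarrow> u' \<in> U \<Longrightarrow> u \<noteq> u' \<Longrightarrow> dist (u, u') (u0, u0) < r \<Longrightarrow>
        norm ((f u' - f u - A (u' - u)) /\<^sub>R norm (u' - u)) < e"
      using tendstoD[OF lim e0] unfolding eventually_at by fastforce
    have "norm (f u' - f u - A (u' - u)) \<le> e * norm (u' - u)"
      if u: "u \<in> U" "u' \<in> U" "dist u u0 < r/2" "dist u' u0 < r/2" for u u'
    proof (cases "u = u'")
      case False
      have "dist (u, u') (u0, u0) \<le> dist u u0 + dist u' u0"
        unfolding dist_Pair_Pair by (rule sqrt_sum_squares_le_sum) auto
      then have "norm ((f u' - f u - A (u' - u)) /\<^sub>R norm (u' - u)) < e" using r(2)[OF u(1,2) False] u by simp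
      moreover have "norm (u' - u) > 0" using False by simp
      moreover have "norm ((f u' - f u - A (u' - u)) /\<^sub>R norm (u' - u)) = norm (f u' - f u - A (u' - u)) / norm (u' - u)"
        by (simp add: divide_inverse mult.commute)
      ultimately show ?thesis by (simp only: pos_divide_less_eq less_imp_le)
    qed (simp add: linear_0[OF A])
    with r(1) show ?thesis by (intro exI[of _ "r/2"]) auto
  qed
  interpret patch: lipschitz_patch "?P \<circ> M" \<Omega> W' K by (rule patch)
  have key: "M w = ?P (M w) + A (?P (M w))" if w: "w \<in> paratingent_cone \<Omega> z" for w
  proof -
    obtain a b t where s: "\<And>k::nat. a k \<in> \<Omega>" "\<And>k. b k \<in> \<Omega>" "\<And>k. 0 < t k" "a \<longlonglongrightarrow> z" "b \<longlonglongrightarrow> z" "t \<longlonglongrightarrow> 0"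
      and q: "(\<lambda>k. (b k - a k) /\<^sub>R t k) \<longlonglongrightarrow> w"
      using paratingent_cone_sequentially[OF w] by blast
    define h where "h k = (\<Phi> (b k) - \<Phi> (a k)) /\<^sub>R t k" for k
    have near: "\<forall>\<^sub>F k in sequentially. a k \<in> ball z r \<and> b k \<in> ball z r" if "r > 0" for r
      using that by (intro eventually_conj topological_tendstoD[OF s(4)] topological_tendstoD[OF s(5)]) auto
    have Mq: "(\<lambda>k. M ((b k - a k) /\<^sub>R t k)) \<longlonglongrightarrow> M w"
      using M(1) by (intro bounded_linear.tendsto[OF _ q]) (simp only: linear_conv_bounded_linear)
    have bnd: "\<forall>\<^sub>F k in sequentially. norm ((b k - a k) /\<^sub>R t k) \<le> norm w + 1"
      using order_tendstoD(2)[OF tendsto_norm[OF q], of "norm w + 1"] by (auto elim: eventually_mono)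
    have "(\<lambda>k. h k - M ((b k - a k) /\<^sub>R t k)) \<longlonglongrightarrow> 0"
    proof (rule tendstoI)
      fix e :: real assume "0 < e"
      define e' where "e' = e / (2 * (norm w + 1))"
      have e': "e' > 0" "e' * (norm w + 1) < e" using \<open>0 < e\<close> by (auto simp: e'_def field_simps add_pos_nonneg)
      obtain r where r: "r > 0" "\<And>a b. a \<in> ball z r \<Longrightarrow> b \<in> ball z r \<Longrightarrow> norm (\<Phi> b - \<Phi> a - M (b - a)) \<le> e' * norm (b - a)"
        using M(3)[OF e'(1)] by blast
      show "\<forall>\<^sub>F k in sequentially. dist (h k - M ((b k - a k) /\<^sub>R t k)) 0 < e"
        using near[OF r(1)] bnd
      proof eventually_elim
        case (elim k)
        have "h k - M ((b k - a k) /\<^sub>R t k) = (\<Phi> (b k) - \<Phi> (a k) - M (b k - a k)) /\<^sub>R t k"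
          
          unfolding h_def linear_cmul[OF M(1)] by (simp add: scaleR_diff_right)
        then have "norm (h k - M ((b k - a k) /\<^sub>R t k)) = inverse (t k) * norm (\<Phi> (b k) - \<Phi> (a k) - M (b k - a k))"
          using s(3)[of k] by simp
        also have "\<dots> \<le> inverse (t k) * (e' * norm (b k - a k))"
          using r(2) elim(1) s(3)[of k] by (intro mult_left_mono) auto
        also have "\<dots> = e' * norm ((b k - a k) /\<^sub>R t k)" using s(3)[of k] by simp
        also have "\<dots> \<le> e' * (norm w + 1)" using elim(2) e'(1) by simp
        finally show ?case using e'(2) by simp
      qed
    qed
    then have "(\<lambda>k. (h k - M ((b k - a k) /\<^sub>R t k)) + M ((b k - a k) /\<^sub>R t k)) \<longlonglongrightarrow> 0 + M w"
      by (intro tendsto_add Mq)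
    then have h: "h \<longlonglongrightarrow> M w" by simp
    have blP: "bounded_linear ?P" and blA: "bounded_linear A"
      using linP A by (auto simp: linear_conv_bounded_linear)
    have Ph: "(\<lambda>k. ?P (h k)) \<longlonglongrightarrow> ?P (M w)" by (rule bounded_linear.tendsto[OF blP h])
    have contPhi: "isCont (\<lambda>x. ?P (\<Phi> x)) z"
    proof -
      obtain r where r: "r > 0" "\<And>a b. a \<in> ball z r \<Longrightarrow> b \<in> ball z r \<Longrightarrow> norm (\<Phi> b - \<Phi> a - M (b - a)) \<le> 1 * norm (b - a)"
        using M(3)[of 1] by auto
      obtain B where B: "\<And>x. norm (M x) \<le> B * norm x" "B > 0" using linear_bounded_pos[OF M(1)] by blast
      have "(B + 1)-lipschitz_on (ball z r) \<Phi>"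
      proof (rule lipschitz_onI)
        fix x y assume "x \<in> ball z r" "y \<in> ball z r"
        then have "norm (\<Phi> x - \<Phi> y - M (x - y)) \<le> 1 * norm (x - y)" using r(2) by blast
        moreover have "norm (\<Phi> x - \<Phi> y) \<le> norm (\<Phi> x - \<Phi> y - M (x - y)) + norm (M (x - y))"
          using norm_triangle_ineq[of "\<Phi> x - \<Phi> y - M (x - y)" "M (x - y)"] by simp
        ultimately show "dist (\<Phi> x) (\<Phi> y) \<le> (B + 1) * dist x y" using B(1)[of "x - y"] by (simp add: dist_norm algebra_simps)
      qed (use B in auto)
      then have "continuous_on (ball z r) \<Phi>" by (rule lipschitz_on_continuous_on)
      then have "isCont \<Phi> z" using r(1) by (simp add: continuous_on_eq_continuous_at)
      then show ?thesis using linear_continuous_at[OF blP] by (rule isCont_o2)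
    qed
    have Pz: "?P (\<Phi> z) = u0" using Pu[OF u0(1)] u0(2) by simp
    have Pa: "(\<lambda>k. ?P (\<Phi> (a k))) \<longlonglongrightarrow> u0" and Pb: "(\<lambda>k. ?P (\<Phi> (b k))) \<longlonglongrightarrow> u0"
      using isCont_tendsto_compose[OF contPhi s(4)] isCont_tendsto_compose[OF contPhi s(5)] by (simp_all add: Pz)
    have bndP: "\<forall>\<^sub>F k in sequentially. norm (?P (h k)) \<le> norm (?P (M w)) + 1"
      using order_tendstoD(2)[OF tendsto_norm[OF Ph], of "norm (?P (M w)) + 1"] by (auto elim: eventually_mono)
    obtain r0 where r0: "r0 > 0" "ball z r0 \<subseteq> W" using M(3)[of 1] by auto
    have "(\<lambda>k. (h k - ?P (h k)) - A (?P (h k))) \<longlonglongrightarrow> 0"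
    proof (rule tendstoI)
      fix e :: real assume "0 < e"
      define e' where "e' = e / (2 * (norm (?P (M w)) + 1))"
      have e': "e' > 0" "e' * (norm (?P (M w)) + 1) < e" using \<open>0 < e\<close> by (auto simp: e'_def field_simps add_pos_nonneg)
      obtain r where r: "r > 0" "\<And>u u'. u \<in> U \<Longrightarrow> u' \<in> U \<Longrightarrow> dist u u0 < r \<Longrightarrow> dist u' u0 < r \<Longrightarrow>
          norm (f u' - f u - A (u' - u)) \<le> e' * norm (u' - u)"
        using strict[OF e'(1)] by metis
      show "\<forall>\<^sub>F k in sequentially. dist ((h k - ?P (h k)) - A (?P (h k))) 0 < e"
        using near[OF r0(1)] tendstoD[OF Pa r(1)] tendstoD[OF Pb r(1)] bndP
      proof eventually_elim
        case (elim k)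
        define u where "u = ?P (\<Phi> (a k))"
        define u' where "u' = ?P (\<Phi> (b k))"
        have u: "u \<in> U" "\<Phi> (a k) = u + f u" "u' \<in> U" "\<Phi> (b k) = u' + f u'"
          using coords[of "a k"] coords[of "b k"] s(1,2) elim(1) r0(2) unfolding u_def u'_def by (auto dest: subsetD)
        have near_u: "dist u u0 < r" "dist u' u0 < r" using elim(2,3) by (simp_all only: u_def u'_def)
        have Phk: "?P (h k) = (u' - u) /\<^sub>R t k"
          by (simp add: h_def linear_cmul[OF linP] linear_diff[OF linP] u_def u'_def)
        have "(h k - ?P (h k)) - A (?P (h k)) = (f u' - f u - A (u' - u)) /\<^sub>R t k"
          unfolding Phk by (simp add: h_def u(2,4) linear_cmul[OF A] flip: scaleR_diff_right)
        then have "norm ((h k - ?P (h k)) - A (?P (h k))) = inverse (t k) * norm (f u' - f u - A (u' - u))"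
          using s(3)[of k] by simp
        also have "\<dots> \<le> inverse (t k) * (e' * norm (u' - u))"
          using s(3)[of k] by (intro mult_left_mono r(2) u(1,3) near_u) simp
        also have "\<dots> = e' * norm (?P (h k))" using s(3)[of k] by (simp add: Phk)
        also have "\<dots> \<le> e' * (norm (?P (M w)) + 1)" using elim e'(1) by simp
        finally show ?case using e'(2) by simp
      qed
    qed
    moreover have "(\<lambda>k. (h k - ?P (h k)) - A (?P (h k))) \<longlonglongrightarrow> (M w - ?P (M w)) - A (?P (M w))"
      by (intro tendsto_diff h Ph bounded_linear.tendsto[OF blA])
    ultimately have "(M w - ?P (M w)) - A (?P (M w)) = 0" using LIMSEQ_unique by blast
    then show ?thesis by (simp add: algebra_simps)
  qed
  show ?thesis
  proof (rule patch.strictly_smooth_of_inj_on_paratingent[OF z W'])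
    show "inj_on (?P \<circ> M) (paratingent_cone \<Omega> z)"
    proof (rule inj_onI)
      fix v w assume vw: "v \<in> paratingent_cone \<Omega> z" "w \<in> paratingent_cone \<Omega> z" "(?P \<circ> M) v = (?P \<circ> M) w"
      then have "M v = M w" using key[OF vw(1)] key[OF vw(2)] by simp
      then show "v = w" using M(2) by (simp add: inj_eq)
    qed
  qed
qed

section \<open>Charts of strictly smooth sets\<close>

text \<open>Normalized secants that violate the estimate would cluster at a unit vector of the
  paratingent cone outside \<open>L\<close>.\<close>

lemma paratingent_subset_imp_cone_condition:
  fixes z :: "'a::euclidean_space"
  assumes L: "subspace L" "paratingent_cone \<Omega> z \<subseteq> L" and e: "0 < e"
  obtains d where "0 < d" "\<And>a b. a \<in> \<Omega> \<Longrightarrow> b \<in> \<Omega> \<Longrightarrow> dist a z < d \<Longrightarrow> dist b z < d \<Longrightarrow>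
    norm ((b - a) - orth_proj L (b - a)) \<le> e * norm (orth_proj L (b - a))"
proof (rule ccontr)
  let ?P = "orth_proj L"
  note ret = that
  assume "\<not> thesis"
  have no: "\<exists>a b. a \<in> \<Omega> \<and> b \<in> \<Omega> \<and> dist a z < d \<and> dist b z < d \<and>
      \<not> norm ((b - a) - ?P (b - a)) \<le> e * norm (?P (b - a))" if "0 < d" for d
    using \<open>\<not> thesis\<close> ret[OF \<open>0 < d\<close>] by blast
  obtain r :: "nat \<Rightarrow> real" where r: "\<And>k. 0 < r k" "r \<longlonglongrightarrow> 0" using inverse_Suc_seq by blast
  obtain a b where ab: "\<And>k. a k \<in> \<Omega>" "\<And>k. b k \<in> \<Omega>" "\<And>k. dist (a k) z < r k" "\<And>k. dist (b k) z < r k"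
    "\<And>k. \<not> norm ((b k - a k) - ?P (b k - a k)) \<le> e * norm (?P (b k - a k))"
    using no[OF r(1)] by metis
  note linP = linear_orth_proj[OF L(1)]
  define t where "t k = norm (b k - a k)" for k
  have t: "0 < t k" for k
    using ab(5)[of k] by (cases "b k = a k") (auto simp: t_def linear_0[OF linP])
  have a: "a \<longlonglongrightarrow> z" and b: "b \<longlonglongrightarrow> z"
    by (rule dist_null_imp_tendsto[OF less_imp_le[OF ab(3)] r(2)],
      rule dist_null_imp_tendsto[OF less_imp_le[OF ab(4)] r(2)])
  have t0: "t \<longlonglongrightarrow> 0" using tendsto_norm[OF tendsto_diff[OF b a]] by (simp add: t_def[abs_def])
  define q where "q k = (b k - a k) /\<^sub>R t k" for k
  have q1: "norm (q k) = 1" for k using t[of k] by (simp add: q_def) (simp add: t_def)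
  then have "range q \<subseteq> sphere 0 1" by auto
  then obtain w s where s: "strict_mono s" "(q \<circ> s) \<longlonglongrightarrow> w" and w: "w \<in> sphere 0 1"
    using compact_sphere[of "0::'a" 1] unfolding compact_def by (metis range_subsetD)
  have "w \<in> paratingent_cone \<Omega> z"
  proof (rule paratingent_coneI_sequentially[of "a \<circ> s" _ "b \<circ> s" "t \<circ> s"])
    show "(a \<circ> s) \<longlonglongrightarrow> z" by (rule LIMSEQ_subseq_LIMSEQ[OF a s(1)])
    show "(t \<circ> s) \<longlonglongrightarrow> 0" by (rule LIMSEQ_subseq_LIMSEQ[OF t0 s(1)])
    show "(\<lambda>k. ((b \<circ> s) k - (a \<circ> s) k) /\<^sub>R (t \<circ> s) k) \<longlonglongrightarrow> w" using s(2) by (simp add: q_def o_def)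
  qed (use ab t in auto)
  then have Pw: "?P w = w" using L orth_proj_id by blast
  have ge: "e * norm (?P (q k)) \<le> norm (q k - ?P (q k))" for k
  proof -
    have "e * norm (?P (b k - a k)) \<le> norm ((b k - a k) - ?P (b k - a k))" using ab(5)[of k] by simp
    then have "inverse (t k) * (e * norm (?P (b k - a k))) \<le> inverse (t k) * norm ((b k - a k) - ?P (b k - a k))"
      using t[of k] by (intro mult_left_mono) auto
    moreover have "?P (q k) = ?P (b k - a k) /\<^sub>R t k" unfolding q_def by (rule linear_cmul[OF linP])
    moreover have "q k - ?P (b k - a k) /\<^sub>R t k = ((b k - a k) - ?P (b k - a k)) /\<^sub>R t k"
      unfolding q_def by (rule scaleR_diff_right[symmetric])
    ultimately show ?thesis using t[of k] by (simp add: mult_ac)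
  qed
  have blP: "bounded_linear ?P" using linP by (simp only: linear_conv_bounded_linear)
  have "(\<lambda>k. e * norm (?P ((q \<circ> s) k))) \<longlonglongrightarrow> e * norm (?P w)"
    by (intro tendsto_intros bounded_linear.tendsto[OF blP s(2)])
  moreover have "(\<lambda>k. norm ((q \<circ> s) k - ?P ((q \<circ> s) k))) \<longlonglongrightarrow> norm (w - ?P w)"
    by (intro tendsto_intros bounded_linear.tendsto[OF blP s(2)] s(2))
  ultimately have "e * norm (?P w) \<le> norm (w - ?P w)"
    by (rule LIMSEQ_le) (use ge in auto)
  with Pw w e show False by simp
qed

text \<open>By compactness of \<open>C\<close>, as the estimate for a direction carries over to nearby directions.\<close>

lemma regular_tangent_cone_uniform:
  fixes z :: "'a::euclidean_space"
  assumes C: "compact C" "C \<subseteq> regular_tangent_cone \<Omega> z" and z: "z \<in> \<Omega>" and e: "0 < e"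
  obtains d where "0 < d" "\<And>w a t. w \<in> C \<Longrightarrow> a \<in> \<Omega> \<Longrightarrow> dist a z < d \<Longrightarrow> 0 < t \<Longrightarrow> t < d \<Longrightarrow>
    \<exists>b\<in>\<Omega>. norm (b - a - t *\<^sub>R w) < e * t"
proof (rule ccontr)
  note ret = that
  assume "\<not> thesis"
  have no: "\<exists>w a t. w \<in> C \<and> a \<in> \<Omega> \<and> dist a z < d \<and> 0 < t \<and> t < d \<and>
      \<not> (\<exists>b\<in>\<Omega>. norm (b - a - t *\<^sub>R w) < e * t)" if "0 < d" for d
    using \<open>\<not> thesis\<close> ret[OF \<open>0 < d\<close>] by metis
  obtain r :: "nat \<Rightarrow> real" where r: "\<And>k. 0 < r k" "r \<longlonglongrightarrow> 0" using inverse_Suc_seq by blast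
  obtain w a t where wat: "\<And>k. w k \<in> C" "\<And>k. a k \<in> \<Omega>" "\<And>k. dist (a k) z < r k" "\<And>k. 0 < t k" "\<And>k. t k < r k"
    "\<And>k. \<not> (\<exists>b\<in>\<Omega>. norm (b - a k - t k *\<^sub>R w k) < e * t k)"
    using no[OF r(1)] by metis
  obtain v s where s: "v \<in> C" "strict_mono s" "(w \<circ> s) \<longlonglongrightarrow> v"
    using C(1) wat(1) unfolding compact_def by metis
  have v: "v \<in> regular_tangent_cone \<Omega> z" using s(1) C(2) by blast
  obtain d where d: "0 < d" "\<And>a t. a \<in> \<Omega> \<Longrightarrow> dist a z < d \<Longrightarrow> 0 < t \<Longrightarrow> t < d \<Longrightarrow>
      \<exists>b\<in>\<Omega>. norm (b - a - t *\<^sub>R v) < (e/2) * t"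
    using regular_tangent_coneE[OF v z half_gt_zero[OF e]] by metis
  have "\<forall>\<^sub>F k in sequentially. dist ((w \<circ> s) k) v < e/2 \<and> (r \<circ> s) k < d"
    using e d(1) by (intro eventually_conj tendstoD[OF s(3)] order_tendstoD(2)[OF LIMSEQ_subseq_LIMSEQ[OF r(2) s(2)]]) auto
  then obtain k where k: "dist (w (s k)) v < e/2" "r (s k) < d" by (auto simp: eventually_sequentially)
  let ?a = "a (s k)" and ?t = "t (s k)" and ?w = "w (s k)"
  obtain b where b: "b \<in> \<Omega>" "norm (b - ?a - ?t *\<^sub>R v) < (e/2) * ?t"
    using d(2)[of ?a ?t] wat(2-5)[of "s k"] k(2) by auto
  have "b - ?a - ?t *\<^sub>R ?w = (b - ?a - ?t *\<^sub>R v) + ?t *\<^sub>R (v - ?w)" by (simp add: algebra_simps)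
  then have "norm (b - ?a - ?t *\<^sub>R ?w) \<le> norm (b - ?a - ?t *\<^sub>R v) + norm (?t *\<^sub>R (v - ?w))"
    by (simp only: norm_triangle_ineq)
  also have "norm (?t *\<^sub>R (v - ?w)) = ?t * dist ?w v"
    using wat(4)[of "s k"] by (simp add: dist_norm norm_minus_commute)
  finally have "norm (b - ?a - ?t *\<^sub>R ?w) < e * ?t"
    using b(2) mult_strict_left_mono[OF k(1) wat(4)[of "s k"]] by (simp add: algebra_simps)
  with wat(6) b(1) show False by blast
qed

text \<open>Strict smoothness gives a cone condition, which makes \<open>P\<close> injective on \<open>\<Omega>\<close> near \<open>z\<close>. It
  remains to hit every point \<open>u\<close> of \<open>L\<close> near \<open>P z\<close>. Let \<open>a\<close> minimize the distance of \<open>P a\<close> to \<open>u\<close>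
  over a compact part of \<open>\<Omega>\<close>; by the cone condition \<open>a\<close> is close to \<open>z\<close>. If \<open>P a \<noteq> u\<close>, the unit
  vector from \<open>P a\<close> to \<open>u\<close> is a regular tangent, and a short step in this direction with relative
  error at most one half reduces the distance.\<close>

lemma strictly_smooth_imp_local_graph:
  fixes z :: "'a::euclidean_space"
  assumes smooth: "strictly_smooth \<Omega> z" and z: "z \<in> \<Omega>" and closed: "locally_closed_at \<Omega> z"
  defines "P \<equiv> orth_proj (paratingent_cone \<Omega> z)"
  obtains W \<rho> where "open W" "z \<in> W" "0 < \<rho>" "P ` (\<Omega> \<inter> W) = paratingent_cone \<Omega> z \<inter> ball (P z) \<rho>"
    "\<And>a b. a \<in> \<Omega> \<inter> W \<Longrightarrow> b \<in> \<Omega> \<inter> W \<Longrightarrow> norm ((b - a) - P (b - a)) \<le> norm (P (b - a))"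
proof -
  define L where "L = paratingent_cone \<Omega> z"
  have L: "subspace L" unfolding L_def by (rule strictly_smooth_imp_subspace[OF smooth z])
  have TH: "regular_tangent_cone \<Omega> z = L" unfolding L_def by (rule strictly_smooth_cones_eq[OF smooth z])
  note linP = linear_orth_proj[OF L, folded P_def[folded L_def]]
  have PL: "P x \<in> L" for x unfolding P_def L_def[symmetric] by (rule orth_proj_in[OF L])
  have Pid: "x \<in> L \<Longrightarrow> P x = x" for x unfolding P_def L_def[symmetric] by (rule orth_proj_id[OF L])
  have Ple: "norm (P x) \<le> norm x" for x unfolding P_def L_def[symmetric] by (rule orth_proj_norm_le[OF L])
  obtain d1 where d1: "0 < d1" "\<And>a b. a \<in> \<Omega> \<Longrightarrow> b \<in> \<Omega> \<Longrightarrow> dist a z < d1 \<Longrightarrow> dist b z < d1 \<Longrightarrow>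
      norm ((b - a) - P (b - a)) \<le> 1 * norm (P (b - a))"
    using paratingent_subset_imp_cone_condition[of L \<Omega> z 1] L unfolding P_def L_def[symmetric]
    by (metis L_def order_refl zero_less_one)
  have "compact (sphere 0 1 \<inter> L)" by (intro compact_Int_closed compact_sphere closed_subspace L)
  moreover have "sphere 0 1 \<inter> L \<subseteq> regular_tangent_cone \<Omega> z" by (simp add: TH)
  ultimately obtain d2 where d2: "0 < d2" "\<And>w a t. w \<in> sphere 0 1 \<inter> L \<Longrightarrow> a \<in> \<Omega> \<Longrightarrow> dist a z < d2 \<Longrightarrow> 0 < t \<Longrightarrow> t < d2 \<Longrightarrow>
      \<exists>b\<in>\<Omega>. norm (b - a - t *\<^sub>R w) < (1/2) * t"
    using regular_tangent_cone_uniform[OF _ _ z, of "sphere 0 1 \<inter> L" "1/2"] by (metis half_gt_zero zero_less_one)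
  obtain V where V: "closed V" "z \<in> interior V" "closed (\<Omega> \<inter> V)" using closed by (auto simp: locally_closed_at_def)
  obtain d3 where d3: "d3 > 0" "cball z d3 \<subseteq> V" using V(2) by (meson mem_interior_cball)
  define r where "r = min (min d1 d2) d3 / 2"
  have r: "0 < r" "r < d1" "r < d2" "r \<le> d3" using d1(1) d2(1) d3(1) by (auto simp: r_def)
  define C where "C = \<Omega> \<inter> cball z r"
  have "C = (\<Omega> \<inter> V) \<inter> cball z r" using d3(2) r(4) by (auto simp: C_def)
  then have C: "compact C" using V(3) by (simp add: closed_Int_compact)
  have zC: "z \<in> C" using z r(1) by (simp add: C_def)
  define \<rho> where "\<rho> = r / 8"
  have \<rho>: "0 < \<rho>" using r by (simp add: \<rho>_def)
  have cone: "norm ((b - a) - P (b - a)) \<le> norm (P (b - a))" if "a \<in> C" "b \<in> C" for a b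
    using d1(2)[of a b] that r(2) by (auto simp: C_def dist_commute)
  have cone2: "norm (b - a) \<le> 2 * norm (P (b - a))" if "a \<in> C" "b \<in> C" for a b
    using cone[OF that] norm_triangle_ineq[of "(b - a) - P (b - a)" "P (b - a)"] by simp
  have contP: "continuous_on A P" for A
    using linP by (intro linear_continuous_on) (simp only: linear_conv_bounded_linear)
  have onto: "\<exists>a\<in>\<Omega>. dist a z < r \<and> P a = u" if u: "u \<in> L" "norm (u - P z) < \<rho>" for u
  proof -
    have "continuous_on C (\<lambda>a. norm (u - P a))" by (intro continuous_intros contP)
    then obtain a where a: "a \<in> C" "\<And>b. b \<in> C \<Longrightarrow> norm (u - P a) \<le> norm (u - P b)"
      using continuous_attains_inf[OF C] zC by blast
    have uPa: "norm (u - P a) < \<rho>" using a(2)[OF zC] u(2) by simp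
    have "norm (P (a - z)) \<le> norm (u - P z) + norm (u - P a)"
      using norm_triangle_ineq4[of "u - P z" "u - P a"] by (simp add: linear_diff[OF linP])
    then have az: "norm (a - z) < r / 2" using cone2[OF zC a(1)] u(2) uPa by (simp add: \<rho>_def)
    have "u = P a"
    proof (rule ccontr)
      assume "u \<noteq> P a"
      define m where "m = norm (u - P a)"
      have m: "0 < m" using \<open>u \<noteq> P a\<close> by (simp add: m_def)
      define w where "w = (u - P a) /\<^sub>R m"
      have w: "w \<in> sphere 0 1 \<inter> L" "m *\<^sub>R w = u - P a"
        using m u(1) PL L by (auto simp: w_def m_def subspace_scale subspace_diff)
      \<comment> \<open>The step must not overshoot \<open>u\<close>, nor leave the compact part of \<open>\<Omega>\<close>.\<close>
      define t where "t = min m (r / 8)"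
      have t: "0 < t" "t \<le> m" "t \<le> r / 8" using m r(1) by (auto simp: t_def)
      obtain b where b: "b \<in> \<Omega>" "norm (b - a - t *\<^sub>R w) < (1/2) * t"
        using d2(2)[OF w(1), of a t] a(1) az t r by (auto simp: C_def dist_norm norm_minus_commute)
      have "norm (b - a) \<le> norm (b - a - t *\<^sub>R w) + norm (t *\<^sub>R w)"
        using norm_triangle_ineq[of "b - a - t *\<^sub>R w" "t *\<^sub>R w"] by simp
      also have "norm (t *\<^sub>R w) = t" using w(1) t(1) by simp
      finally have "norm (b - a) \<le> r / 4" using b(2) t by simp
      then have "norm (b - z) < r"
        using norm_triangle_ineq[of "b - a" "a - z"] az r(1) by simp
      then have bC: "b \<in> C" using b(1) by (simp add: C_def dist_norm norm_minus_commute)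
      have "u - P b = (m - t) *\<^sub>R w - P (b - a - t *\<^sub>R w)"
        using w by (simp add: linear_diff[OF linP] linear_cmul[OF linP] Pid scaleR_diff_left)
      then have "norm (u - P b) \<le> norm ((m - t) *\<^sub>R w) + norm (P (b - a - t *\<^sub>R w))"
        by (simp only: norm_triangle_ineq4)
      also have "norm ((m - t) *\<^sub>R w) = m - t" using w(1) t by simp
      finally have "norm (u - P b) < m" using Ple[of "b - a - t *\<^sub>R w"] b(2) t(1) by simp
      then show False using a(2)[OF bC] by (simp add: m_def)
    qed
    then show ?thesis using a(1) az r(1) by (auto simp: C_def dist_norm intro!: bexI[of _ a])
  qed
  define W where "W = ball z r \<inter> P -` ball (P z) \<rho>"
  have "open W" unfolding W_def
    by (intro open_Int open_ball open_vimage contP)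
  moreover have "z \<in> W" using r(1) \<rho> by (simp add: W_def)
  moreover have "P ` (\<Omega> \<inter> W) = L \<inter> ball (P z) \<rho>"
  proof
    show "P ` (\<Omega> \<inter> W) \<subseteq> L \<inter> ball (P z) \<rho>" using PL by (auto simp: W_def)
    show "L \<inter> ball (P z) \<rho> \<subseteq> P ` (\<Omega> \<inter> W)"
    proof
      fix u assume u: "u \<in> L \<inter> ball (P z) \<rho>"
      then obtain a where "a \<in> \<Omega>" "dist a z < r" "P a = u"
        using onto[of u] by (auto simp: dist_norm norm_minus_commute)
      with u show "u \<in> P ` (\<Omega> \<inter> W)" by (auto simp: W_def dist_commute)
    qed
  qed
  moreover have "norm ((b - a) - P (b - a)) \<le> norm (P (b - a))" if "a \<in> \<Omega> \<inter> W" "b \<in> \<Omega> \<inter> W" for a b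
    using cone[of a b] that by (auto simp: W_def C_def)
  ultimately show thesis using \<rho> that unfolding L_def by blast
qed

lemma linear_isomorphism_C1_diffeo_on:
  fixes \<Phi> :: "'a::euclidean_space \<Rightarrow> 'a"
  assumes lin: "linear \<Phi>" "linear \<Psi>" and inv: "\<And>x. \<Psi> (\<Phi> x) = x" "\<And>y. \<Phi> (\<Psi> y) = y" and W: "open W"
  shows "C1_diffeo_on \<Phi> W"
proof -
  have bl: "bounded_linear \<Phi>" "bounded_linear \<Psi>" using lin by (simp_all only: linear_conv_bounded_linear)
  have inj: "inj_on \<Phi> W" using inv(1) by (metis inj_onI)
  have "\<Phi> ` W = \<Psi> -` W" 
  proof
    show "\<Phi> ` W \<subseteq> \<Psi> -` W" by (auto simp: inv(1))
    show "\<Psi> -` W \<subseteq> \<Phi> ` W" using inv(2) by (metis imageI subsetI vimageE)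
  qed
  then have op: "open (\<Phi> ` W)" using W linear_continuous_on[OF bl(2)] by (simp add: open_vimage)
  have C1: "continuously_differentiable_on g V"
    if f: "bounded_linear f" and V: "open V" and g: "\<And>x. x \<in> V \<Longrightarrow> f x = g x" for f g :: "'a \<Rightarrow> 'a" and V
    unfolding continuously_differentiable_on_def
  proof (intro exI conjI ballI)
    fix x assume "x \<in> V"
    have "(f has_derivative blinfun_apply (Blinfun f)) (at x)"
      unfolding bounded_linear_Blinfun_apply[OF f] by (rule bounded_linear_imp_has_derivative[OF f])
    then show "(g has_derivative blinfun_apply (Blinfun f)) (at x)"
      by (rule has_derivative_transform_within_open[OF _ V \<open>x \<in> V\<close> g])
  qed (rule continuous_on_const)
  have "continuously_differentiable_on \<Phi> W" by (rule C1[OF bl(1) W refl])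
  moreover have "\<Psi> y = inv_into W \<Phi> y" if "y \<in> \<Phi> ` W" for y using that inj inv(1) by auto
  then have "continuously_differentiable_on (inv_into W \<Phi>) (\<Phi> ` W)" by (rule C1[OF bl(2) op])
  ultimately show ?thesis using W inj op by (simp add: C1_diffeo_on_def)
qed

lemma dim_orthogonal_comp:
  fixes L :: "'a::euclidean_space set"
  assumes "subspace L" shows "dim (L\<^sup>\<bottom>) + dim L = DIM('a)"
  using dim_subspace_orthogonal_to_vectors[OF assms subspace_UNIV subset_UNIV]
  by (simp add: orthogonal_comp_def)

text \<open>Glue isometries of \<open>L\<close> and of its complement onto complementary coordinate subspaces.\<close>

lemma subspace_to_coordinate_subspace:
  fixes L :: "'a::euclidean_space set"
  assumes L: "subspace L"
  obtains S :: "'a set" and \<Phi> \<Psi> :: "'a \<Rightarrow> 'a" where "S \<subseteq> Basis" "card S = dim L" "linear \<Phi>" "linear \<Psi>"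
    "\<Psi> \<circ> \<Phi> = id" "\<Phi> \<circ> \<Psi> = id" "\<Phi> ` L = span S" "\<Phi> ` (L\<^sup>\<bottom>) = span (Basis - S)"
    "\<forall>x\<in>L \<union> L\<^sup>\<bottom>. norm (\<Phi> x) = norm x"
proof -
  obtain S :: "'a set" where S: "S \<subseteq> Basis" "card S = dim L"
    using obtain_subset_with_card_n[of "dim L" Basis] dim_subset_UNIV[of L] by metis
  have dS: "dim (span S) = dim L" using S by (simp add: independent_substdbasis dim_eq_card_independent)
  have subS: "subspace (span S)" by simp
  have comp: "(span S)\<^sup>\<bottom> = span (Basis - S)" by (rule span_Basis_orthogonal_comp[OF S(1)])
  have dS': "dim (span (Basis - S)) = dim (L\<^sup>\<bottom>)"
    using dim_orthogonal_comp[OF L] dim_orthogonal_comp[OF subS] dS by (simp add: comp)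
  obtain f1 g1 where 1: "linear f1" "linear g1" "f1 ` L = span S" "g1 ` span S = L"
    "\<And>x. x \<in> L \<Longrightarrow> norm (f1 x) = norm x" "\<And>x. x \<in> L \<Longrightarrow> g1 (f1 x) = x" "\<And>x. x \<in> span S \<Longrightarrow> f1 (g1 x) = x"
    using isometries_subspaces[OF L subS dS[symmetric]] by metis
  obtain f2 g2 where 2: "linear f2" "linear g2" "f2 ` (L\<^sup>\<bottom>) = span (Basis - S)" "g2 ` span (Basis - S) = L\<^sup>\<bottom>"
    "\<And>x. x \<in> L\<^sup>\<bottom> \<Longrightarrow> norm (f2 x) = norm x" "\<And>x. x \<in> L\<^sup>\<bottom> \<Longrightarrow> g2 (f2 x) = x"
    "\<And>x. x \<in> span (Basis - S) \<Longrightarrow> f2 (g2 x) = x"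
    using isometries_subspaces[OF subspace_orthogonal_comp subspace_span dS'[symmetric]] by metis
  let ?P = "orth_proj L" and ?Q = "orth_proj (span S)"
  note lin = linear_orth_proj[OF L] linear_orth_proj[OF subS] 1(1,2) 2(1,2)
  define \<Phi> where "\<Phi> x = f1 (?P x) + f2 (x - ?P x)" for x
  define \<Psi> where "\<Psi> y = g1 (?Q y) + g2 (y - ?Q y)" for y
  have f1S: "f1 (?P x) \<in> span S" and f2S: "f2 (x - ?P x) \<in> (span S)\<^sup>\<bottom>" for x
    using 1(3) 2(3) orth_proj_in[OF L] orth_proj_compl[OF L] by (auto simp: comp)
  have g1L: "g1 (?Q y) \<in> L" and g2L: "g2 (y - ?Q y) \<in> L\<^sup>\<bottom>" for y
    using 1(4) 2(4) orth_proj_in[OF subS] orth_proj_compl[OF subS] by (auto simp: comp)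
  have Q: "?Q (\<Phi> x) = f1 (?P x)" for x
    by (rule orth_proj_unique[OF subS]) (use f1S f2S in \<open>auto simp: \<Phi>_def\<close>)
  have P: "?P (\<Psi> y) = g1 (?Q y)" for y
    by (rule orth_proj_unique[OF L]) (use g1L g2L in \<open>auto simp: \<Psi>_def\<close>)
  have inv1: "\<Psi> (\<Phi> x) = x" for x
    unfolding \<Psi>_def Q by (simp add: \<Phi>_def 1(6) 2(6) orth_proj_in[OF L] orth_proj_compl[OF L])
  have inv2: "\<Phi> (\<Psi> y) = y" for y
    unfolding \<Phi>_def P using orth_proj_in[OF subS, of y] orth_proj_compl[OF subS, of y]
    by (simp add: \<Psi>_def 1(7) 2(7) comp)
  have lin': "linear \<Phi>" "linear \<Psi>"
    by (intro linearI; simp add: \<Phi>_def \<Psi>_def linear_add[OF lin(1)] linear_add[OF lin(2)] linear_add[OF lin(3)]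
      linear_add[OF lin(4)] linear_add[OF lin(5)] linear_add[OF lin(6)] linear_diff[OF lin(5)] linear_diff[OF lin(6)]
      linear_cmul[OF lin(1)] linear_cmul[OF lin(2)] linear_cmul[OF lin(3)] linear_cmul[OF lin(4)]
      linear_cmul[OF lin(5)] linear_cmul[OF lin(6)] algebra_simps)+
  have \<Phi>1: "\<Phi> x = f1 x" if "x \<in> L" for x
    using orth_proj_id[OF L that] by (simp add: \<Phi>_def linear_0[OF lin(5)])
  have \<Phi>2: "\<Phi> x = f2 x" if "x \<in> L\<^sup>\<bottom>" for x
    using orth_proj_eq_0[OF L that] by (simp add: \<Phi>_def linear_0[OF lin(3)])
  show thesis
  proof (rule that[OF S lin'])
    show "\<Psi> \<circ> \<Phi> = id" "\<Phi> \<circ> \<Psi> = id" using inv1 inv2 by auto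
    show "\<Phi> ` L = span S" "\<Phi> ` (L\<^sup>\<bottom>) = span (Basis - S)"
      unfolding 1(3)[symmetric] 2(3)[symmetric] by (auto intro!: image_cong \<Phi>1 \<Phi>2)
    show "\<forall>x\<in>L \<union> L\<^sup>\<bottom>. norm (\<Phi> x) = norm x" using \<Phi>1 \<Phi>2 1(5) 2(5) by auto
  qed
qed

text \<open>The local graph over \<open>L\<close>, moved isometrically to coordinate subspaces, is the graph of \<open>f\<close>.
  The cone condition holds with every slope near \<open>z\<close>, which says that \<open>f\<close> has strict derivative
  \<open>0\<close>.\<close>

lemma strictly_smooth_imp_strictly_differentiable_chart:
  fixes z :: "'a::euclidean_space"
  assumes smooth: "strictly_smooth \<Omega> z" and z: "z \<in> \<Omega>" and closed: "locally_closed_at \<Omega> z"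
  obtains d W \<Phi> S U f u where "lipschitz_chart d \<Omega> z W \<Phi> S U f" "u \<in> U" "u + f u = \<Phi> z"
    "strictly_differentiable_within f U u"
proof -
  define L where "L = paratingent_cone \<Omega> z"
  define P where "P = orth_proj L"
  have L: "subspace L" unfolding L_def by (rule strictly_smooth_imp_subspace[OF smooth z])
  obtain W \<rho> where W: "open W" "z \<in> W" "0 < \<rho>" "P ` (\<Omega> \<inter> W) = L \<inter> ball (P z) \<rho>"
    and cone: "\<And>a b. a \<in> \<Omega> \<inter> W \<Longrightarrow> b \<in> \<Omega> \<inter> W \<Longrightarrow> norm ((b - a) - P (b - a)) \<le> norm (P (b - a))"
    using strictly_smooth_imp_local_graph[OF smooth z closed] unfolding L_def P_def by metis
  obtain S :: "'a set" and \<Phi> \<Psi> where S: "S \<subseteq> Basis" "card S = dim L" and lin\<Phi>: "linear \<Phi>" "linear \<Psi>"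
    and inv: "\<Psi> \<circ> \<Phi> = id" "\<Phi> \<circ> \<Psi> = id" and img: "\<Phi> ` L = span S" "\<Phi> ` (L\<^sup>\<bottom>) = span (Basis - S)"
    and iso: "\<forall>x\<in>L \<union> L\<^sup>\<bottom>. norm (\<Phi> x) = norm x"
    by (rule subspace_to_coordinate_subspace[OF L])
  note linP = linear_orth_proj[OF L, folded P_def]
  have PL: "P x \<in> L" "x - P x \<in> L\<^sup>\<bottom>" for x
    unfolding P_def by (simp_all add: orth_proj_in[OF L] orth_proj_compl[OF L])
  have \<Phi>_eq: "\<Phi> x = \<Phi> (P x) + \<Phi> (x - P x)" for x
    by (simp flip: linear_add[OF lin\<Phi>(1)])
  have d1: "norm (\<Phi> (P b) - \<Phi> (P a)) = norm (P (b - a))" for a b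
    using iso PL(1)[of "b - a"] by (simp add: linear_diff[OF linP] flip: linear_diff[OF lin\<Phi>(1)])
  have d2: "norm (\<Phi> (b - P b) - \<Phi> (a - P a)) = norm ((b - a) - P (b - a))" for a b
  proof -
    have "\<Phi> (b - P b) - \<Phi> (a - P a) = \<Phi> ((b - a) - P (b - a))"
      by (simp add: linear_diff[OF linP] algebra_simps flip: linear_diff[OF lin\<Phi>(1)])
    then show ?thesis using iso PL(2)[of "b - a"] by simp
  qed
  define U where "U = (\<lambda>a. \<Phi> (P a)) ` (\<Omega> \<inter> W)"
  have inj: "inj_on (\<lambda>a. \<Phi> (P a)) (\<Omega> \<inter> W)"
  proof (rule inj_onI)
    fix a b assume ab: "a \<in> \<Omega> \<inter> W" "b \<in> \<Omega> \<inter> W" "\<Phi> (P a) = \<Phi> (P b)"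
    then have "P (b - a) = 0" using d1[of b a] by simp
    then show "a = b" using cone[OF ab(1,2)] by simp
  qed
  define f where "f u = (let a = inv_into (\<Omega> \<inter> W) (\<lambda>a. \<Phi> (P a)) u in \<Phi> (a - P a))" for u
  have fa: "f (\<Phi> (P a)) = \<Phi> (a - P a)" if "a \<in> \<Omega> \<inter> W" for a
    using inv_into_f_f[OF inj that] by (simp add: f_def)
  have graph: "\<Phi> ` (\<Omega> \<inter> W) = (\<lambda>u. u + f u) ` U"
    unfolding U_def image_image
  proof (rule image_cong[OF refl])
    fix a assume "a \<in> \<Omega> \<inter> W"
    then show "\<Phi> a = \<Phi> (P a) + f (\<Phi> (P a))" using fa \<Phi>_eq[of a] by simp
  qed
  have U_eq: "U = span S \<inter> ball (\<Phi> (P z)) \<rho>"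
  proof -
    have "U = \<Phi> ` (L \<inter> ball (P z) \<rho>)" unfolding U_def W(4)[symmetric] image_image ..
    also have "\<dots> = span S \<inter> ball (\<Phi> (P z)) \<rho>"
    proof -
      have "dist (\<Phi> (P z)) (\<Phi> x) = dist (P z) x" if "x \<in> L" for x
        using iso subspace_diff[OF L PL(1)[of z] that] by (simp add: dist_norm flip: linear_diff[OF lin\<Phi>(1)])
      then show ?thesis unfolding img(1)[symmetric] by auto
    qed
    finally show ?thesis .
  qed
  have lip: "1-lipschitz_on U f"
  proof (rule lipschitz_onI)
    fix u u' assume "u \<in> U" "u' \<in> U"
    then obtain a a' where "a \<in> \<Omega> \<inter> W" "a' \<in> \<Omega> \<inter> W" "u = \<Phi> (P a)" "u' = \<Phi> (P a')" by (auto simp: U_def)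
    then show "dist (f u) (f u') \<le> 1 * dist u u'"
      using cone[of a' a] d1[of a a'] d2[of a a'] by (simp add: dist_norm fa)
  qed simp
  have chart: "lipschitz_chart (dim L) \<Omega> z W \<Phi> S U f"
    unfolding lipschitz_chart_def
  proof (intro conjI)
    show "C1_diffeo_on \<Phi> W" using inv by (intro linear_isomorphism_C1_diffeo_on[OF lin\<Phi> _ _ W(1)]) (auto dest: fun_cong)
    show "openin (top_of_set (span S)) U" unfolding U_eq by (intro openin_open_Int open_ball)
    show "f ` U \<subseteq> span (Basis - S)" using img(2) PL(2) by (auto simp: U_def fa)
    show "\<exists>L. L-lipschitz_on U f" using lip by blast
  qed (use W S graph in auto)
  let ?u0 = "\<Phi> (P z)"
  have zW: "z \<in> \<Omega> \<inter> W" using z W by simp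
  have "strictly_differentiable_within f U ?u0"
    unfolding strictly_differentiable_within_def
  proof (intro exI conjI)
    show "linear (\<lambda>_::'a. 0 :: 'a)" by (simp add: linear_zero)
    show "((\<lambda>(u, u'). (f u' - f u - 0) /\<^sub>R norm (u' - u)) \<longlongrightarrow> 0)
          (at (?u0, ?u0) within {(u, u'). u \<in> U \<and> u' \<in> U \<and> u \<noteq> u'})"
    proof (rule tendstoI)
      fix e :: real assume "0 < e"
      have "paratingent_cone \<Omega> z \<subseteq> L" by (simp add: L_def)
      then obtain d where d: "0 < d" "\<And>a b. a \<in> \<Omega> \<Longrightarrow> b \<in> \<Omega> \<Longrightarrow> dist a z < d \<Longrightarrow> dist b z < d \<Longrightarrow>
          norm ((b - a) - P (b - a)) \<le> (e/2) * norm (P (b - a))"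
        using paratingent_subset_imp_cone_condition[OF L _ half_gt_zero[OF \<open>0 < e\<close>], of \<Omega> z] unfolding P_def by metis
      have near: "dist a z < d" if a: "a \<in> \<Omega> \<inter> W" and u: "dist (\<Phi> (P a)) ?u0 < d / 2" for a
      proof -
        have "norm (a - z) \<le> norm (P (a - z)) + norm (P (a - z))"
          using cone[OF zW a] norm_triangle_ineq[of "(a - z) - P (a - z)" "P (a - z)"] by simp
        then show ?thesis using u d1[of a z] by (simp add: dist_norm)
      qed
      have small: "norm ((f u' - f u) /\<^sub>R norm (u' - u)) < e"
        if uu: "u \<in> U" "u' \<in> U" "u \<noteq> u'" "dist u ?u0 < d/2" "dist u' ?u0 < d/2" for u u'
      proof -
        obtain a a' where a: "a \<in> \<Omega> \<inter> W" "a' \<in> \<Omega> \<inter> W" "u = \<Phi> (P a)" "u' = \<Phi> (P a')"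
          using uu(1,2) by (auto simp: U_def)
        have "norm (f u' - f u) \<le> (e/2) * norm (u' - u)"
          using d(2)[of a a'] near a uu(4,5) d1[of a' a] d2[of a' a] by (simp add: fa)
        also have "\<dots> < e * norm (u' - u)" using uu(3) \<open>0 < e\<close> by simp
        finally have "norm (f u' - f u) / norm (u' - u) < e" using uu(3) by (subst pos_divide_less_eq) auto
        then show ?thesis by (simp add: divide_inverse mult.commute)
      qed
      have "dist u ?u0 < d/2 \<and> dist u' ?u0 < d/2" if "dist (u, u') (?u0, ?u0) < d/2" for u u'
        using dist_fst_le[of "(u, u')" "(?u0, ?u0)"] dist_snd_le[of "(u, u')" "(?u0, ?u0)"] that by simp
      then show "\<forall>\<^sub>F x in at (?u0, ?u0) within {(u, u'). u \<in> U \<and> u' \<in> U \<and> u \<noteq> u'}.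
          dist (case x of (u, u') \<Rightarrow> (f u' - f u - 0) /\<^sub>R norm (u' - u)) 0 < e"
        unfolding eventually_at using d(1) small by (intro exI[of _ "d/2"]) auto
    qed
  qed
  moreover have "?u0 \<in> U" using zW by (auto simp: U_def)
  moreover have "?u0 + f ?u0 = \<Phi> z" using fa[OF zW] \<Phi>_eq[of z] by simp
  ultimately show thesis using chart that by blast
qed

section \<open>Normal cones\<close>

text \<open>The vector from a nearest point to the projected point is normal: a tangent direction with
  positive inner product would lead to a nearer point.\<close>

lemma projection_residual_regular_normal:
  fixes x p :: "'a::euclidean_space"
  assumes p: "p \<in> interior V" and nearest: "\<And>b. b \<in> \<Omega> \<Longrightarrow> b \<in> V \<Longrightarrow> norm (x - p) \<le> norm (x - b)"
    and c: "0 \<le> c"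
  shows "c *\<^sub>R (x - p) \<in> regular_normal_cone \<Omega> p"
proof -
  have "(x - p) \<bullet> y \<le> 0" if y: "y \<in> tangent_cone \<Omega> p" for y
  proof (rule ccontr)
    assume "\<not> (x - p) \<bullet> y \<le> 0"
    define m where "m = (x - p) \<bullet> y"
    have m: "m > 0" using \<open>\<not> (x - p) \<bullet> y \<le> 0\<close> by (simp add: m_def)
    obtain r where r: "r > 0" "ball p r \<subseteq> V" using p mem_interior by blast
    define e where "e = min 1 (m / (4 * (norm (x - p) + 1)))"
    have n1: "4 * (norm (x - p) + 1) > 0" by (simp add: add_nonneg_pos)
    have e: "0 < e" "e \<le> 1" using m n1 by (auto simp: e_def)
    have "e \<le> m / (4 * (norm (x - p) + 1))" by (simp add: e_def)
    then have "e * (4 * (norm (x - p) + 1)) \<le> m" using n1 by (simp only: pos_le_divide_eq)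
    then have e4: "e * (norm (x - p) + 1) \<le> m / 4" by (simp add: algebra_simps)
    define N where "N = norm y + 1"
    have N: "N \<ge> 1" by (simp add: N_def)
    define d where "d = min (r / N) (m / (2 * N\<^sup>2))"
    have d: "0 < d" "d \<le> r / N" "d \<le> m / (2 * N\<^sup>2)" using r m N by (auto simp: d_def)
    obtain t b where tb: "0 < t" "t < d" "b \<in> \<Omega>" "norm (b - p - t *\<^sub>R y) < e * t"
      using y e(1) d(1) unfolding mem_tangent_cone_iff by blast
    have "norm (b - p) \<le> norm (b - p - t *\<^sub>R y) + norm (t *\<^sub>R y)"
      using norm_triangle_ineq[of "b - p - t *\<^sub>R y" "t *\<^sub>R y"] by simp
    also have "\<dots> \<le> 1 * t + t * norm y"
    proof -
      have "e * t \<le> 1 * t" using e(2) tb(1) by (intro mult_right_mono) auto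
      moreover have "norm (t *\<^sub>R y) = t * norm y" using tb(1) by simp
      ultimately show ?thesis using tb(4) by linarith
    qed
    finally have bp: "norm (b - p) \<le> t * N" by (simp add: N_def algebra_simps)
    also have "t * N < r" using tb(2) d(2) N by (simp add: pos_le_divide_eq less_le_trans) (smt (verit) mult_strict_right_mono)
    finally have "b \<in> V" using r(2) by (auto simp: dist_norm norm_minus_commute)
    then have "norm (x - p) \<le> norm (x - b)" using nearest tb(3) by blast
    then have "(norm (x - p))\<^sup>2 \<le> (norm ((x - p) - (b - p)))\<^sup>2" by (simp add: power_mono)
    also have "\<dots> = (norm (x - p))\<^sup>2 + (norm (b - p))\<^sup>2 - 2 * ((x - p) \<bullet> (b - p))"
      by (simp add: power2_norm_eq_inner inner_diff inner_commute)
    finally have 1: "2 * ((x - p) \<bullet> (b - p)) \<le> (norm (b - p))\<^sup>2" by simp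
    have "(norm (b - p))\<^sup>2 \<le> (t * N)\<^sup>2" using bp by (simp add: power_mono)
    with 1 have 2: "2 * ((x - p) \<bullet> (b - p)) \<le> t * (t * N\<^sup>2)" by (simp add: power_mult_distrib power2_eq_square mult_ac)
    have "(x - p) \<bullet> (b - p) = (x - p) \<bullet> (b - p - t *\<^sub>R y) + t * m"
      by (simp add: m_def inner_diff_right)
    moreover have "\<bar>(x - p) \<bullet> (b - p - t *\<^sub>R y)\<bar> \<le> norm (x - p) * (e * t)"
      using Cauchy_Schwarz_ineq2[of "x - p" "b - p - t *\<^sub>R y"] tb(4)
      by (meson less_imp_le mult_left_mono norm_ge_zero order_trans)
    ultimately have "2 * (t * m) \<le> t * (t * N\<^sup>2) + 2 * (norm (x - p) * (e * t))" using 2 by linarith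
    then have "t * (2 * m) \<le> t * (t * N\<^sup>2 + 2 * (e * norm (x - p)))" by (simp add: algebra_simps)
    then have 3: "2 * m \<le> t * N\<^sup>2 + 2 * (e * norm (x - p))" using tb(1) by simp
    have "t * N\<^sup>2 \<le> m / (2 * N\<^sup>2) * N\<^sup>2" using tb(2) d(3) by (intro mult_right_mono) auto
    also have "\<dots> = m / 2" using N by simp
    finally have "t * N\<^sup>2 \<le> m / 2" .
    moreover have "e * norm (x - p) \<le> m / 4" using e4 e(1) by (simp add: algebra_simps)
    ultimately show False using 3 m by simp
  qed
  then show ?thesis
    using c by (auto simp: regular_normal_cone_def polar_cone_def mult_nonneg_nonpos)
qed

text \<open>The distance \<open>d s\<close> of \<open>a + s w\<close> to \<open>C\<close> grows from \<open>0\<close> to at least \<open>e t\<close>, so at some \<open>s\<close>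
  where it is positive its slope to the right is at least \<open>e / 2\<close>. For the projection \<open>p\<close> of \<open>x =
  a + s w\<close>, the slope is at most the inner product of \<open>w\<close> with the unit vector from \<open>p\<close> to \<open>x\<close>.\<close>

lemma empty_ball_imp_normal:
  fixes a w :: "'a::euclidean_space"
  assumes C: "closed C" and a: "a \<in> C" and t: "0 < t" and e: "0 < e"
    and far: "\<And>b. b \<in> C \<Longrightarrow> e * t \<le> norm (b - a - t *\<^sub>R w)"
  obtains x p where "p \<in> C" "x \<noteq> p" "\<And>b. b \<in> C \<Longrightarrow> norm (x - p) \<le> norm (x - b)"
    "norm (p - a) \<le> 2 * t * norm w" "e / 2 * norm (x - p) \<le> (x - p) \<bullet> w"
proof -
  define d where "d s = infdist (a + s *\<^sub>R w) C" for s
  have C0: "C \<noteq> {}" using a by blast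
  have contd: "continuous_on A d" for A unfolding d_def by (intro continuous_intros)
  have dt: "e * t \<le> d t"
  proof -
    obtain q where "q \<in> C" "d t = dist (a + t *\<^sub>R w) q"
      using infdist_attains_inf[OF C C0] unfolding d_def by metis
    then show ?thesis using far[of q] by (simp add: dist_norm norm_minus_commute algebra_simps)
  qed
  have d0: "d 0 = 0" using a by (simp add: d_def)
  define m where "m = e * t / 4"
  have m: "m > 0" using e t by (simp add: m_def)
  \<comment> \<open>Otherwise \<open>e/2 * s - max (d s) m\<close> is nondecreasing, which contradicts its end values. The
    threshold \<open>m\<close> keeps \<open>s\<close> away from points of \<open>C\<close>.\<close>
  have "\<exists>s\<ge>0. s < t \<and> m \<le> d s \<and> (\<exists>\<tau>0>0. \<forall>\<tau>. 0 < \<tau> \<longrightarrow> \<tau> < \<tau>0 \<longrightarrow> d s + e/2 * \<tau> < d (s + \<tau>))"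
  proof (rule ccontr)
    assume no: "\<not> ?thesis"
    have "e/2 * 0 - max (d 0) m \<le> e/2 * t - max (d t) m"
    proof (rule right_nondecreasing_imp_le[of 0 t "\<lambda>s. e/2 * s - max (d s) m"])
      show "continuous_on {0..t} (\<lambda>s. e/2 * s - max (d s) m)" by (intro continuous_intros contd)
      show "0 \<le> t" using t by simp
      fix s \<tau>0 :: real assume s: "0 \<le> s" "s < t" and \<tau>0: "0 < \<tau>0"
      show "\<exists>\<tau>>0. \<tau> < \<tau>0 \<and> e/2 * s - max (d s) m \<le> e/2 * (s + \<tau>) - max (d (s + \<tau>)) m"
      proof (cases "m \<le> d s")
        case True
        then have "\<exists>\<tau>>0. \<tau> < \<tau>0 \<and> d (s + \<tau>) \<le> d s + e/2 * \<tau>"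
          using no s \<tau>0 by (metis not_le)
        then obtain \<tau> where \<tau>: "0 < \<tau>" "\<tau> < \<tau>0" "d (s + \<tau>) \<le> d s + e/2 * \<tau>" by blast
        have "0 < e/2 * \<tau>" using e \<tau>(1) by simp
        then have "e/2 * s - max (d s) m \<le> e/2 * (s + \<tau>) - max (d (s + \<tau>)) m"
          using \<tau>(3) True by (auto simp: max_def algebra_simps)
        with \<tau> show ?thesis by blast
      next
        case False
        have "isCont d s" using contd[of UNIV] by (simp add: continuous_on_eq_continuous_at)
        then have "\<forall>\<^sub>F x in nhds s. d x < m"
          using False by (intro order_tendstoD(2)[of d "d s"]) (auto simp: isCont_def tendsto_at_iff_tendsto_nhds)
        then obtain \<delta> where \<delta>: "\<delta> > 0" "\<And>x. dist x s < \<delta> \<Longrightarrow> d x < m" by (auto simp: eventually_nhds_metric)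
        define \<tau> where "\<tau> = min \<delta> \<tau>0 / 2"
        have \<tau>: "0 < \<tau>" "\<tau> < \<tau>0" "\<tau> < \<delta>" using \<delta>(1) \<tau>0 by (auto simp: \<tau>_def)
        have "d (s + \<tau>) < m" using \<delta>(2)[of "s + \<tau>"] \<tau> by (simp add: dist_real_def)
        then show ?thesis using False \<tau> e by (intro exI[of _ \<tau>]) (auto simp: max_def algebra_simps)
      qed
    qed
    then have "e / 2 * t \<ge> d t - m" using d0 m by (simp add: max_def split: if_splits)
    with dt m show False by (simp add: m_def)
  qed
  then obtain s \<tau>0 where s: "0 \<le> s" "s < t" "m \<le> d s" and \<tau>0: "0 < \<tau>0"
    "\<And>\<tau>. 0 < \<tau> \<Longrightarrow> \<tau> < \<tau>0 \<Longrightarrow> d s + e/2 * \<tau> < d (s + \<tau>)" by blast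
  define x where "x = a + s *\<^sub>R w"
  obtain p where p: "p \<in> C" "d s = norm (x - p)"
    using infdist_attains_inf[OF C C0, of x] unfolding d_def x_def by (metis dist_norm)
  have dpos: "d s > 0" using s(3) m by simp
  have near: "norm (x - p) \<le> norm (x - b)" if "b \<in> C" for b
    using infdist_le[OF that, of x] p(2) by (simp add: d_def x_def dist_norm)
  have "norm (p - a) \<le> norm (x - p) + norm (x - a)"
    using norm_triangle_ineq4[of "x - a" "x - p"] by simp
  also have "norm (x - p) \<le> norm (x - a)" by (rule near[OF a])
  also have "norm (x - a) \<le> t * norm w" using s by (simp add: x_def mult_right_mono)
  finally have pa: "norm (p - a) \<le> 2 * t * norm w" by simp
  have "e * d s \<le> 2 * ((x - p) \<bullet> w)"
  proof (rule ccontr)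
    assume "\<not> ?thesis"
    then have g: "0 < e * d s - 2 * ((x - p) \<bullet> w)" by simp
    define \<tau> where "\<tau> = min (\<tau>0/2) ((e * d s - 2 * ((x - p) \<bullet> w)) / (2 * ((norm w)\<^sup>2 + 1)))"
    have w1: "2 * ((norm w)\<^sup>2 + 1) > 0" by (simp add: add_nonneg_pos)
    have \<tau>: "0 < \<tau>" "\<tau> < \<tau>0" using \<tau>0(1) g w1 by (auto simp: \<tau>_def)
    have \<tau>w: "\<tau> * (2 * ((norm w)\<^sup>2 + 1)) \<le> e * d s - 2 * ((x - p) \<bullet> w)"
      using min.cobounded2 unfolding \<tau>_def pos_le_divide_eq[OF w1, symmetric] by blast
    have "d (s + \<tau>) \<le> norm ((x - p) + \<tau> *\<^sub>R w)"
      using infdist_le[OF p(1), of "a + (s + \<tau>) *\<^sub>R w"] by (simp add: d_def x_def dist_norm algebra_simps)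
    with \<tau>0(2)[OF \<tau>] have "d s + e/2 * \<tau> < norm ((x - p) + \<tau> *\<^sub>R w)" by simp
    moreover have "0 \<le> d s + e/2 * \<tau>" using dpos e \<tau> by simp
    ultimately have "(d s + e/2 * \<tau>)\<^sup>2 < (norm ((x - p) + \<tau> *\<^sub>R w))\<^sup>2" by (intro power_strict_mono) auto
    also have "\<dots> = (d s)\<^sup>2 + 2 * \<tau> * ((x - p) \<bullet> w) + \<tau>\<^sup>2 * (norm w)\<^sup>2"
      unfolding p(2) power2_norm_eq_inner by (simp add: inner_add inner_commute power2_eq_square algebra_simps)
    finally have "\<tau> * (e * d s) + (e/2 * \<tau>)\<^sup>2 < 2 * \<tau> * ((x - p) \<bullet> w) + \<tau>\<^sup>2 * (norm w)\<^sup>2"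
      by (simp add: power2_sum algebra_simps)
    then have "\<tau> * (e * d s) < 2 * \<tau> * ((x - p) \<bullet> w) + \<tau>\<^sup>2 * (norm w)\<^sup>2"
      using zero_le_power2[of "e/2 * \<tau>"] by linarith
    then have "\<tau> * (e * d s) < \<tau> * (2 * ((x - p) \<bullet> w) + \<tau> * (norm w)\<^sup>2)" by (simp add: algebra_simps power2_eq_square)
    then have "e * d s < 2 * ((x - p) \<bullet> w) + \<tau> * (norm w)\<^sup>2" using \<tau>(1) by simp
    moreover have "\<tau> * (norm w)\<^sup>2 \<le> \<tau> * (2 * ((norm w)\<^sup>2 + 1))" using \<tau>(1) by simp
    ultimately show False using \<tau>w by linarith
  qed
  then have "e / 2 * norm (x - p) \<le> (x - p) \<bullet> w" using p(2) by simp
  moreover have "x \<noteq> p" using dpos p(2) by auto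
  ultimately show thesis using that p(1) near pa by blast
qed

text \<open>If \<open>w\<close> is not a regular tangent, balls around \<open>a + t w\<close> of radius \<open>e t\<close> avoid \<open>\<Omega>\<close> for \<open>a\<close>
  near \<open>z\<close> and small \<open>t\<close>. Each yields a unit normal near \<open>z\<close> whose inner product with \<open>w\<close> is at
  least \<open>e / 2\<close>; so does their limit, which contradicts polarity.\<close>

lemma polar_limiting_normal_subset_regular_tangent:
  fixes z :: "'a::euclidean_space"
  assumes z: "z \<in> \<Omega>" and closed: "locally_closed_at \<Omega> z"
  shows "polar_cone (limiting_normal_cone \<Omega> z) \<subseteq> regular_tangent_cone \<Omega> z"
proof
  fix w assume w: "w \<in> polar_cone (limiting_normal_cone \<Omega> z)"
  show "w \<in> regular_tangent_cone \<Omega> z"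
  proof (rule ccontr)
    assume "\<not> ?thesis"
    then obtain e where e: "0 < e"
      "\<And>d. 0 < d \<Longrightarrow> \<exists>a t. a \<in> \<Omega> \<and> dist a z < d \<and> 0 < t \<and> t < d \<and> (\<forall>b\<in>\<Omega>. \<not> norm (b - a - t *\<^sub>R w) < e * t)"
      using not_regular_tangent_coneE[OF _ z] by metis
    obtain V where V: "closed V" "z \<in> interior V" "closed (\<Omega> \<inter> V)"
      using closed by (auto simp: locally_closed_at_def)
    obtain R where R: "R > 0" "ball z R \<subseteq> interior V"
      using V(2) open_interior open_contains_ball by metis
    define c where "c = 1 + 2 * norm w"
    have c: "c \<ge> 1" by (simp add: c_def)
    have step: "\<exists>p v. p \<in> \<Omega> \<and> dist p z \<le> c * r \<and> v \<in> regular_normal_cone \<Omega> p \<and> norm v = 1 \<and> e / 2 \<le> v \<bullet> w"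
      if r: "0 < r" "c * r < R" for r
    proof -
      obtain a t where at: "a \<in> \<Omega>" "dist a z < r" "0 < t" "t < r" "\<And>b. b \<in> \<Omega> \<Longrightarrow> \<not> norm (b - a - t *\<^sub>R w) < e * t"
        using e(2)[OF r(1)] by blast
      have "r \<le> c * r" using c r(1) by simp
      then have "dist z a < R" using at(2) r(2) by (simp add: dist_commute)
      then have aV: "a \<in> \<Omega> \<inter> V" using at(1) R(2) interior_subset by (auto simp: subset_iff)
      obtain x p where xp: "p \<in> \<Omega> \<inter> V" "x \<noteq> p" "\<And>b. b \<in> \<Omega> \<inter> V \<Longrightarrow> norm (x - p) \<le> norm (x - b)"
        "norm (p - a) \<le> 2 * t * norm w" "e / 2 * norm (x - p) \<le> (x - p) \<bullet> w"
        using empty_ball_imp_normal[OF V(3) aV at(3) e(1), of w] at(5) by (metis IntD1 not_le)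
      have "norm (p - a) \<le> 2 * r * norm w"
        using xp(4) mult_right_mono[of "2 * t" "2 * r" "norm w"] at(4) by simp
      then have pz: "dist p z \<le> c * r"
        using dist_triangle[of p z a] at(2) by (simp add: c_def dist_norm algebra_simps)
      then have "p \<in> interior V" using R(2) r(2) by (auto simp: dist_commute)
      define v where "v = inverse (norm (x - p)) *\<^sub>R (x - p)"
      have "v \<in> regular_normal_cone \<Omega> p"
        unfolding v_def by (rule projection_residual_regular_normal[OF \<open>p \<in> interior V\<close>]) (use xp(3) in auto)
      moreover have n: "norm (x - p) > 0" using xp(2) by simp
      then have "norm v = 1" by (simp add: v_def)
      moreover have "e / 2 \<le> v \<bullet> w"
      proof -
        have "v \<bullet> w = ((x - p) \<bullet> w) / norm (x - p)" by (simp add: v_def divide_inverse mult.commute)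
        then show ?thesis using xp(5) n by (simp only: pos_le_divide_eq)
      qed
      ultimately show ?thesis using xp(1) pz by blast
    qed
    obtain r0 :: "nat \<Rightarrow> real" where r0: "\<And>k. 0 < r0 k" "r0 \<longlonglongrightarrow> 0" using inverse_Suc_seq by blast
    define r where "r k = min (r0 k) (R / (2 * c))" for k
    have r: "0 < r k" "r k \<le> r0 k" "c * r k < R" for k
    proof -
      show "0 < r k" "r k \<le> r0 k" using r0(1)[of k] R c by (auto simp: r_def)
      have "c * r k \<le> c * (R / (2 * c))" using c by (intro mult_left_mono) (auto simp: r_def)
      also have "\<dots> < R" using c R by simp
      finally show "c * r k < R" .
    qed
    obtain p v where pv: "\<And>k. p k \<in> \<Omega>" "\<And>k. dist (p k) z \<le> c * r k" "\<And>k. v k \<in> regular_normal_cone \<Omega> (p k)"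
      "\<And>k. norm (v k) = 1" "\<And>k. e / 2 \<le> v k \<bullet> w"
      using step[OF r(1,3)] by metis
    have "range v \<subseteq> sphere 0 1" using pv(4) by auto
    then obtain u s where s: "strict_mono s" "(v \<circ> s) \<longlonglongrightarrow> u"
      using compact_sphere[of "0::'a" 1] unfolding compact_def by (metis range_subsetD)
    have "u \<in> limiting_normal_cone \<Omega> z"
      unfolding mem_limiting_normal_cone_iff
    proof (intro allI impI)
      fix e' d :: real assume "0 < e'" "0 < d"
      have cr: "(\<lambda>k. c * r0 k) \<longlonglongrightarrow> c * 0" by (intro tendsto_intros r0)
      have "\<forall>\<^sub>F k in sequentially. dist ((v \<circ> s) k) u < e' \<and> ((\<lambda>k. c * r0 k) \<circ> s) k < d"
        using \<open>0 < e'\<close> \<open>0 < d\<close>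
        by (intro eventually_conj tendstoD[OF s(2)] order_tendstoD(2)[OF LIMSEQ_subseq_LIMSEQ[OF cr s(1)]]) auto
      then obtain k where k: "dist (v (s k)) u < e'" "c * r0 (s k) < d" by (auto simp: eventually_sequentially)
      have "c * r (s k) \<le> c * r0 (s k)" using c r(2) by simp
      then have "dist (p (s k)) z < d" using pv(2)[of "s k"] k(2) by linarith
      then show "\<exists>a\<in>\<Omega>. dist a z < d \<and> (\<exists>c\<in>regular_normal_cone \<Omega> a. norm (u - c) < e')"
        using pv(1,3) k(1) by (intro bexI[of _ "p (s k)"] conjI bexI[of _ "v (s k)"]) (auto simp: dist_norm norm_minus_commute)
    qed
    then have "w \<bullet> u \<le> 0" using w by (simp add: polar_cone_def)
    moreover have "(\<lambda>k. (v \<circ> s) k \<bullet> w) \<longlonglongrightarrow> u \<bullet> w" by (intro tendsto_intros s)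
    then have "e / 2 \<le> u \<bullet> w" by (rule LIMSEQ_le_const) (use pv(5) in auto)
    ultimately show False using e(1) by (simp add: inner_commute)
  qed
qed

text \<open>Regular tangents are approximated by tangents at all nearby points: let \<open>t \<rightarrow> 0\<close> at a fixed
  base point.\<close>

lemma regular_tangent_cone_approx_tangent:
  fixes z :: "'a::euclidean_space"
  assumes w: "w \<in> regular_tangent_cone \<Omega> z" and z: "z \<in> \<Omega>" and e: "0 < e"
  obtains d where "0 < d" "\<And>a. a \<in> \<Omega> \<Longrightarrow> dist a z < d \<Longrightarrow> \<exists>w'\<in>tangent_cone \<Omega> a. norm (w' - w) \<le> e"
proof -
  obtain d where d: "0 < d" "\<And>a t. a \<in> \<Omega> \<Longrightarrow> dist a z < d \<Longrightarrow> 0 < t \<Longrightarrow> t < d \<Longrightarrow>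
      \<exists>b\<in>\<Omega>. norm (b - a - t *\<^sub>R w) < e * t"
    using regular_tangent_coneE[OF w z e] by metis
  have "\<exists>w'\<in>tangent_cone \<Omega> a. norm (w' - w) \<le> e" if a: "a \<in> \<Omega>" "dist a z < d" for a
  proof -
    obtain r0 :: "nat \<Rightarrow> real" where r0: "\<And>k. 0 < r0 k" "r0 \<longlonglongrightarrow> 0" using inverse_Suc_seq by blast
    define t where "t k = min (r0 k) (d/2)" for k
    have t: "0 < t k" "t k < d" "t k \<le> r0 k" for k using r0(1)[of k] d(1) by (auto simp: t_def)
    have "dist (t k) 0 \<le> r0 k" for k using t[of k] by simp
    then have t0: "t \<longlonglongrightarrow> 0" by (rule dist_null_imp_tendsto[OF _ r0(2)])
    obtain b where b: "\<And>k. b k \<in> \<Omega>" "\<And>k. norm (b k - a - t k *\<^sub>R w) < e * t k"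
      using d(2)[OF a t(1,2)] by metis
    have bound: "norm (b k - a) \<le> (norm w + e) * t k" for k
    proof -
      have "norm (b k - a) \<le> norm (b k - a - t k *\<^sub>R w) + norm (t k *\<^sub>R w)"
        using norm_triangle_ineq[of "b k - a - t k *\<^sub>R w" "t k *\<^sub>R w"] by simp
      then show ?thesis using b(2)[of k] t(1)[of k] by (simp add: algebra_simps)
    qed
    obtain w' s where q: "(\<lambda>k. (b (s k) - a) /\<^sub>R t (s k)) \<longlonglongrightarrow> w'" and w': "w' \<in> tangent_cone \<Omega> a"
      using bounded_quotients_cluster[OF a(1) b(1) t(1) t0 tendsto_const bound] by metis
    have "norm ((b k - a) /\<^sub>R t k - w) \<le> e" for k
    proof -
      have "(b k - a) /\<^sub>R t k - w = (b k - a - t k *\<^sub>R w) /\<^sub>R t k" using t(1)[of k] by (simp add: scaleR_diff_right)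
      then show ?thesis using norm_scaleR_inverse_le[OF t(1) less_imp_le[OF b(2)]] by simp
    qed
    then have "norm (w' - w) \<le> e"
      by (intro LIMSEQ_le_const2[OF tendsto_norm[OF tendsto_diff[OF q tendsto_const]]]) auto
    then show ?thesis using w' by blast
  qed
  with d(1) that show thesis by blast
qed

lemma limiting_normal_subset_polar_regular_tangent:
  fixes z :: "'a::euclidean_space"
  assumes z: "z \<in> \<Omega>"
  shows "limiting_normal_cone \<Omega> z \<subseteq> polar_cone (regular_tangent_cone \<Omega> z)"
proof
  fix v assume v: "v \<in> limiting_normal_cone \<Omega> z"
  have "v \<bullet> w \<le> 0" if w: "w \<in> regular_tangent_cone \<Omega> z" for w
  proof (rule nonpos_of_le_mult_epsilon)
    fix e1 :: real assume e1: "0 < e1" "e1 \<le> 1"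
    obtain d where d: "0 < d" "\<And>a. a \<in> \<Omega> \<Longrightarrow> dist a z < d \<Longrightarrow> \<exists>w'\<in>tangent_cone \<Omega> a. norm (w' - w) \<le> e1"
      using regular_tangent_cone_approx_tangent[OF w z e1(1)] by metis
    obtain a u where a: "a \<in> \<Omega>" "dist a z < d" and u: "u \<in> regular_normal_cone \<Omega> a" "norm (v - u) < e1"
      using v e1(1) d(1) unfolding mem_limiting_normal_cone_iff by blast
    obtain w' where w': "w' \<in> tangent_cone \<Omega> a" "norm (w' - w) \<le> e1" using d(2) a by blast
    have "u \<bullet> w' \<le> 0" using u(1) w'(1) by (simp add: regular_normal_cone_def polar_cone_def)
    moreover have "v \<bullet> w = u \<bullet> w' + (v - u) \<bullet> w' + v \<bullet> (w - w')" by (simp add: inner_diff)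
    moreover have "(v - u) \<bullet> w' \<le> e1 * (norm w + 1)"
    proof -
      have "norm w' \<le> norm w + 1" using w'(2) e1(2) norm_triangle_ineq[of w "w' - w"] by simp
      then have "norm (v - u) * norm w' \<le> e1 * (norm w + 1)" using u(2) e1(1) by (intro mult_mono) auto
      then show ?thesis using norm_cauchy_schwarz[of "v - u" w'] by linarith
    qed
    moreover have "v \<bullet> (w - w') \<le> norm v * e1"
      using norm_cauchy_schwarz[of v "w - w'"] mult_left_mono[OF w'(2), of "norm v"]
      by (simp add: norm_minus_commute)
    ultimately show "v \<bullet> w \<le> e1 * (norm v + norm w + 1)" by (simp add: algebra_simps)
  qed
  then show "v \<in> polar_cone (regular_tangent_cone \<Omega> z)" by (simp add: polar_cone_def)
qed

lemma polar_cone_subspace: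
  assumes L: "subspace L" shows "polar_cone L = L\<^sup>\<bottom>"
proof
  show "polar_cone L \<subseteq> L\<^sup>\<bottom>"
  proof
    fix v assume v: "v \<in> polar_cone L"
    have "v \<bullet> a = 0" if "a \<in> L" for a
    proof -
      have "v \<bullet> a \<le> 0" "v \<bullet> (- a) \<le> 0" using v that subspace_neg[OF L that] by (auto simp: polar_cone_def)
      then show ?thesis by simp
    qed
    then show "v \<in> L\<^sup>\<bottom>" by (simp add: orthogonal_comp_def orthogonal_def inner_commute)
  qed
  show "L\<^sup>\<bottom> \<subseteq> polar_cone L" by (auto simp: orthogonal_comp_def orthogonal_def polar_cone_def inner_commute)
qed

lemma regular_normal_subset_limiting_normal:
  assumes "z \<in> \<Omega>" shows "regular_normal_cone \<Omega> z \<subseteq> limiting_normal_cone \<Omega> z"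
proof
  fix v assume v: "v \<in> regular_normal_cone \<Omega> z"
  show "v \<in> limiting_normal_cone \<Omega> z"
    unfolding mem_limiting_normal_cone_iff
    using assms v by (intro allI impI bexI[of _ z] conjI bexI[of _ v]) auto
qed

text \<open>The limiting normal cone lies between the regular one, polar to the tangent cone, and the
  polar of the regular tangent cone; here both are the complement of the same subspace.\<close>

lemma strictly_smooth_normal_cones:
  fixes z :: "'a::euclidean_space"
  assumes smooth: "strictly_smooth \<Omega> z" and z: "z \<in> \<Omega>"
  shows "regular_normal_cone \<Omega> z = (paratingent_cone \<Omega> z)\<^sup>\<bottom>"
    and "limiting_normal_cone \<Omega> z = (paratingent_cone \<Omega> z)\<^sup>\<bottom>"
proof -
  note eq = strictly_smooth_cones_eq[OF smooth z]
  note L = strictly_smooth_imp_subspace[OF smooth z]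
  show 1: "regular_normal_cone \<Omega> z = (paratingent_cone \<Omega> z)\<^sup>\<bottom>"
    by (simp add: regular_normal_cone_def eq(1) polar_cone_subspace[OF L])
  show "limiting_normal_cone \<Omega> z = (paratingent_cone \<Omega> z)\<^sup>\<bottom>"
    using regular_normal_subset_limiting_normal[OF z] limiting_normal_subset_polar_regular_tangent[OF z]
    unfolding 1 eq(2) polar_cone_subspace[OF L] by (rule subset_antisym[rotated])
qed

context lipschitz_patch
begin

text \<open>For the tangent \<open>w\<close> at a nearby point with \<open>p w = x\<close>, a regular normal \<open>u\<close> close to \<open>v\<close>
  satisfies \<open>u \<bullet> w \<le> 0\<close>, while \<open>v \<bullet> w\<close> is the squared norm of \<open>x\<close>; and \<open>w\<close> is bounded by \<open>K\<close> times
  the norm of \<open>x\<close>.\<close>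

lemma limiting_normal_adjoint_eq_0:
  assumes z: "z \<in> \<Omega>" "z \<in> W" and v: "v \<in> limiting_normal_cone \<Omega> z"
    and x: "x \<in> range p" and adj: "\<And>y. v \<bullet> y = x \<bullet> p y"
  shows "x = 0"
proof -
  have "x \<bullet> x \<le> e * (K * norm x)" if e: "0 < e" for e
  proof -
    obtain r where r: "r > 0" "ball z r \<subseteq> W" using open_W z(2) open_contains_ball by blast
    obtain a u where a: "a \<in> \<Omega>" "dist a z < r" and u: "u \<in> regular_normal_cone \<Omega> a" "norm (v - u) < e"
      using v e r(1) unfolding mem_limiting_normal_cone_iff by blast
    have aW: "a \<in> W" using a(2) r(2) by (auto simp: dist_commute)
    obtain w where w: "w \<in> tangent_cone \<Omega> a" "p w = x" using tangent_lift[OF a(1) aW x] by blast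
    have "norm w \<le> K * norm x"
      using paratingent_norm_le[OF aW] tangent_subset_paratingent[OF a(1)] w by blast
    have "x \<bullet> x = v \<bullet> w" by (simp add: adj w(2))
    also have "\<dots> = u \<bullet> w + (v - u) \<bullet> w" by (simp add: inner_diff_left)
    also have "u \<bullet> w \<le> 0" using u(1) w(1) by (simp add: regular_normal_cone_def polar_cone_def)
    also have "(v - u) \<bullet> w \<le> norm (v - u) * norm w" by (rule norm_cauchy_schwarz)
    also have "\<dots> \<le> e * (K * norm x)" using u(2) e \<open>norm w \<le> K * norm x\<close> by (intro mult_mono) auto
    finally show ?thesis by simp
  qed
  then have "x \<bullet> x \<le> 0" by (rule nonpos_of_le_mult_epsilon)
  then show ?thesis by (metis inner_eq_zero_iff inner_ge_zero order_antisym)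
qed

text \<open>If \<open>x\<close> in \<open>range p\<close> is orthogonal to the image \<open>R\<close> of \<open>N\<^sup>\<bottom>\<close> under \<open>p\<close>, then the adjoint of
  \<open>p\<close> maps \<open>x\<close> into \<open>N\<^sup>\<bottom>\<^sup>\<bottom> = N\<close>, hence \<open>x = 0\<close>. So \<open>R\<close> is all of \<open>range p\<close>.\<close>

lemma strictly_smooth_of_limiting_normal_subspace:
  assumes z: "z \<in> \<Omega>" "z \<in> W" and closed: "locally_closed_at \<Omega> z"
    and sub: "subspace (limiting_normal_cone \<Omega> z)"
  shows "strictly_smooth \<Omega> z"
proof (rule strictly_smooth_of_regular_tangent_onto[OF z])
  let ?N = "limiting_normal_cone \<Omega> z"
  have perp: "?N\<^sup>\<bottom> \<subseteq> regular_tangent_cone \<Omega> z"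
    using polar_limiting_normal_subset_regular_tangent[OF z(1) closed] by (simp add: polar_cone_subspace[OF sub])
  define R where "R = p ` (?N\<^sup>\<bottom>)"
  have R: "subspace R" unfolding R_def by (intro linear_subspace_image lin subspace_orthogonal_comp)
  have "range p \<subseteq> R"
  proof
    fix x0 assume x0: "x0 \<in> range p"
    define x where "x = x0 - orth_proj R x0"
    have "orth_proj R x0 \<in> R" by (rule orth_proj_in[OF R])
    then have x: "x \<in> range p" using x0 subspace_diff[OF subspace_range] by (auto simp: x_def R_def)
    have xR: "x \<in> R\<^sup>\<bottom>" unfolding x_def by (rule orth_proj_compl[OF R])
    define v where "v = adjoint p x"
    have adj: "v \<bullet> y = x \<bullet> p y" for y
      unfolding v_def using adjoint_works[OF lin, of y x] by (simp add: inner_commute)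
    have "v \<in> ?N\<^sup>\<bottom>\<^sup>\<bottom>"
      using xR adj by (auto simp: orthogonal_comp_def orthogonal_def R_def inner_commute)
    then have "v \<in> ?N" by (simp add: orthogonal_comp_self[OF sub])
    from limiting_normal_adjoint_eq_0[OF z this x adj] have "x0 = orth_proj R x0" by (simp add: x_def)
    then show "x0 \<in> R" using orth_proj_in[OF R, of x0] by simp
  qed
  also have "R \<subseteq> p ` regular_tangent_cone \<Omega> z" unfolding R_def using perp by blast
  finally show "range p \<subseteq> p ` regular_tangent_cone \<Omega> z" .
qed

text \<open>Here the bipolar of the tangent cone lies in the regular tangent cone.\<close>

lemma strictly_smooth_of_normal_regularity:
  assumes z: "z \<in> \<Omega>" "z \<in> W" and closed: "locally_closed_at \<Omega> z"
    and reg: "regular_normal_cone \<Omega> z = limiting_normal_cone \<Omega> z"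
  shows "strictly_smooth \<Omega> z"
proof (rule strictly_smooth_of_regular_tangent_onto[OF z])
  have "tangent_cone \<Omega> z \<subseteq> polar_cone (regular_normal_cone \<Omega> z)"
    by (auto simp: regular_normal_cone_def polar_cone_def inner_commute)
  also have "\<dots> \<subseteq> regular_tangent_cone \<Omega> z"
    unfolding reg by (rule polar_limiting_normal_subset_regular_tangent[OF z(1) closed])
  finally have T: "tangent_cone \<Omega> z \<subseteq> regular_tangent_cone \<Omega> z" .
  show "range p \<subseteq> p ` regular_tangent_cone \<Omega> z"
  proof
    fix h assume "h \<in> range p"
    then obtain w where "w \<in> tangent_cone \<Omega> z" "p w = h" using tangent_lift[OF z] by metis
    with T show "h \<in> p ` regular_tangent_cone \<Omega> z" by blast
  qed
qed

end

section \<open>Limits of tangent subspaces\<close>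

lemma orth_proj_diff_le:
  assumes "subspace L1" "subspace L2"
  shows "norm (orth_proj L1 x - orth_proj L2 x) \<le> subspace_dist L1 L2 * norm x"
proof -
  have "bounded_linear (\<lambda>x. orth_proj L1 x - orth_proj L2 x)"
    using linear_orth_proj[OF assms(1)] linear_orth_proj[OF assms(2)]
    by (intro bounded_linear_sub) (simp_all only: linear_conv_bounded_linear)
  then show ?thesis unfolding subspace_dist_def by (rule onorm)
qed

lemma subspace_limit_closed:
  fixes L :: "'a::euclidean_space set"
  assumes L: "subspace L" "\<And>k. subspace (T k)" and conv: "(\<lambda>k. subspace_dist (T k) L) \<longlonglongrightarrow> 0"
    and w: "\<And>k. w k \<in> T k" "w \<longlonglongrightarrow> v"
  shows "v \<in> L"
proof -
  have blP: "bounded_linear (orth_proj L)" using linear_orth_proj[OF L(1)] by (simp only: linear_conv_bounded_linear)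
  have le: "norm (w k - orth_proj L (w k)) \<le> subspace_dist (T k) L * norm (w k)" for k
    using orth_proj_diff_le[OF L(2) L(1), of k "w k"] by (simp add: orth_proj_id[OF L(2) w(1)])
  have "(\<lambda>k. subspace_dist (T k) L * norm (w k)) \<longlonglongrightarrow> 0 * norm v" by (intro tendsto_intros conv w(2))
  then have lim0: "(\<lambda>k. subspace_dist (T k) L * norm (w k)) \<longlonglongrightarrow> 0" by simp
  have "(\<lambda>k. w k - orth_proj L (w k)) \<longlonglongrightarrow> 0"
    by (rule Lim_null_comparison[OF always_eventually lim0]) (simp add: le)
  moreover have "(\<lambda>k. w k - orth_proj L (w k)) \<longlonglongrightarrow> v - orth_proj L v"
    by (intro tendsto_diff w(2) bounded_linear.tendsto[OF blP])
  ultimately have "v = orth_proj L v" using LIMSEQ_unique by fastforce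
  then show ?thesis using orth_proj_in[OF L(1)] by metis
qed

lemma subspace_limit_approx:
  fixes L :: "'a::euclidean_space set"
  assumes L: "subspace L" "\<And>k. subspace (T k)" and conv: "(\<lambda>k. subspace_dist (T k) L) \<longlonglongrightarrow> 0"
    and v: "v \<in> L"
  shows "(\<lambda>k. orth_proj (T k) v) \<longlonglongrightarrow> v"
proof -
  have le: "norm (orth_proj (T k) v - v) \<le> subspace_dist (T k) L * norm v" for k
    using orth_proj_diff_le[OF L(2) L(1), of k v] by (simp add: orth_proj_id[OF L(1) v])
  have "(\<lambda>k. subspace_dist (T k) L * norm v) \<longlonglongrightarrow> 0 * norm v" by (intro tendsto_intros conv)
  then have lim0: "(\<lambda>k. subspace_dist (T k) L * norm v) \<longlonglongrightarrow> 0" by simp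
  have "(\<lambda>k. orth_proj (T k) v - v) \<longlonglongrightarrow> 0"
    by (rule Lim_null_comparison[OF always_eventually lim0]) (simp add: le)
  then show ?thesis by (rule LIM_zero_cancel)
qed

text \<open>Orthogonal projections are bounded operators, so a subsequence converges; idempotence and
  symmetry pass to the limit, which therefore projects onto its set of fixed points.\<close>

lemma subspaces_sequentially_compact:
  fixes T :: "nat \<Rightarrow> 'a::euclidean_space set"
  assumes T: "\<And>k. subspace (T k)"
  obtains L s where "subspace L" "strict_mono s" "(\<lambda>k. subspace_dist (T (s k)) L) \<longlonglongrightarrow> 0"
proof -
  have bl: "bounded_linear (orth_proj (T k))" for k
    using linear_orth_proj[OF T] by (simp only: linear_conv_bounded_linear)
  define P where "P k = Blinfun (orth_proj (T k))" for k
  have P: "blinfun_apply (P k) = orth_proj (T k)" for k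
    unfolding P_def by (rule bounded_linear_Blinfun_apply[OF bl])
  have "norm (P k) \<le> 1" for k
    by (rule norm_blinfun_bound) (simp_all add: P orth_proj_norm_le[OF T])
  then have "bounded (range P)" by (auto simp: bounded_iff)
  then obtain Q s where s: "strict_mono s" "(P \<circ> s) \<longlonglongrightarrow> Q"
    using bounded_imp_convergent_subsequence by blast
  have lim: "(\<lambda>k. orth_proj (T (s k)) (x k)) \<longlonglongrightarrow> blinfun_apply Q y" if "x \<longlonglongrightarrow> y" for x y
  proof -
    have "(\<lambda>k. blinfun_apply ((P \<circ> s) k) (x k)) \<longlonglongrightarrow> blinfun_apply Q y"
      by (intro blinfun.tendsto s(2) that)
    then show ?thesis by (simp add: P)
  qed
  define L where "L = {x. blinfun_apply Q x = x}"
  have L: "subspace L"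
    by (auto simp: L_def subspace_def blinfun.add_right blinfun.scaleR_right)
  have PQ: "orth_proj L x = blinfun_apply Q x" for x
  proof (rule orth_proj_unique[OF L])
    have "orth_proj (T (s k)) (orth_proj (T (s k)) x) = orth_proj (T (s k)) x" for k
      by (rule orth_proj_id[OF T orth_proj_in[OF T]])
    then have "(\<lambda>k. orth_proj (T (s k)) x) \<longlonglongrightarrow> blinfun_apply Q (blinfun_apply Q x)"
      using lim[OF lim[OF tendsto_const[of x]]] by simp
    then have "blinfun_apply Q (blinfun_apply Q x) = blinfun_apply Q x"
      using lim[OF tendsto_const[of x]] LIMSEQ_unique by blast
    then show "blinfun_apply Q x \<in> L" by (simp add: L_def)
    have "(x - blinfun_apply Q x) \<bullet> w = 0" if "w \<in> L" for w
    proof -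
      have "(\<lambda>k. (x - orth_proj (T (s k)) x) \<bullet> orth_proj (T (s k)) w) \<longlonglongrightarrow> (x - blinfun_apply Q x) \<bullet> blinfun_apply Q w"
        by (intro tendsto_inner tendsto_diff tendsto_const lim)
      moreover have "(x - orth_proj (T (s k)) x) \<bullet> orth_proj (T (s k)) w = 0" for k
        using orth_proj_compl[OF T, of x "s k"] orth_proj_in[OF T, of "s k" w]
        by (auto simp: orthogonal_comp_def orthogonal_def inner_commute)
      ultimately have "(\<lambda>_::nat. 0) \<longlonglongrightarrow> (x - blinfun_apply Q x) \<bullet> blinfun_apply Q w" by (simp only:)
      then have "(x - blinfun_apply Q x) \<bullet> blinfun_apply Q w = 0"
        by (rule LIMSEQ_unique[OF _ tendsto_const])
      then show ?thesis using that by (simp add: L_def)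
    qed
    then show "x - blinfun_apply Q x \<in> L\<^sup>\<bottom>" by (simp add: orthogonal_comp_def orthogonal_def inner_commute)
  qed
  have "subspace_dist (T (s k)) L = norm ((P \<circ> s) k - Q)" for k
  proof -
    have "(\<lambda>x. orth_proj (T (s k)) x - orth_proj L x) = blinfun_apply ((P \<circ> s) k - Q)"
      by (simp add: blinfun.diff_left P PQ fun_eq_iff)
    then show ?thesis by (simp add: subspace_dist_def norm_blinfun.rep_eq)
  qed
  moreover have "(\<lambda>k. norm ((P \<circ> s) k - Q)) \<longlonglongrightarrow> 0"
    using tendsto_norm[OF tendsto_diff[OF s(2) tendsto_const[of Q]]] by simp
  ultimately have "(\<lambda>k. subspace_dist (T (s k)) L) \<longlonglongrightarrow> 0" by simp
  with that L s(1) show thesis by blast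
qed

text \<open>For \<open>\<Omega> = gph F\<close> this is the generalized SC derivative.\<close>

definition tangent_subspace_limits :: "'a::euclidean_space set \<Rightarrow> 'a \<Rightarrow> 'a set set" where
  "tangent_subspace_limits \<Omega> z = {L. subspace L \<and>
     (\<exists>a. a \<longlonglongrightarrow> z \<and> (\<forall>k::nat. a k \<in> \<Omega> \<and> subspace (tangent_cone \<Omega> (a k))) \<and>
          (\<lambda>k. subspace_dist (tangent_cone \<Omega> (a k)) L) \<longlonglongrightarrow> 0)}"

lemma tangent_subspace_limitsE:
  assumes "L \<in> tangent_subspace_limits \<Omega> z"
  obtains a where "subspace L" "a \<longlonglongrightarrow> z" "\<And>k::nat. a k \<in> \<Omega>" "\<And>k. subspace (tangent_cone \<Omega> (a k))"
    "(\<lambda>k. subspace_dist (tangent_cone \<Omega> (a k)) L) \<longlonglongrightarrow> 0"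
  using assms unfolding tangent_subspace_limits_def by blast

lemma tangent_limit_in_paratingent:
  assumes a: "\<And>k::nat. a k \<in> \<Omega>" "a \<longlonglongrightarrow> z" and w: "\<And>k. w k \<in> tangent_cone \<Omega> (a k)" "w \<longlonglongrightarrow> v"
  shows "v \<in> paratingent_cone \<Omega> z"
  unfolding mem_paratingent_cone_iff
proof (intro allI impI)
  fix e d :: real assume ed: "0 < e" "0 < d"
  have "\<forall>\<^sub>F k in sequentially. dist (a k) z < d \<and> dist (w k) v < e/2"
    using ed by (intro eventually_conj tendstoD[OF a(2)] tendstoD[OF w(2)]) auto
  then obtain k where k: "dist (a k) z < d" "dist (w k) v < e/2" by (auto simp: eventually_sequentially)
  obtain t b where t: "0 < t" "t < d" and b: "b \<in> \<Omega>" "norm (b - a k - t *\<^sub>R w k) < (e/2) * t"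
    using w(1)[of k] half_gt_zero[OF ed(1)] ed(2) unfolding mem_tangent_cone_iff by meson
  have "b - a k - t *\<^sub>R v = (b - a k - t *\<^sub>R w k) + t *\<^sub>R (w k - v)" by (simp add: algebra_simps)
  then have "norm (b - a k - t *\<^sub>R v) \<le> norm (b - a k - t *\<^sub>R w k) + norm (t *\<^sub>R (w k - v))"
    by (simp only: norm_triangle_ineq)
  moreover have "norm (t *\<^sub>R (w k - v)) = t * dist (w k) v" using t(1) by (simp add: dist_norm)
  moreover have "t * dist (w k) v < t * (e/2)" using k(2) t(1) by (rule mult_strict_left_mono)
  ultimately have "norm (b - a k - t *\<^sub>R v) < e * t" using b(2) by (simp add: algebra_simps)
  with a(1) k(1) t b(1) show "\<exists>a\<in>\<Omega>. \<exists>t. dist a z < d \<and> 0 < t \<and> t < d \<and> (\<exists>b\<in>\<Omega>. norm (b - a - t *\<^sub>R v) < e * t)"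
    by blast
qed

text \<open>A limit \<open>L\<close> of tangent subspaces lies in the paratingent cone, and it contains every regular
  tangent because regular tangents are approximated by tangents at nearby points.\<close>

lemma strictly_smooth_tangent_subspace_limits:
  fixes z :: "'a::euclidean_space"
  assumes smooth: "strictly_smooth \<Omega> z" and z: "z \<in> \<Omega>"
  shows "tangent_subspace_limits \<Omega> z = {tangent_cone \<Omega> z}"
proof
  let ?T = "tangent_cone \<Omega> z"
  note eq = strictly_smooth_cones_eq[OF smooth z]
  have sub: "subspace ?T" using strictly_smooth_imp_subspace[OF smooth z] by (simp add: eq)
  have "(\<lambda>k::nat. subspace_dist ?T ?T) \<longlonglongrightarrow> 0" by (simp add: subspace_dist_def onorm_zero)
  then show "{?T} \<subseteq> tangent_subspace_limits \<Omega> z"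
    using sub z unfolding tangent_subspace_limits_def by (auto intro!: exI[of _ "\<lambda>_. z"])
  show "tangent_subspace_limits \<Omega> z \<subseteq> {?T}"
  proof
    fix L assume "L \<in> tangent_subspace_limits \<Omega> z"
    then obtain a where L: "subspace L" and a: "a \<longlonglongrightarrow> z" "\<And>k. a k \<in> \<Omega>" and T: "\<And>k. subspace (tangent_cone \<Omega> (a k))"
      and conv: "(\<lambda>k. subspace_dist (tangent_cone \<Omega> (a k)) L) \<longlonglongrightarrow> 0"
      using tangent_subspace_limitsE by metis
    have "L \<subseteq> ?T"
    proof
      fix v assume "v \<in> L"
      then have "(\<lambda>k. orth_proj (tangent_cone \<Omega> (a k)) v) \<longlonglongrightarrow> v"
        by (rule subspace_limit_approx[OF L T conv])
      then show "v \<in> ?T"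
        unfolding eq(1) by (rule tangent_limit_in_paratingent[OF a(2,1) orth_proj_in[OF T]])
    qed
    moreover have "?T \<subseteq> L"
    proof
      fix v assume "v \<in> ?T"
      then have v: "v \<in> regular_tangent_cone \<Omega> z" by (simp add: eq)
      let ?P = "orth_proj L"
      note linP = linear_orth_proj[OF L]
      have "norm (v - ?P v) \<le> e * 3" if e: "0 < e" for e
      proof -
        obtain d where d: "0 < d" "\<And>b. b \<in> \<Omega> \<Longrightarrow> dist b z < d \<Longrightarrow> \<exists>w\<in>tangent_cone \<Omega> b. norm (w - v) \<le> e"
          using regular_tangent_cone_approx_tangent[OF v z e] by metis
        have "(\<lambda>k. subspace_dist (tangent_cone \<Omega> (a k)) L * (norm v + e)) \<longlonglongrightarrow> 0 * (norm v + e)"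
          by (intro tendsto_intros conv)
        then have "\<forall>\<^sub>F k in sequentially. dist (a k) z < d \<and> subspace_dist (tangent_cone \<Omega> (a k)) L * (norm v + e) < e"
          using e by (intro eventually_conj tendstoD[OF a(1) d(1)] order_tendstoD(2)) auto
        then obtain k where k: "dist (a k) z < d" "subspace_dist (tangent_cone \<Omega> (a k)) L * (norm v + e) < e"
          by (auto simp: eventually_sequentially)
        obtain w where w: "w \<in> tangent_cone \<Omega> (a k)" "norm (w - v) \<le> e" using d(2)[OF a(2) k(1)] by blast
        have nw: "norm w \<le> norm v + e" using w(2) norm_triangle_ineq[of v "w - v"] by simp
        have "norm (w - ?P w) \<le> subspace_dist (tangent_cone \<Omega> (a k)) L * norm w"
          using orth_proj_diff_le[OF T L, of k w] by (simp add: orth_proj_id[OF T w(1)])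
        also have "\<dots> \<le> subspace_dist (tangent_cone \<Omega> (a k)) L * (norm v + e)"
        proof (rule mult_left_mono[OF nw])
          show "0 \<le> subspace_dist (tangent_cone \<Omega> (a k)) L"
            unfolding subspace_dist_def using linear_orth_proj[OF T] linP
            by (intro onorm_pos_le bounded_linear_sub) (simp_all only: linear_conv_bounded_linear)
        qed
        finally have 1: "norm (w - ?P w) \<le> e" using k(2) by simp
        have 2: "norm (?P (w - v)) \<le> e" using orth_proj_norm_le[OF L, of "w - v"] w(2) by simp
        have "v - ?P v = (w - ?P w) - (w - v) + ?P (w - v)" by (simp add: linear_diff[OF linP])
        then have "norm (v - ?P v) \<le> norm ((w - ?P w) - (w - v)) + norm (?P (w - v))"
          by (simp only: norm_triangle_ineq)
        also have "norm ((w - ?P w) - (w - v)) \<le> norm (w - ?P w) + norm (w - v)" by (rule norm_triangle_ineq4)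
        finally show ?thesis using 1 2 w(2) by simp
      qed
      then have "norm (v - ?P v) \<le> 0" by (rule nonpos_of_le_mult_epsilon)
      then have "v = ?P v" by simp
      then show "v \<in> L" using orth_proj_in[OF L] by metis
    qed
    ultimately show "L \<in> {?T}" by blast
  qed
qed

context lipschitz_patch
begin

lemma inj_on_patch: "inj_on p (\<Omega> \<inter> W)"
proof (rule inj_onI)
  fix a b assume "a \<in> \<Omega> \<inter> W" "b \<in> \<Omega> \<inter> W" "p a = p b"
  then show "a = b" using contr[of a b] by simp
qed

text \<open>The inverse of the projection, composed with the projection itself: a Lipschitz map onto \<open>\<Omega>
  \<inter> W\<close> which is defined on an open set of the ambient space, so that Rademacher's theorem applies
  to it. It fixes \<open>\<Omega> \<inter> W\<close> pointwise.\<close>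

definition chart_domain :: "'a set" where "chart_domain = p -` (p ` (\<Omega> \<inter> W))"

definition param :: "'a \<Rightarrow> 'a" where "param e = inv_into (\<Omega> \<inter> W) p (p e)"

lemma open_chart_domain: "open chart_domain"
proof -
  obtain V where V: "open V" "p ` (\<Omega> \<inter> W) = range p \<inter> V" using openin_proj by (auto simp: openin_open)
  then have "chart_domain = p -` V" by (auto simp: chart_domain_def)
  then show ?thesis using V(1) linear_continuous_on[OF bounded_linear_p] by (simp add: open_vimage)
qed

lemma param_in: "e \<in> chart_domain \<Longrightarrow> param e \<in> \<Omega> \<inter> W"
  unfolding chart_domain_def param_def by (rule inv_into_into) simp

lemma p_param: "e \<in> chart_domain \<Longrightarrow> p (param e) = p e"
  unfolding chart_domain_def param_def by (rule f_inv_into_f) simp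

lemma param_eqI: "b \<in> \<Omega> \<Longrightarrow> b \<in> W \<Longrightarrow> p e = p b \<Longrightarrow> e \<in> chart_domain \<and> param e = b"
  unfolding chart_domain_def param_def using inv_into_f_f[OF inj_on_patch, of b] by auto

lemma param_lipschitz: obtains L where "L-lipschitz_on chart_domain param"
proof -
  obtain B where B: "0 < B" "\<And>x. norm (p x) \<le> B * norm x" using norm_p_le by blast
  have "(K * B)-lipschitz_on chart_domain param"
  proof (rule lipschitz_onI)
    fix x y assume xy: "x \<in> chart_domain" "y \<in> chart_domain"
    have "norm (param x - param y) \<le> K * norm (p (param x) - p (param y))"
      using contr param_in xy by auto
    also have "\<dots> = K * norm (p (x - y))" using xy by (simp add: p_param linear_diff[OF lin])
    also have "\<dots> \<le> K * (B * norm (x - y))" using B(2) K by (intro mult_left_mono)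
    finally show "dist (param x) (param y) \<le> K * B * dist x y" by (simp add: dist_norm)
  qed (use K B in simp)
  with that show thesis by blast
qed

lemma p_derivative_param:
  assumes e: "e \<in> chart_domain" and A: "(param has_derivative A) (at e)"
  shows "p (A v) = p v"
proof -
  have "((\<lambda>x. p (param x)) has_derivative (\<lambda>v. p (A v))) (at e)"
    by (rule bounded_linear.has_derivative[OF bounded_linear_p A])
  then have "(p has_derivative (\<lambda>v. p (A v))) (at e)"
    by (rule has_derivative_transform_within_open[OF _ open_chart_domain e]) (rule p_param)
  then show ?thesis
    using has_derivative_unique[OF _ bounded_linear_imp_has_derivative[OF bounded_linear_p]] by metis
qed

text \<open>A tangent \<open>w\<close> is realized by points \<open>b\<close> of \<open>\<Omega>\<close> near \<open>param e\<close>. Each is \<open>param (e + h)\<close> for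
  \<open>h = b - param e\<close>, so differentiability yields \<open>w = A w\<close>.\<close>

lemma tangent_cone_derivative_param:
  assumes e: "e \<in> chart_domain" and A: "(param has_derivative A) (at e)"
  shows "tangent_cone \<Omega> (param e) = range A"
proof
  have linA: "linear A" using A by (rule has_derivative_linear)
  have alt: "\<exists>d>0. \<forall>y. norm (y - e) < d \<longrightarrow> norm (param y - param e - A (y - e)) \<le> \<epsilon> * norm (y - e)" if "0 < \<epsilon>" for \<epsilon>
    using A that unfolding has_derivative_at_alt by blast
  show "range A \<subseteq> tangent_cone \<Omega> (param e)"
  proof clarify
    fix v
    show "A v \<in> tangent_cone \<Omega> (param e)"
      unfolding mem_tangent_cone_iff
    proof (intro allI impI)
      fix \<epsilon> d :: real assume \<epsilon>: "0 < \<epsilon>" "0 < d"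
      define N where "N = norm v + 1"
      have N: "N > 0" "norm v < N" by (auto simp: N_def add_nonneg_pos)
      obtain d1 where d1: "0 < d1" "\<And>y. norm (y - e) < d1 \<Longrightarrow> norm (param y - param e - A (y - e)) \<le> \<epsilon> / N * norm (y - e)"
        using alt[of "\<epsilon> / N"] \<epsilon>(1) N(1) by auto
      obtain d2 where d2: "0 < d2" "ball e d2 \<subseteq> chart_domain" using open_chart_domain e open_contains_ball by blast
      define m where "m = min d1 d2 / N"
      define t where "t = min d m / 2"
      have t: "0 < t" "t < d" "t * N < min d1 d2"
      proof -
        have m: "0 < m" using d1(1) d2(1) N(1) by (simp add: m_def)
        then show "0 < t" "t < d" using \<epsilon>(2) by (auto simp: t_def)
        have "t < m" using m \<epsilon>(2) by (auto simp: t_def)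
        then show "t * N < min d1 d2" using N(1) by (simp only: m_def pos_less_divide_eq)
      qed
      have tv: "norm (t *\<^sub>R v) = t * norm v" using t(1) by simp
      have "t * norm v < t * N" using t(1) N(2) by (rule mult_strict_left_mono[rotated])
      then have small: "t * norm v < d1" "t * norm v < d2" using t(3) by auto
      have "norm (param (e + t *\<^sub>R v) - param e - A (e + t *\<^sub>R v - e)) \<le> \<epsilon> / N * norm (e + t *\<^sub>R v - e)"
        using small(1) tv by (intro d1(2)) (simp only: add_diff_cancel_left')
      then have "norm (param (e + t *\<^sub>R v) - param e - t *\<^sub>R A v) \<le> \<epsilon> / N * (t * norm v)"
        using t(1) by (simp add: linear_cmul[OF linA])
      also have "\<dots> < \<epsilon> / N * (t * N)"
        by (rule mult_strict_left_mono[OF \<open>t * norm v < t * N\<close>]) (simp add: \<epsilon>(1) N(1))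
      also have "\<dots> = \<epsilon> * t" using N(1) by simp
      finally have "norm (param (e + t *\<^sub>R v) - param e - t *\<^sub>R A v) < \<epsilon> * t" .
      moreover have "e + t *\<^sub>R v \<in> chart_domain" using d2(2) small(2) tv by (auto simp: dist_norm subset_iff)
      then have "param (e + t *\<^sub>R v) \<in> \<Omega>" using param_in by blast
      ultimately show "\<exists>t. 0 < t \<and> t < d \<and> (\<exists>b\<in>\<Omega>. norm (b - param e - t *\<^sub>R A v) < \<epsilon> * t)"
        using t(1,2) by blast
    qed
  qed
  show "tangent_cone \<Omega> (param e) \<subseteq> range A"
  proof
    fix w assume w: "w \<in> tangent_cone \<Omega> (param e)"
    obtain B where B: "0 < B" "\<And>x. norm (A x) \<le> B * norm x" using linear_bounded_pos[OF linA] by blast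
    define c where "c = norm w + 2 + B"
    have "norm (w - A w) \<le> \<epsilon> * c" if \<epsilon>: "0 < \<epsilon>" "\<epsilon> \<le> 1" for \<epsilon>
    proof -
      obtain d1 where d1: "0 < d1" "\<And>y. norm (y - e) < d1 \<Longrightarrow> norm (param y - param e - A (y - e)) \<le> \<epsilon> * norm (y - e)"
        using alt[OF \<epsilon>(1)] by blast
      obtain d2 where d2: "0 < d2" "ball (param e) d2 \<subseteq> W" using open_W param_in[OF e] open_contains_ball by blast
      define N where "N = norm w + 1"
      have N: "N > 0" by (simp add: N_def add_nonneg_pos)
      obtain t b where tb: "0 < t" "t < min d1 d2 / N" "b \<in> \<Omega>" "norm (b - param e - t *\<^sub>R w) < \<epsilon> * t"
        using w \<epsilon>(1) N d1(1) d2(1) unfolding mem_tangent_cone_iff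
        by (metis divide_pos_pos min_less_iff_conj)
      define h where "h = b - param e"
      define \<rho> where "\<rho> = h - t *\<^sub>R w"
      have \<rho>: "norm \<rho> < \<epsilon> * t" using tb(4) by (simp add: \<rho>_def h_def)
      have tN: "t * N < min d1 d2" using tb(2) N by (simp only: pos_less_divide_eq)
      have \<epsilon>t: "\<epsilon> * t \<le> 1 * t" using \<epsilon>(2) tb(1) by (intro mult_right_mono) auto
      have "norm h \<le> norm \<rho> + norm (t *\<^sub>R w)" using norm_triangle_ineq[of \<rho> "t *\<^sub>R w"] by (simp add: \<rho>_def)
      moreover have tw: "norm (t *\<^sub>R w) = t * norm w" using tb(1) by simp
      ultimately have hN: "norm h \<le> t * N" using \<rho> \<epsilon>t unfolding N_def distrib_left by linarith
      have "b \<in> W" using d2(2) hN tN by (auto simp: h_def dist_norm norm_minus_commute subset_iff)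
      have "p (e + h) = p b" by (simp add: h_def linear_add[OF lin] linear_diff[OF lin] p_param[OF e])
      from param_eqI[OF tb(3) \<open>b \<in> W\<close> this] have "param (e + h) = b" by blast
      then have "norm (h - A h) \<le> \<epsilon> * norm h" using d1(2)[of "e + h"] hN tN by (simp add: h_def)
      also have "\<dots> \<le> \<epsilon> * (t * N)" using hN \<epsilon>(1) by simp
      finally have 1: "norm (h - A h) \<le> \<epsilon> * (t * N)" .
      have 2: "norm (\<rho> - A \<rho>) \<le> \<epsilon> * t + B * (\<epsilon> * t)"
      proof -
        have "norm (\<rho> - A \<rho>) \<le> norm \<rho> + norm (A \<rho>)" by (rule norm_triangle_ineq4)
        moreover have "B * norm \<rho> \<le> B * (\<epsilon> * t)" using \<rho> B(1) by simp
        ultimately show ?thesis using \<rho> B(2)[of \<rho>] by linarith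
      qed
      have "t *\<^sub>R (w - A w) = (h - A h) - (\<rho> - A \<rho>)"
        by (simp add: \<rho>_def linear_diff[OF linA] linear_cmul[OF linA] algebra_simps)
      then have "norm (t *\<^sub>R (w - A w)) \<le> norm (h - A h) + norm (\<rho> - A \<rho>)" by (simp only: norm_triangle_ineq4)
      moreover have "norm (t *\<^sub>R (w - A w)) = t * norm (w - A w)" using tb(1) by simp
      moreover have "\<epsilon> * (t * N) + (\<epsilon> * t + B * (\<epsilon> * t)) = t * (\<epsilon> * c)"
        by (simp add: c_def N_def algebra_simps)
      ultimately have "t * norm (w - A w) \<le> t * (\<epsilon> * c)" using 1 2 by linarith
      then show ?thesis using tb(1) by simp
    qed
    then have "norm (w - A w) \<le> 0" by (rule nonpos_of_le_mult_epsilon)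
    then have "w = A w" by simp
    then show "w \<in> range A" by blast
  qed
qed

text \<open>Along points \<open>e \<rightarrow> z\<close> that violate the estimate, the ranges of the derivatives are tangent
  subspaces and subconverge, necessarily to \<open>L\<close>. The values at \<open>v\<close> are bounded and cluster at an
  element of \<open>L\<close> with projection \<open>p v\<close>. As \<open>p\<close> is injective on \<open>L\<close>, this element is \<open>l\<close>.\<close>

lemma derivative_param_limit:
  assumes z: "z \<in> \<Omega>" "z \<in> W" and single: "tangent_subspace_limits \<Omega> z = {L}"
    and l: "l \<in> L" "p l = p v" and \<epsilon>: "0 < \<epsilon>"
  obtains d where "0 < d" "\<And>e A. dist e z < d \<Longrightarrow> (param has_derivative A) (at e) \<Longrightarrow> norm (A v - l) \<le> \<epsilon>"
proof (rule ccontr)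
  note ret = that
  assume "\<not> thesis"
  have "L \<in> tangent_subspace_limits \<Omega> z" using single by simp
  then obtain b where L: "subspace L" and b: "b \<longlonglongrightarrow> z" "\<And>k. b k \<in> \<Omega>" and T: "\<And>k. subspace (tangent_cone \<Omega> (b k))"
    and conv: "(\<lambda>k. subspace_dist (tangent_cone \<Omega> (b k)) L) \<longlonglongrightarrow> 0"
    using tangent_subspace_limitsE by metis
  have L_bound: "norm w \<le> K * norm (p w)" if "w \<in> L" for w
  proof -
    have "(\<lambda>k. orth_proj (tangent_cone \<Omega> (b k)) w) \<longlonglongrightarrow> w" by (rule subspace_limit_approx[OF L T conv that])
    from tangent_limit_in_paratingent[OF b(2,1) orth_proj_in[OF T] this]
    show ?thesis by (rule paratingent_norm_le[OF z(2)])
  qed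
  have zd: "z \<in> chart_domain" "param z = z" using param_eqI[OF z refl] by auto
  obtain R where R: "0 < R" "ball z R \<subseteq> chart_domain" using open_chart_domain zd(1) open_contains_ball by blast
  obtain r0 :: "nat \<Rightarrow> real" where r0: "\<And>k. 0 < r0 k" "r0 \<longlonglongrightarrow> 0" using inverse_Suc_seq by blast
  define r where "r k = min (r0 k) R" for k
  have r: "0 < r k" "r k \<le> r0 k" "r k \<le> R" for k using r0(1)[of k] R by (auto simp: r_def)
  have "\<exists>e A. dist e z < r k \<and> (param has_derivative A) (at e) \<and> \<not> norm (A v - l) \<le> \<epsilon>" for k
    using \<open>\<not> thesis\<close> ret[OF r(1)] by metis
  then obtain e A where eA: "\<And>k. dist (e k) z < r k" "\<And>k. (param has_derivative A k) (at (e k))"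
    "\<And>k. \<not> norm (A k v - l) \<le> \<epsilon>" by metis
  have ed: "e k \<in> chart_domain" for k
  proof -
    have "dist (e k) z < R" using eA(1)[of k] r(3)[of k] by linarith
    then show ?thesis using R(2) by (auto simp: dist_commute)
  qed
  have "dist (e k) z \<le> r0 k" for k using eA(1)[of k] r(2)[of k] by simp
  then have e0: "e \<longlonglongrightarrow> z" by (rule dist_null_imp_tendsto[OF _ r0(2)])
  define a where "a k = param (e k)" for k
  have a: "a k \<in> \<Omega>" "a k \<in> W" for k using param_in[OF ed] by (auto simp: a_def)
  have a0: "a \<longlonglongrightarrow> z"
  proof -
    obtain Lc where "Lc-lipschitz_on chart_domain param" using param_lipschitz by blast
    then have "continuous_on chart_domain param" by (rule lipschitz_on_continuous_on)
    then have "isCont param z" using zd(1) open_chart_domain by (simp add: continuous_on_eq_continuous_at)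
    from isCont_tendsto_compose[OF this e0] show ?thesis by (simp add: zd(2) a_def[abs_def])
  qed
  have TA: "tangent_cone \<Omega> (a k) = range (A k)" for k
    unfolding a_def by (rule tangent_cone_derivative_param[OF ed eA(2)])
  have Tsub: "subspace (tangent_cone \<Omega> (a k))" for k
    unfolding TA using has_derivative_linear[OF eA(2)] by (simp add: linear_subspace_image)
  obtain L' s where L': "subspace L'" and s: "strict_mono s"
    and conv': "(\<lambda>k. subspace_dist (tangent_cone \<Omega> (a (s k))) L') \<longlonglongrightarrow> 0"
    using subspaces_sequentially_compact[of "\<lambda>k. tangent_cone \<Omega> (a k)", OF Tsub] by metis
  have "L' \<in> tangent_subspace_limits \<Omega> z"
    unfolding tangent_subspace_limits_def
    using L' conv' a(1) Tsub LIMSEQ_subseq_LIMSEQ[OF a0 s] by (auto intro!: exI[of _ "\<lambda>k. a (s k)"] simp: o_def)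
  then have "L' = L" using single by simp
  have Av: "A k v \<in> tangent_cone \<Omega> (a k)" "p (A k v) = p v" for k
    using p_derivative_param[OF ed eA(2)] by (auto simp: TA)
  have "norm (A k v) \<le> K * norm (p v)" for k
    using paratingent_norm_le[OF a(2)] tangent_subset_paratingent[OF a(1)] Av by (metis subsetD)
  then obtain w s' where s': "strict_mono s'" "(\<lambda>k. A (s (s' k)) v) \<longlonglongrightarrow> w"
    using bounded_subsequence[of "\<lambda>k. A (s k) v"] by metis
  have "w \<in> L"
  proof (rule subspace_limit_closed[OF L])
    show "(\<lambda>k. subspace_dist (tangent_cone \<Omega> (a (s (s' k)))) L) \<longlonglongrightarrow> 0"
      using LIMSEQ_subseq_LIMSEQ[OF conv' s'(1)] by (simp add: \<open>L' = L\<close> o_def)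
    show "(\<lambda>k. A (s (s' k)) v) \<longlonglongrightarrow> w" by (rule s'(2))
  qed (auto simp: Tsub Av)
  moreover have "p w = p v"
    using bounded_linear.tendsto[OF bounded_linear_p s'(2)] by (simp add: Av LIMSEQ_const_iff)
  ultimately have "w = l" using L_bound[of "w - l"] subspace_diff[OF L] l by (simp add: linear_diff[OF lin])
  have "(\<lambda>k. norm (A (s (s' k)) v - l)) \<longlonglongrightarrow> norm (w - l)" by (intro tendsto_intros s'(2))
  then have "\<epsilon> \<le> norm (w - l)"
    by (rule LIMSEQ_le_const) (use eA(3) in \<open>auto simp: not_le less_imp_le\<close>)
  with \<open>w = l\<close> \<epsilon> show False by simp
qed

text \<open>The derivatives at \<open>v\<close> are close to a fixed \<open>l\<close> near \<open>z\<close>, so by the mean value inequality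
  \<open>param (a + t v)\<close> realizes \<open>l\<close> as a regular tangent; and \<open>p l = p v\<close> is an arbitrary element of
  \<open>range p\<close>.\<close>

lemma strictly_smooth_of_single_tangent_limit:
  assumes z: "z \<in> \<Omega>" "z \<in> W" and single: "tangent_subspace_limits \<Omega> z = {L}"
  shows "strictly_smooth \<Omega> z"
proof (rule strictly_smooth_of_regular_tangent_onto[OF z])
  have "L \<in> tangent_subspace_limits \<Omega> z" using single by simp
  then obtain a where L: "subspace L" and a: "a \<longlonglongrightarrow> z" "\<And>k. a k \<in> \<Omega>" and T: "\<And>k. subspace (tangent_cone \<Omega> (a k))"
    and conv: "(\<lambda>k. subspace_dist (tangent_cone \<Omega> (a k)) L) \<longlonglongrightarrow> 0"
    using tangent_subspace_limitsE by metis
  have zd: "z \<in> chart_domain" "param z = z" using param_eqI[OF z refl] by auto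
  obtain R where R: "0 < R" "ball z R \<subseteq> chart_domain \<inter> W"
    using open_Int[OF open_chart_domain open_W] zd(1) z(2) open_contains_ball by (metis IntI)
  obtain Lc where Lc: "Lc-lipschitz_on chart_domain param" using param_lipschitz by blast
  show "range p \<subseteq> p ` regular_tangent_cone \<Omega> z"
  proof clarify
    fix v
    obtain l where l: "l \<in> L" "p l = p v"
    proof -
      obtain N where N: "\<And>k. k \<ge> N \<Longrightarrow> a k \<in> W"
        using topological_tendstoD[OF a(1) open_W z(2)] by (auto simp: eventually_sequentially)
      define b where "b k = a (k + N)" for k
      have b: "b k \<in> \<Omega>" "b k \<in> W" "subspace (tangent_cone \<Omega> (b k))" for k using a(2) N T by (auto simp: b_def)
      have convb: "(\<lambda>k. subspace_dist (tangent_cone \<Omega> (b k)) L) \<longlonglongrightarrow> 0"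
        unfolding b_def by (rule LIMSEQ_ignore_initial_segment[OF conv])
      have "\<exists>w. w \<in> tangent_cone \<Omega> (b k) \<and> p w = p v" for k
        using tangent_lift[OF b(1,2), of "p v"] by (metis rangeI)
      then obtain w where w: "\<And>k. w k \<in> tangent_cone \<Omega> (b k)" "\<And>k. p (w k) = p v" by metis
      have "norm (w k) \<le> K * norm (p v)" for k
        using paratingent_norm_le[OF b(2)] tangent_subset_paratingent[OF b(1)] w by (metis subsetD)
      then obtain l s where s: "strict_mono s" "(\<lambda>k. w (s k)) \<longlonglongrightarrow> l"
        using bounded_subsequence[of w] by metis
      have "l \<in> L"
      proof (rule subspace_limit_closed[OF L])
        show "(\<lambda>k. subspace_dist (tangent_cone \<Omega> (b (s k))) L) \<longlonglongrightarrow> 0"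
          using LIMSEQ_subseq_LIMSEQ[OF convb s(1)] by (simp add: o_def)
        show "(\<lambda>k. w (s k)) \<longlonglongrightarrow> l" by (rule s(2))
      qed (auto simp: b w)
      moreover have "p l = p v"
        using bounded_linear.tendsto[OF bounded_linear_p s(2)] by (simp add: w LIMSEQ_const_iff)
      ultimately show thesis by (rule that)
    qed
    have "l \<in> regular_tangent_cone \<Omega> z"
      unfolding mem_regular_tangent_cone_iff[OF z(1)]
    proof (intro allI impI)
      fix \<epsilon> :: real assume \<epsilon>: "0 < \<epsilon>"
      obtain d where d: "0 < d" "\<And>e A. dist e z < d \<Longrightarrow> (param has_derivative A) (at e) \<Longrightarrow> norm (A v - l) \<le> \<epsilon> / 2"
        using derivative_param_limit[OF z single l half_gt_zero[OF \<epsilon>]] by metis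
      define r where "r = min d R"
      have r: "0 < r" "r \<le> d" "r \<le> R" using d(1) R(1) by (auto simp: r_def)
      define V where "V = ball z r"
      have V: "open V" "convex V" "V \<subseteq> chart_domain" "V \<subseteq> W"
        using R(2) r(3) by (auto simp: V_def subset_iff)
      have lip: "Lc-lipschitz_on V param" using Lc V(3) by (rule lipschitz_on_subset)
      define N where "N = norm v + 1"
      have N: "N \<ge> 1" by (simp add: N_def)
      show "\<exists>d>0. \<forall>a\<in>\<Omega>. \<forall>t. dist a z < d \<longrightarrow> 0 < t \<longrightarrow> t < d \<longrightarrow> (\<exists>b\<in>\<Omega>. norm (b - a - t *\<^sub>R l) < \<epsilon> * t)"
      proof (intro exI[of _ "r / (2 * N)"] conjI ballI allI impI)
        show "0 < r / (2 * N)" using r(1) N by simp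
        fix a t assume a: "a \<in> \<Omega>" "dist a z < r / (2 * N)" and t: "0 < t" "t < r / (2 * N)"
        have "r / (2 * N) \<le> r / 2" using r(1) N by (intro divide_left_mono) auto
        then have az: "dist a z < r / 2" using a(2) by simp
        have "t * (2 * N) < r" using t(2) N by (subst (asm) pos_less_divide_eq) auto
        then have "2 * (t * N) < r" by simp
        moreover have "t * norm v \<le> t * N" using t(1) by (intro mult_left_mono) (auto simp: N_def)
        moreover have "norm (t *\<^sub>R v) = t * norm v" using t(1) by simp
        ultimately have tv: "norm (t *\<^sub>R v) < r / 2" by linarith
        have aV: "a \<in> V" using az r(1) by (simp add: V_def dist_commute)
        have "dist (a + t *\<^sub>R v) z \<le> dist (a + t *\<^sub>R v) a + dist a z" by (rule dist_triangle)
        then have "dist (a + t *\<^sub>R v) z < r" using az tv by (simp add: dist_norm)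
        then have atV: "a + t *\<^sub>R v \<in> V" by (simp add: V_def dist_commute)
        have "norm (param (a + t *\<^sub>R v) - param a - t *\<^sub>R l) \<le> \<epsilon> / 2 * t"
        proof (rule lipschitz_increment_of_derivative_near[OF lip V(1,2) _ less_imp_le[OF t(1)] aV atV])
          show "norm (A v - l) \<le> \<epsilon> / 2" if "e \<in> V" "(param has_derivative A) (at e)" for e A
            using d(2)[of e A] that r(2) by (simp add: V_def dist_commute)
        qed
        moreover have "param a = a" using param_eqI[OF a(1) _ refl] aV V(4) by blast
        moreover have "\<epsilon> / 2 * t < \<epsilon> * t" using \<epsilon> t(1) by simp
        moreover have "param (a + t *\<^sub>R v) \<in> \<Omega>" using param_in atV V(3) by blast
        ultimately show "\<exists>b\<in>\<Omega>. norm (b - a - t *\<^sub>R l) < \<epsilon> * t"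
          by (intro bexI[of _ "param (a + t *\<^sub>R v)"]) auto
      qed
    qed
    then show "p v \<in> p ` regular_tangent_cone \<Omega> z" using l(2) by (metis imageI)
  qed
qed

end

section \<open>Set-valued mappings\<close>

lemma SC_derivative_eq: "SC_derivative F x y = tangent_subspace_limits (gph F) (x, y)"
  unfolding SC_derivative_def tangent_subspace_limits_def subspace_tangent_points_def by auto

lemma gph_strict_derivative: "gph (strict_derivative F x y) = paratingent_cone (gph F) (x, y)"
  by (auto simp: gph_def strict_derivative_def)

lemma gph_graphical_derivative: "gph (graphical_derivative F x y) = tangent_cone (gph F) (x, y)"
  by (auto simp: gph_def graphical_derivative_def)

text \<open>The adjoint of a subspace and the graph of the coderivative are the images of the orthogonal
  complement and of the limiting normal cone under this isometry.\<close>

definition rotate_pair :: "'a::real_normed_vector \<times> 'b::real_normed_vector \<Rightarrow> 'b \<times> 'a" where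
  "rotate_pair w = (- snd w, fst w)"

lemma linear_rotate_pair: "linear rotate_pair"
  by (rule linearI) (auto simp: rotate_pair_def)

lemma inj_rotate_pair: "inj rotate_pair"
  by (rule injI) (auto simp: rotate_pair_def prod_eq_iff)

lemma rotate_pair_image: "rotate_pair ` N = {(y', x'). (x', - y') \<in> N}"
proof
  show "rotate_pair ` N \<subseteq> {(y', x'). (x', - y') \<in> N}" by (auto simp: rotate_pair_def)
  show "{(y', x'). (x', - y') \<in> N} \<subseteq> rotate_pair ` N"
  proof clarify
    fix x' y' assume "(x', - y') \<in> N"
    then have "rotate_pair (x', - y') \<in> rotate_pair ` N" by (rule imageI)
    then show "(y', x') \<in> rotate_pair ` N" by (simp add: rotate_pair_def)
  qed
qed

lemma gph_limiting_coderivative: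
  "gph (limiting_coderivative F x y) = rotate_pair ` limiting_normal_cone (gph F) (x, y)"
  by (auto simp: gph_def limiting_coderivative_def rotate_pair_image)

lemma adjoint_subspace_eq: "adjoint_subspace L = rotate_pair ` (L\<^sup>\<bottom>)"
  by (simp add: adjoint_subspace_def rotate_pair_image)

lemma subspace_rotate_pair_iff: "subspace (rotate_pair ` N) \<longleftrightarrow> subspace N"
proof
  assume s: "subspace (rotate_pair ` N)"
  have "rotate_pair -` (rotate_pair ` N) = N" by (rule inj_vimage_image_eq[OF inj_rotate_pair])
  then show "subspace N" using linear_subspace_vimage[OF linear_rotate_pair s] by simp
qed (rule linear_subspace_image[OF linear_rotate_pair])

lemma dim_rotate_pair:
  fixes N :: "('a::euclidean_space \<times> 'b::euclidean_space) set"
  shows "dim (rotate_pair ` N) = dim N"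
  using linear_rotate_pair inj_rotate_pair by (intro dim_image_eq) (auto intro: inj_on_subset)

lemma inj_on_adjoint_subspace: "inj_on adjoint_subspace {L. subspace L}"
proof (rule inj_onI)
  fix L1 L2 :: "('a \<times> 'b) set"
  assume sub: "L1 \<in> {L. subspace L}" "L2 \<in> {L. subspace L}" and "adjoint_subspace L1 = adjoint_subspace L2"
  then have "L1\<^sup>\<bottom> = L2\<^sup>\<bottom>" by (simp only: adjoint_subspace_eq inj_image_eq_iff[OF inj_rotate_pair])
  then show "L1 = L2" using sub orthogonal_comp_self by (metis mem_Collect_eq)
qed

text \<open>Taking adjoints is injective on subspaces, as \<open>L\<^sup>\<bottom>\<^sup>\<bottom> = L\<close>.\<close>

lemma is_singleton_adjoint_SC_iff:
  "is_singleton (adjoint_SC_derivative F x y) \<longleftrightarrow> is_singleton (SC_derivative F x y)"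
proof -
  have "SC_derivative F x y \<subseteq> {L. subspace L}" by (auto simp: SC_derivative_def)
  then have "inj_on adjoint_subspace (SC_derivative F x y)" by (rule inj_on_subset[OF inj_on_adjoint_subspace])
  then have "bij_betw adjoint_subspace (SC_derivative F x y) (adjoint_SC_derivative F x y)"
    by (simp add: adjoint_SC_derivative_def bij_betw_def)
  then show ?thesis by (metis bij_betw_same_card is_singleton_altdef)
qed

text \<open>Each condition is reduced to one of the criteria (A) and (B) above, by means of the patch at
  \<open>z\<close> that every Lipschitz manifold provides.\<close>

lemma strictly_smooth_equivalences:
  fixes z :: "'a::euclidean_space"
  assumes z: "z \<in> \<Omega>" and closed: "locally_closed_at \<Omega> z"
  shows "strictly_smooth \<Omega> z \<longleftrightarrow> (\<exists>d W \<Phi> S U f u. lipschitz_chart d \<Omega> z W \<Phi> S U f \<and>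
        u \<in> U \<and> u + f u = \<Phi> z \<and> strictly_differentiable_within f U u)" (is "?s \<longleftrightarrow> ?chart")
    and "strictly_smooth \<Omega> z \<longleftrightarrow> (\<exists>d. lipschitz_manifold d \<Omega> z \<and>
        subspace (regular_tangent_cone \<Omega> z) \<and> dim (regular_tangent_cone \<Omega> z) = d)" (is "?s \<longleftrightarrow> ?reg")
    and "strictly_smooth \<Omega> z \<longleftrightarrow> (\<exists>d. lipschitz_manifold d \<Omega> z) \<and> subspace (paratingent_cone \<Omega> z)" (is "?s \<longleftrightarrow> ?par")
    and "strictly_smooth \<Omega> z \<longleftrightarrow> (\<exists>d. lipschitz_manifold d \<Omega> z) \<and> subspace (limiting_normal_cone \<Omega> z)" (is "?s \<longleftrightarrow> ?nor")
    and "strictly_smooth \<Omega> z \<longleftrightarrow> (\<exists>d. lipschitz_manifold d \<Omega> z) \<and> regular_normal_cone \<Omega> z = limiting_normal_cone \<Omega> z"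
      (is "?s \<longleftrightarrow> ?regular")
    and "strictly_smooth \<Omega> z \<longleftrightarrow> (\<exists>d. lipschitz_manifold d \<Omega> z) \<and> is_singleton (tangent_subspace_limits \<Omega> z)"
      (is "?s \<longleftrightarrow> ?single")
proof -
  have chart: ?chart if ?s
    using strictly_smooth_imp_strictly_differentiable_chart[OF that z closed] by metis
  then have man: "\<exists>d. lipschitz_manifold d \<Omega> z" if ?s
    using chart[OF that] unfolding lipschitz_manifold_def by blast
  note dims = strictly_smooth_cones_eq[OF _ z] strictly_smooth_imp_subspace[OF _ z]
  show "?s \<longleftrightarrow> ?chart"
    using chart strictly_differentiable_chart_imp_strictly_smooth[OF _ z] by blast
  have reg: ?reg if s: ?s
  proof -
    obtain d where d: "lipschitz_manifold d \<Omega> z" using man[OF s] by blast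
    obtain p W K where "lipschitz_patch p \<Omega> W K" "z \<in> W" "dim (range p) = d"
      using lipschitz_manifold_imp_patch[OF d z] by blast
    then have "dim (paratingent_cone \<Omega> z) = d"
      using lipschitz_patch.dim_paratingent_cone[OF _ z] dims(3)[OF s] by blast
    with d show ?thesis using dims[OF s] by auto
  qed
  show "?s \<longleftrightarrow> ?reg"
  proof
    assume ?reg
    then obtain d where d: "lipschitz_manifold d \<Omega> z" "subspace (regular_tangent_cone \<Omega> z)" "dim (regular_tangent_cone \<Omega> z) = d"
      by blast
    obtain p W K where "lipschitz_patch p \<Omega> W K" "z \<in> W" "dim (range p) = d"
      using lipschitz_manifold_imp_patch[OF d(1) z] by blast
    then show ?s using lipschitz_patch.strictly_smooth_of_regular_tangent_dim[OF _ z _ d(2)] d(3) by blast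
  qed (rule reg)
  have patch: thesis
    if "\<exists>d. lipschitz_manifold d \<Omega> z" "\<And>p W K. lipschitz_patch p \<Omega> W K \<Longrightarrow> z \<in> W \<Longrightarrow> thesis" for thesis
    using that lipschitz_manifold_imp_patch[OF _ z] by metis
  show "?s \<longleftrightarrow> ?par"
  proof
    assume ?par
    show ?s
    proof (rule patch)
      fix p W K assume p: "lipschitz_patch p \<Omega> W K" "z \<in> W"
      have "inj_on p (paratingent_cone \<Omega> z)"
        using lipschitz_patch.inj_on_paratingent_if_subspace[OF p _ order_refl] \<open>?par\<close> by blast
      then show ?s by (rule lipschitz_patch.strictly_smooth_of_inj_on_paratingent[OF p(1) z p(2)])
    qed (use \<open>?par\<close> in blast)
  qed (use man dims in blast)
  show "?s \<longleftrightarrow> ?nor"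
  proof
    assume ?nor
    show ?s
    proof (rule patch)
      fix p W K assume p: "lipschitz_patch p \<Omega> W K" "z \<in> W"
      show ?s using lipschitz_patch.strictly_smooth_of_limiting_normal_subspace[OF p(1) z p(2) closed] \<open>?nor\<close> by blast
    qed (use \<open>?nor\<close> in blast)
  qed (use man strictly_smooth_normal_cones[OF _ z] in \<open>simp add: subspace_orthogonal_comp\<close>)
  show "?s \<longleftrightarrow> ?regular"
  proof
    assume ?regular
    show ?s
    proof (rule patch)
      fix p W K assume p: "lipschitz_patch p \<Omega> W K" "z \<in> W"
      show ?s using lipschitz_patch.strictly_smooth_of_normal_regularity[OF p(1) z p(2) closed] \<open>?regular\<close> by blast
    qed (use \<open>?regular\<close> in blast)
  qed (use man strictly_smooth_normal_cones[OF _ z] in simp)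
  show "?s \<longleftrightarrow> ?single"
  proof
    assume ?single
    then obtain L where L: "tangent_subspace_limits \<Omega> z = {L}" by (auto simp: is_singleton_def)
    show ?s
    proof (rule patch)
      fix p W K assume p: "lipschitz_patch p \<Omega> W K" "z \<in> W"
      show ?s by (rule lipschitz_patch.strictly_smooth_of_single_tangent_limit[OF p(1) z p(2) L])
    qed (use \<open>?single\<close> in blast)
  qed (use man strictly_smooth_tangent_subspace_limits[OF _ z] in \<open>simp add: is_singleton_def\<close>)
qed

theorem corollary3p3:
  fixes F :: "real ^ 'n \<Rightarrow> (real ^ 'm) set" and x :: "real ^ 'n" and y :: "real ^ 'm"
  assumes "(x, y) \<in> gph F"
    and "locally_closed_at (gph F) (x, y)"
  shows
    "(strictly_proto_differentiable F x y \<longleftrightarrow> graphically_strictly_differentiable F x y) \<and>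
     (strictly_proto_differentiable F x y \<longleftrightarrow>
        (\<exists>d. graphically_lipschitzian_dim d F x y \<and>
             subspace (regular_tangent_cone (gph F) (x, y)) \<and>
             dim (regular_tangent_cone (gph F) (x, y)) = d)) \<and>
     (strictly_proto_differentiable F x y \<longleftrightarrow>
        graphically_lipschitzian F x y \<and> subspace (gph (strict_derivative F x y))) \<and>
     (strictly_proto_differentiable F x y \<longleftrightarrow>
        graphically_lipschitzian F x y \<and> subspace (gph (limiting_coderivative F x y))) \<and>
     (strictly_proto_differentiable F x y \<longleftrightarrow>
        graphically_lipschitzian F x y \<and> graphically_regular F x y) \<and>
     (strictly_proto_differentiable F x y \<longleftrightarrow>
        graphically_lipschitzian F x y \<and> is_singleton (SC_derivative F x y)) \<and>
     (strictly_proto_differentiable F x y \<longleftrightarrow>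
        graphically_lipschitzian F x y \<and> is_singleton (adjoint_SC_derivative F x y)) \<and>
     (strictly_proto_differentiable F x y \<longrightarrow>
        (\<forall>d. graphically_lipschitzian_dim d F x y \<longrightarrow>
           subspace (gph (strict_derivative F x y)) \<and>
           dim (gph (strict_derivative F x y)) = d \<and>
           subspace (gph (graphical_derivative F x y)) \<and>
           dim (gph (graphical_derivative F x y)) = d \<and>
           subspace (regular_tangent_cone (gph F) (x, y)) \<and>
           dim (regular_tangent_cone (gph F) (x, y)) = d \<and>
           subspace (gph (limiting_coderivative F x y)) \<and>
           dim (gph (limiting_coderivative F x y)) = CARD('n) + CARD('m) - d) \<and>
        SC_derivative F x y = {gph (graphical_derivative F x y)} \<and>
        adjoint_SC_derivative F x y = {gph (limiting_coderivative F x y)})"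
proof -
  let ?\<Omega> = "gph F" and ?z = "(x, y)"
  note z = assms(1) and closed = assms(2)
  note equiv = strictly_smooth_equivalences[OF z closed]
  let ?T = "paratingent_cone ?\<Omega> ?z"
  have lip: "graphically_lipschitzian F x y \<longleftrightarrow> (\<exists>d. lipschitz_manifold d ?\<Omega> ?z)"
    by (simp add: graphically_lipschitzian_def graphically_lipschitzian_dim_def)
  have spd: "strictly_proto_differentiable F x y \<longleftrightarrow> strictly_smooth ?\<Omega> ?z"
    by (simp add: strictly_proto_differentiable_def)
  have i: "strictly_proto_differentiable F x y \<longleftrightarrow> graphically_strictly_differentiable F x y"
    unfolding spd equiv(1) graphically_strictly_differentiable_def graphically_strictly_differentiable_dim_def ..
  have ii: "strictly_proto_differentiable F x y \<longleftrightarrow>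
        (\<exists>d. graphically_lipschitzian_dim d F x y \<and>
             subspace (regular_tangent_cone (gph F) (x, y)) \<and>
             dim (regular_tangent_cone (gph F) (x, y)) = d)"
    unfolding spd equiv(2) graphically_lipschitzian_dim_def ..
  have iii: "strictly_proto_differentiable F x y \<longleftrightarrow>
        graphically_lipschitzian F x y \<and> subspace (gph (strict_derivative F x y))"
    unfolding spd equiv(3) lip gph_strict_derivative ..
  have iv: "strictly_proto_differentiable F x y \<longleftrightarrow>
        graphically_lipschitzian F x y \<and> subspace (gph (limiting_coderivative F x y))"
    unfolding spd equiv(4) lip gph_limiting_coderivative subspace_rotate_pair_iff ..
  have v: "strictly_proto_differentiable F x y \<longleftrightarrow> graphically_lipschitzian F x y \<and> graphically_regular F x y"
    unfolding spd equiv(5) lip graphically_regular_def ..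
  have vi: "strictly_proto_differentiable F x y \<longleftrightarrow>
        graphically_lipschitzian F x y \<and> is_singleton (SC_derivative F x y)"
    unfolding spd equiv(6) lip SC_derivative_eq ..
  then have vii: "strictly_proto_differentiable F x y \<longleftrightarrow>
        graphically_lipschitzian F x y \<and> is_singleton (adjoint_SC_derivative F x y)"
    unfolding is_singleton_adjoint_SC_iff .
  have dims: "subspace (gph (strict_derivative F x y)) \<and>
           dim (gph (strict_derivative F x y)) = d \<and>
           subspace (gph (graphical_derivative F x y)) \<and>
           dim (gph (graphical_derivative F x y)) = d \<and>
           subspace (regular_tangent_cone (gph F) (x, y)) \<and>
           dim (regular_tangent_cone (gph F) (x, y)) = d \<and>
           subspace (gph (limiting_coderivative F x y)) \<and>
           dim (gph (limiting_coderivative F x y)) = CARD('n) + CARD('m) - d"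
    if s: "strictly_smooth ?\<Omega> ?z" and d: "graphically_lipschitzian_dim d F x y" for d
  proof -
    note cones = strictly_smooth_cones_eq[OF s z] and L = strictly_smooth_imp_subspace[OF s z]
    obtain p W K where p: "lipschitz_patch p ?\<Omega> W K" "?z \<in> W" "dim (range p) = d"
      using lipschitz_manifold_imp_patch[OF d[unfolded graphically_lipschitzian_dim_def] z] by blast
    have dT: "dim ?T = d"
      using lipschitz_patch.dim_paratingent_cone[OF p(1) z p(2) L] p(3) by simp
    have "dim (gph (limiting_coderivative F x y)) = dim (?T\<^sup>\<bottom>)"
      unfolding gph_limiting_coderivative strictly_smooth_normal_cones[OF s z] by (rule dim_rotate_pair)
    also have "\<dots> = CARD('n) + CARD('m) - d"
      using dim_orthogonal_comp[OF L] dT by simp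
    finally have dN: "dim (gph (limiting_coderivative F x y)) = CARD('n) + CARD('m) - d" .
    have "subspace (gph (limiting_coderivative F x y))"
      unfolding gph_limiting_coderivative subspace_rotate_pair_iff strictly_smooth_normal_cones[OF s z]
      by (rule subspace_orthogonal_comp)
    with dN dT L show ?thesis by (simp add: gph_strict_derivative gph_graphical_derivative cones)
  qed
  have SC: "SC_derivative F x y = {gph (graphical_derivative F x y)}" if s: "strictly_smooth ?\<Omega> ?z"
    unfolding SC_derivative_eq gph_graphical_derivative by (rule strictly_smooth_tangent_subspace_limits[OF s z])
  have SC': "adjoint_SC_derivative F x y = {gph (limiting_coderivative F x y)}" if s: "strictly_smooth ?\<Omega> ?z"
    unfolding adjoint_SC_derivative_def SC[OF s] gph_limiting_coderivative strictly_smooth_normal_cones[OF s z]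
    by (simp add: adjoint_subspace_eq gph_graphical_derivative strictly_smooth_cones_eq[OF s z])
  show ?thesis
    using i ii iii iv v vi vii dims SC SC' unfolding spd by blast
qed

end
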